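(* Let $\Gamma=\mathbb{Z}^2$ and let $\omega_0$ be a pure state on $\mathcal{A}_\Gamma$ with GNS representation $\pi_0$. Suppose that there is a cone $\Lambda$ such that $\pi_0$ is quasi-equivalent to $\pi_\Lambda\otimes\pi_{\Lambda^c}$, where $\pi_\Lambda$ and $\pi_{\Lambda^c}$ are irreducible representations of $\mathcal{A}_\Lambda$ and $\mathcal{A}_{\Lambda^c}$ respectively. Let $\pi$ be a representation of $\mathcal{A}_\Gamma$ satisfying the superselection criterion with respect to $\pi_0$, i.e. for every cone $\Lambda'\subset\Gamma$ the restrictions $\pi|_{\mathcal{A}_{(\Lambda')^c}}$ and $\pi_0|_{\mathcal{A}_{(\Lambda')^c}}$ are quasi-equivalent. Then $\pi$ is quasi-equivalent to $\pi_0$. In particular, if $\pi$ is irreducible, then $\pi$ and $\pi_0$ are (unitarily) equivalent.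
   Context: Quantum spin system: each $x\in\Gamma=\mathbb{Z}^2$ carries a finite dimensional Hilbert space $\mathcal{H}_x$ with $\sup_x\dim\mathcal{H}_x<\infty$. For finite $\Lambda\subset\Gamma$, $\mathcal{A}_\Lambda=\bigotimes_{x\in\Lambda}\mathcal{B}(\mathcal{H}_x)$, with the natural inclusions; for any $\Lambda\subset\Gamma$, $\mathcal{A}_\Lambda$ is the norm closure of $\bigcup_{\Lambda_0\subset\Lambda\text{ finite}}\mathcal{A}_{\Lambda_0}$, and $\mathcal{A}_\Gamma\cong\mathcal{A}_\Lambda\otimes\mathcal{A}_{\Lambda^c}$ with $\Lambda^c=\Gamma\setminus\Lambda$. Cones: a cone is a set $\Lambda=\{x\in\mathbb{Z}^2:(x-a)\cdot e>|x-a|\cos\theta\}$ with apex $a\in\mathbb{R}^2$, axis direction a unit vector $e\in\mathbb{R}^2$, and half-opening angle $\theta\in(0,\pi/2)$. All representations are non-degenerate $*$-representations on Hilbert spaces. Two representations $\pi_1,\pi_2$ of a $C^*$-algebra $\mathcal{A}$ are quasi-equivalent if there is a $*$-isomorphism $\tau:\pi_1(\mathcal{A})''\to\pi_2(\mathcal{A})''$ with $\tau(\pi_1(A))=\pi_2(A)$ for all $A\in\mathcal{A}$. *)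

theory Defs
  imports "HOL-Analysis.Analysis"
begin

section \<open>Hilbert spaces and \<open>C\<^sup>*\<close>-algebras\<close>

class complex_vector = real_vector +
  fixes scaleC :: "complex \<Rightarrow> 'a \<Rightarrow> 'a" (infixr "*\<^sub>C" 75)
  assumes scaleC_add_right: "c *\<^sub>C (x + y) = c *\<^sub>C x + c *\<^sub>C y"
    and scaleC_add_left: "(b + c) *\<^sub>C x = b *\<^sub>C x + c *\<^sub>C x"
    and scaleC_scaleC: "b *\<^sub>C c *\<^sub>C x = (b * c) *\<^sub>C x"
    and scaleC_of_real: "complex_of_real r *\<^sub>C x = r *\<^sub>R x"

text \<open>The inner product is linear in its second argument.  Norm and topology are those of the
  underlying real inner product space, whose inner product is the real part of \<open>cinner\<close>.\<close>

class chilbert_space = complex_vector + real_inner + complete_space +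
  fixes cinner :: "'a \<Rightarrow> 'a \<Rightarrow> complex"
  assumes cinner_commute: "cinner x y = cnj (cinner y x)"
    and cinner_add_right: "cinner x (y + z) = cinner x y + cinner x z"
    and cinner_scaleC_right: "cinner x (c *\<^sub>C y) = c * cinner x y"
    and inner_eq_Re_cinner: "inner x y = Re (cinner x y)"

text \<open>Unital, with \<open>1 \<noteq> 0\<close> (part of \<^class>\<open>real_normed_algebra_1\<close>).\<close>

class cstar_algebra = complex_vector + real_normed_algebra_1 + complete_space +
  fixes star :: "'a \<Rightarrow> 'a"
  assumes norm_scaleC: "norm (c *\<^sub>C a) = cmod c * norm a"
    and scaleC_mult_left: "(c *\<^sub>C a) * b = c *\<^sub>C (a * b)"
    and scaleC_mult_right: "a * (c *\<^sub>C b) = c *\<^sub>C (a * b)"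
    and star_add: "star (a + b) = star a + star b"
    and star_scaleC: "star (c *\<^sub>C a) = cnj c *\<^sub>C star a"
    and star_mult: "star (a * b) = star b * star a"
    and star_star: "star (star a) = a"
    and cstar_identity: "norm (star a * a) = (norm a)\<^sup>2"

instantiation complex :: complex_vector
begin
definition scaleC_complex :: "complex \<Rightarrow> complex \<Rightarrow> complex" where
  "scaleC_complex c x = c * x"
instance
  by standard (simp_all add: scaleC_complex_def algebra_simps scaleR_conv_of_real)
end

instantiation complex :: chilbert_space
begin
definition cinner_complex :: "complex \<Rightarrow> complex \<Rightarrow> complex" where
  "cinner_complex x y = cnj x * y"
instance
  by standard
    (simp_all add: cinner_complex_def scaleC_complex_def inner_complex_def algebra_simps)
end

instantiation complex :: cstar_algebra
begin
definition star_complex :: "complex \<Rightarrow> complex" where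
  "star_complex = cnj"
instance
  by standard
    (simp_all add: star_complex_def scaleC_complex_def norm_mult power2_eq_square algebra_simps)
end

definition csubspace :: "'a::complex_vector set \<Rightarrow> bool" where
  "csubspace V \<longleftrightarrow> 0 \<in> V \<and> (\<forall>x\<in>V. \<forall>y\<in>V. x + y \<in> V) \<and> (\<forall>c. \<forall>x\<in>V. c *\<^sub>C x \<in> V)"


section \<open>Operator algebras and representations\<close>

text \<open>The elements of \<open>'h \<Rightarrow>\<^sub>L 'k\<close> are only real-linear.\<close>

definition bounded_ops :: "('h::chilbert_space \<Rightarrow>\<^sub>L 'k::chilbert_space) set" where
  "bounded_ops = {T. \<forall>c x. blinfun_apply T (c *\<^sub>C x) = c *\<^sub>C blinfun_apply T x}"

definition is_adjoint :: "('h::chilbert_space \<Rightarrow>\<^sub>L 'h) \<Rightarrow> ('h \<Rightarrow>\<^sub>L 'h) \<Rightarrow> bool" where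
  "is_adjoint S T \<longleftrightarrow>
     (\<forall>x y. cinner (blinfun_apply S x) y = cinner x (blinfun_apply T y))"

definition commutant :: "('h::chilbert_space \<Rightarrow>\<^sub>L 'h) set \<Rightarrow> ('h \<Rightarrow>\<^sub>L 'h) set" where
  "commutant X = {T \<in> bounded_ops. \<forall>S\<in>X. T o\<^sub>L S = S o\<^sub>L T}"

definition star_isomorphism ::
  "('h::chilbert_space \<Rightarrow>\<^sub>L 'h) set \<Rightarrow> ('k::chilbert_space \<Rightarrow>\<^sub>L 'k) set \<Rightarrow>
   (('h \<Rightarrow>\<^sub>L 'h) \<Rightarrow> ('k \<Rightarrow>\<^sub>L 'k)) \<Rightarrow> bool" where
  "star_isomorphism M N \<tau> \<longleftrightarrow>
     bij_betw \<tau> M N \<and>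
     (\<forall>S\<in>M. \<forall>T\<in>M. \<tau> (S + T) = \<tau> S + \<tau> T) \<and>
     (\<forall>c. \<forall>S\<in>M. \<forall>T\<in>M. (\<forall>x. blinfun_apply T x = c *\<^sub>C blinfun_apply S x) \<longrightarrow>
        (\<forall>y. blinfun_apply (\<tau> T) y = c *\<^sub>C blinfun_apply (\<tau> S) y)) \<and>
     (\<forall>S\<in>M. \<forall>T\<in>M. \<tau> (S o\<^sub>L T) = \<tau> S o\<^sub>L \<tau> T) \<and>
     (\<forall>S\<in>M. \<forall>T\<in>M. is_adjoint S T \<longrightarrow> is_adjoint (\<tau> S) (\<tau> T))"

text \<open>In the following, \<open>A\<close> is a \<open>*\<close>-subalgebra of an ambient \<open>C\<^sup>*\<close>-algebra, and only the values
  of \<open>\<pi>\<close> on \<open>A\<close> matter.  In particular the restriction of a representation to a smaller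
  subalgebra is given by the same function.\<close>

definition star_representation ::
  "'a::cstar_algebra set \<Rightarrow> ('a \<Rightarrow> 'h::chilbert_space \<Rightarrow>\<^sub>L 'h) \<Rightarrow> bool" where
  "star_representation A \<pi> \<longleftrightarrow>
     (\<forall>a\<in>A. \<pi> a \<in> bounded_ops) \<and>
     (\<forall>a\<in>A. \<forall>b\<in>A. \<pi> (a + b) = \<pi> a + \<pi> b) \<and>
     (\<forall>c. \<forall>a\<in>A. \<forall>x. blinfun_apply (\<pi> (c *\<^sub>C a)) x = c *\<^sub>C blinfun_apply (\<pi> a) x) \<and>
     (\<forall>a\<in>A. \<forall>b\<in>A. \<pi> (a * b) = \<pi> a o\<^sub>L \<pi> b) \<and>
     (\<forall>a\<in>A. is_adjoint (\<pi> (star a)) (\<pi> a)) \<and>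
     closure (span {blinfun_apply (\<pi> a) x |a x. a \<in> A}) = UNIV"

definition irreducible_rep ::
  "'a::cstar_algebra set \<Rightarrow> ('a \<Rightarrow> 'h::chilbert_space \<Rightarrow>\<^sub>L 'h) \<Rightarrow> bool" where
  "irreducible_rep A \<pi> \<longleftrightarrow>
     star_representation A \<pi> \<and> (UNIV :: 'h set) \<noteq> {0} \<and>
     (\<forall>V. csubspace V \<and> closed V \<and> (\<forall>a\<in>A. \<forall>x\<in>V. blinfun_apply (\<pi> a) x \<in> V) \<longrightarrow>
        V = {0} \<or> V = UNIV)"

definition quasi_equivalent ::
  "'a::cstar_algebra set \<Rightarrow> ('a \<Rightarrow> 'h::chilbert_space \<Rightarrow>\<^sub>L 'h) \<Rightarrow>
   ('a \<Rightarrow> 'k::chilbert_space \<Rightarrow>\<^sub>L 'k) \<Rightarrow> bool" where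
  "quasi_equivalent A \<pi>\<^sub>1 \<pi>\<^sub>2 \<longleftrightarrow>
     (\<exists>\<tau>. star_isomorphism (commutant (commutant (\<pi>\<^sub>1 ` A))) (commutant (commutant (\<pi>\<^sub>2 ` A))) \<tau> \<and>
          (\<forall>a\<in>A. \<tau> (\<pi>\<^sub>1 a) = \<pi>\<^sub>2 a))"

definition unitary_op :: "('h::chilbert_space \<Rightarrow>\<^sub>L 'k::chilbert_space) \<Rightarrow> bool" where
  "unitary_op U \<longleftrightarrow> U \<in> bounded_ops \<and> surj (blinfun_apply U) \<and>
     (\<forall>x y. cinner (blinfun_apply U x) (blinfun_apply U y) = cinner x y)"

definition unitarily_equivalent ::
  "'a::cstar_algebra set \<Rightarrow> ('a \<Rightarrow> 'h::chilbert_space \<Rightarrow>\<^sub>L 'h) \<Rightarrow>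
   ('a \<Rightarrow> 'k::chilbert_space \<Rightarrow>\<^sub>L 'k) \<Rightarrow> bool" where
  "unitarily_equivalent A \<pi>\<^sub>1 \<pi>\<^sub>2 \<longleftrightarrow>
     (\<exists>U. unitary_op U \<and> (\<forall>a\<in>A. U o\<^sub>L \<pi>\<^sub>1 a = \<pi>\<^sub>2 a o\<^sub>L U))"

definition state :: "('a::cstar_algebra \<Rightarrow> complex) \<Rightarrow> bool" where
  "state \<omega> \<longleftrightarrow>
     (\<forall>a b. \<omega> (a + b) = \<omega> a + \<omega> b) \<and>
     (\<forall>c a. \<omega> (c *\<^sub>C a) = c * \<omega> a) \<and>
     (\<forall>a. Im (\<omega> (star a * a)) = 0 \<and> 0 \<le> Re (\<omega> (star a * a))) \<and>
     \<omega> 1 = 1"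

definition pure_state :: "('a::cstar_algebra \<Rightarrow> complex) \<Rightarrow> bool" where
  "pure_state \<omega> \<longleftrightarrow> state \<omega> \<and>
     (\<forall>\<omega>\<^sub>1 \<omega>\<^sub>2 t. state \<omega>\<^sub>1 \<and> state \<omega>\<^sub>2 \<and> 0 < t \<and> t < 1 \<and>
        (\<forall>a. \<omega> a = complex_of_real t * \<omega>\<^sub>1 a + complex_of_real (1 - t) * \<omega>\<^sub>2 a) \<longrightarrow>
        \<omega>\<^sub>1 = \<omega> \<and> \<omega>\<^sub>2 = \<omega>)"

text \<open>The GNS triple is determined by these properties up to unitary equivalence.\<close>

definition GNS_representation ::
  "('a::cstar_algebra \<Rightarrow> complex) \<Rightarrow> ('a \<Rightarrow> 'h::chilbert_space \<Rightarrow>\<^sub>L 'h) \<Rightarrow> 'h \<Rightarrow> bool" where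
  "GNS_representation \<omega> \<pi> \<Omega> \<longleftrightarrow>
     star_representation UNIV \<pi> \<and>
     (\<forall>a. \<omega> a = cinner \<Omega> (blinfun_apply (\<pi> a) \<Omega>)) \<and>
     closure (range (\<lambda>a. blinfun_apply (\<pi> a) \<Omega>)) = UNIV"


section \<open>Tensor products of representations\<close>

text \<open>The Hilbert space \<open>'t\<close>, together with the elementary tensors \<open>x \<otimes> y = tens x y\<close>, is the
  Hilbert space tensor product of \<open>'h\<close> and \<open>'k\<close>.  This determines it up to a unique unitary that
  respects elementary tensors.\<close>

definition hilbert_tensor ::
  "('h::chilbert_space \<Rightarrow> 'k::chilbert_space \<Rightarrow> 't::chilbert_space) \<Rightarrow> bool" where
  "hilbert_tensor tens \<longleftrightarrow>
     (\<forall>x x' y. tens (x + x') y = tens x y + tens x' y) \<and>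
     (\<forall>x y y'. tens x (y + y') = tens x y + tens x y') \<and>
     (\<forall>c x y. tens (c *\<^sub>C x) y = c *\<^sub>C tens x y \<and> tens x (c *\<^sub>C y) = c *\<^sub>C tens x y) \<and>
     (\<forall>x x' y y'. cinner (tens x y) (tens x' y') = cinner x x' * cinner y y') \<and>
     closure (span {tens x y |x y. True}) = UNIV"

text \<open>\<open>\<sigma> = \<pi>\<^sub>1 \<otimes> \<pi>\<^sub>2\<close>, for commuting subalgebras \<open>A\<^sub>1\<close> and \<open>A\<^sub>2\<close> of an algebra that is identified with
  \<open>A\<^sub>1 \<otimes> A\<^sub>2\<close> through \<open>a \<otimes> b \<mapsto> a * b\<close>.\<close>

definition tensor_representation ::
  "('h::chilbert_space \<Rightarrow> 'k::chilbert_space \<Rightarrow> 't::chilbert_space) \<Rightarrow>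
   'a::cstar_algebra set \<Rightarrow> ('a \<Rightarrow> 'h \<Rightarrow>\<^sub>L 'h) \<Rightarrow>
   'a set \<Rightarrow> ('a \<Rightarrow> 'k \<Rightarrow>\<^sub>L 'k) \<Rightarrow>
   ('a \<Rightarrow> 't \<Rightarrow>\<^sub>L 't) \<Rightarrow> bool" where
  "tensor_representation tens A\<^sub>1 \<pi>\<^sub>1 A\<^sub>2 \<pi>\<^sub>2 \<sigma> \<longleftrightarrow>
     star_representation UNIV \<sigma> \<and>
     (\<forall>a\<in>A\<^sub>1. \<forall>b\<in>A\<^sub>2. \<forall>x y. blinfun_apply (\<sigma> (a * b)) (tens x y) =
        tens (blinfun_apply (\<pi>\<^sub>1 a) x) (blinfun_apply (\<pi>\<^sub>2 b) y))"


section \<open>Quantum spin systems on \<open>\<int>\<^sup>2\<close>\<close>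

type_synonym site = "int \<times> int"
type_synonym config = "site \<Rightarrow> nat"
type_synonym local_op = "config \<Rightarrow> config \<Rightarrow> complex"

text \<open>The Hilbert space at \<open>x\<close> is \<open>\<complex>\<close> to the power \<open>d x\<close>, with standard basis labelled by
  \<open>{..<d x}\<close>.  For finite \<open>\<Lambda>\<close>, the product basis of the tensor product of these spaces over
  \<open>x \<in> \<Lambda>\<close> is labelled by \<open>configs d \<Lambda>\<close>, and the tensor product over \<open>x \<in> \<Lambda>\<close> of the full operator
  algebras at \<open>x\<close> is the algebra of all operators on that space, here given by their matrices
  in the product basis.  The elementary tensor of the matrices \<open>m x\<close> has the matrix elements
  \<open>\<Prod>x\<in>\<Lambda>. m x (s x) (t x)\<close>.\<close>

definition configs :: "(site \<Rightarrow> nat) \<Rightarrow> site set \<Rightarrow> config set" where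
  "configs d \<Lambda> = (\<Pi>\<^sub>E x\<in>\<Lambda>. {..<d x})"

definition local_ops :: "(site \<Rightarrow> nat) \<Rightarrow> site set \<Rightarrow> local_op set" where
  "local_ops d \<Lambda> = {M. \<forall>s t. s \<notin> configs d \<Lambda> \<or> t \<notin> configs d \<Lambda> \<longrightarrow> M s t = 0}"

definition local_one :: "(site \<Rightarrow> nat) \<Rightarrow> site set \<Rightarrow> local_op" where
  "local_one d \<Lambda> = (\<lambda>s t. if s \<in> configs d \<Lambda> \<and> s = t then 1 else 0)"

definition local_mult :: "(site \<Rightarrow> nat) \<Rightarrow> site set \<Rightarrow> local_op \<Rightarrow> local_op \<Rightarrow> local_op" where
  "local_mult d \<Lambda> M N = (\<lambda>s t. \<Sum>u\<in>configs d \<Lambda>. M s u * N u t)"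

definition local_star :: "local_op \<Rightarrow> local_op" where
  "local_star M = (\<lambda>s t. cnj (M t s))"

text \<open>The natural inclusion \<open>M \<mapsto> M \<otimes> 1\<close> of the algebra of \<open>\<Lambda>\<^sub>0\<close> into that of
  \<open>\<Lambda>\<^sub>1 \<supseteq> \<Lambda>\<^sub>0\<close>.\<close>

definition local_incl :: "(site \<Rightarrow> nat) \<Rightarrow> site set \<Rightarrow> site set \<Rightarrow> local_op \<Rightarrow> local_op" where
  "local_incl d \<Lambda>\<^sub>0 \<Lambda>\<^sub>1 M = (\<lambda>s t.
     if s \<in> configs d \<Lambda>\<^sub>1 \<and> t \<in> configs d \<Lambda>\<^sub>1 \<and> (\<forall>x\<in>\<Lambda>\<^sub>1 - \<Lambda>\<^sub>0. s x = t x)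
     then M (restrict s \<Lambda>\<^sub>0) (restrict t \<Lambda>\<^sub>0) else 0)"

definition local_part ::
  "(site \<Rightarrow> nat) \<Rightarrow> (site set \<Rightarrow> local_op \<Rightarrow> 'a) \<Rightarrow> site set \<Rightarrow> 'a set" where
  "local_part d \<iota> \<Lambda> = (\<Union>\<Lambda>\<^sub>0\<in>{\<Lambda>\<^sub>0. finite \<Lambda>\<^sub>0 \<and> \<Lambda>\<^sub>0 \<subseteq> \<Lambda>}. \<iota> \<Lambda>\<^sub>0 ` local_ops d \<Lambda>\<^sub>0)"

definition algebra_of ::
  "(site \<Rightarrow> nat) \<Rightarrow> (site set \<Rightarrow> local_op \<Rightarrow> 'a::cstar_algebra) \<Rightarrow> site set \<Rightarrow> 'a set" where
  "algebra_of d \<iota> \<Lambda> = closure (local_part d \<iota> \<Lambda>)"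

text \<open>The type \<open>'a\<close>, with the embeddings \<open>\<iota> \<Lambda>\<close> for finite \<open>\<Lambda>\<close>, is the \<open>C\<^sup>*\<close>-inductive limit of the
  local algebras, that is, the algebra of the whole lattice.  (Injective \<open>*\<close>-homomorphisms into a
  \<open>C\<^sup>*\<close>-algebra are isometric, so this fixes \<open>'a\<close> up to a unique \<open>*\<close>-isomorphism compatible
  with the embeddings.)\<close>

locale quantum_spin_system =
  fixes d :: "site \<Rightarrow> nat"
    and \<iota> :: "site set \<Rightarrow> local_op \<Rightarrow> 'a::cstar_algebra"
  assumes dim_pos: "0 < d x"
    and dim_bounded: "\<exists>D. \<forall>x. d x \<le> D"
    and embed_inj: "finite \<Lambda> \<Longrightarrow> inj_on (\<iota> \<Lambda>) (local_ops d \<Lambda>)"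
    and embed_add: "finite \<Lambda> \<Longrightarrow> M \<in> local_ops d \<Lambda> \<Longrightarrow> N \<in> local_ops d \<Lambda> \<Longrightarrow>
          \<iota> \<Lambda> (\<lambda>s t. M s t + N s t) = \<iota> \<Lambda> M + \<iota> \<Lambda> N"
    and embed_scaleC: "finite \<Lambda> \<Longrightarrow> M \<in> local_ops d \<Lambda> \<Longrightarrow>
          \<iota> \<Lambda> (\<lambda>s t. c * M s t) = c *\<^sub>C \<iota> \<Lambda> M"
    and embed_mult: "finite \<Lambda> \<Longrightarrow> M \<in> local_ops d \<Lambda> \<Longrightarrow> N \<in> local_ops d \<Lambda> \<Longrightarrow>
          \<iota> \<Lambda> (local_mult d \<Lambda> M N) = \<iota> \<Lambda> M * \<iota> \<Lambda> N"
    and embed_star: "finite \<Lambda> \<Longrightarrow> M \<in> local_ops d \<Lambda> \<Longrightarrow>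
          \<iota> \<Lambda> (local_star M) = star (\<iota> \<Lambda> M)"
    and embed_one: "finite \<Lambda> \<Longrightarrow> \<iota> \<Lambda> (local_one d \<Lambda>) = 1"
    and embed_incl: "finite \<Lambda>\<^sub>1 \<Longrightarrow> \<Lambda>\<^sub>0 \<subseteq> \<Lambda>\<^sub>1 \<Longrightarrow> M \<in> local_ops d \<Lambda>\<^sub>0 \<Longrightarrow>
          \<iota> \<Lambda>\<^sub>1 (local_incl d \<Lambda>\<^sub>0 \<Lambda>\<^sub>1 M) = \<iota> \<Lambda>\<^sub>0 M"
    and embed_dense: "algebra_of d \<iota> UNIV = UNIV"

definition site_point :: "site \<Rightarrow> real \<times> real" where
  "site_point x = (real_of_int (fst x), real_of_int (snd x))"

definition cone :: "real \<times> real \<Rightarrow> real \<times> real \<Rightarrow> real \<Rightarrow> site set" where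
  "cone a e \<theta> = {x. inner (site_point x - a) e > norm (site_point x - a) * cos \<theta>}"

definition is_cone :: "site set \<Rightarrow> bool" where
  "is_cone \<Lambda> \<longleftrightarrow> (\<exists>a e \<theta>. norm e = 1 \<and> 0 < \<theta> \<and> \<theta> < pi / 2 \<and> \<Lambda> = cone a e \<theta>)"

definition superselection_criterion ::
  "(site \<Rightarrow> nat) \<Rightarrow> (site set \<Rightarrow> local_op \<Rightarrow> 'a::cstar_algebra) \<Rightarrow>
   ('a \<Rightarrow> 'h::chilbert_space \<Rightarrow>\<^sub>L 'h) \<Rightarrow> ('a \<Rightarrow> 'k::chilbert_space \<Rightarrow>\<^sub>L 'k) \<Rightarrow> bool" where
  "superselection_criterion d \<iota> \<pi>\<^sub>0 \<pi> \<longleftrightarrow>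
     (\<forall>\<Lambda>. is_cone \<Lambda> \<longrightarrow> quasi_equivalent (algebra_of d \<iota> (- \<Lambda>)) \<pi> \<pi>\<^sub>0)"

end

theory Submission
  imports Defs
begin

text \<open>
  Purity makes \<open>\<pi>\<^sub>0\<close> irreducible, and \<open>\<sigma> = \<pi>\<^sub>1 \<otimes> \<pi>\<^sub>2\<close> is irreducible as well, so the two are unitarily
  equivalent.  Rank-one projections of the two tensor factors therefore give projections \<open>E\<^sub>0\<close> and
  \<open>F\<^sub>0\<close> in the von Neumann algebras that \<open>\<pi>\<^sub>0\<close> generates over \<open>\<Lambda>\<close> and over \<open>- \<Lambda>\<close>, and
  \<open>E\<^sub>0 F\<^sub>0\<close> compresses \<open>\<pi>\<^sub>0\<close> to a product vector state \<open>w\<close>.  Let \<open>\<Lambda>'\<close> be a cone disjoint from \<open>\<Lambda>\<close>.  The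
  superselection criterion for \<open>\<Lambda>'\<close> and for \<open>\<Lambda>\<close> carries \<open>E\<^sub>0\<close> and \<open>F\<^sub>0\<close> to commuting projections \<open>E\<close>
  and \<open>F\<close> in the von Neumann algebra of \<open>\<pi>\<close>, and \<open>G = E F\<close> satisfies \<open>G \<pi>(c) G = w(c) G\<close>.  The von
  Neumann algebras of \<open>\<pi>\<close> over \<open>- \<Lambda>'\<close> and \<open>- \<Lambda>\<close> are factors, so \<open>G\<close> kills no nonzero operator that
  commutes with \<open>\<pi>\<close>, and \<open>\<pi>\<close> is a multiple of the GNS representation \<open>\<pi>\<^sub>0\<close> of \<open>w\<close>.  Only the algebraic
  properties of the given isomorphisms enter, not their normality.
\<close>

text \<open>The superselection criterion speaks only of complements of cones. So \<open>F0\<close>,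
  living over \<open>- \<Lambda>\<close>, can be carried to \<open>\<pi>\<close> at once, while
  \<open>E0\<close>, living over \<open>\<Lambda>\<close>, must first be viewed inside the larger
  algebra over \<open>- \<Lambda>'\<close>; this is what \<open>\<Lambda>'\<close> is for. The
  comparison of \<open>\<pi>\<^sub>0\<close> with \<open>\<sigma>\<close> is sharpened to a unitary
  for a similar reason: an isomorphism of the two full von Neumann algebras, used only
  algebraically, does not visibly match the bicommutants of a subalgebra such as that of
  \<open>\<Lambda>\<close>, whereas conjugation by a unitary does. The state of a projection is
  encoded by the identity \<open>E o\<^sub>L \<pi> a o\<^sub>L E = cmul c o\<^sub>L E\<close>, which
  any isomorphism preserves. That \<open>\<pi>\<close> is a multiple of \<open>\<pi>\<^sub>0\<close>
  is never written as a tensor product: compression by a single isometric intertwiner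
  \<open>V g\<close> is the isomorphism sought, and the intertwiners \<open>V k\<close> to the other
  copies give its injectivity and surjectivity. Square roots, obtained from one iteration, take the
  place of spectral calculus.\<close>

instance chilbert_space \<subseteq> banach ..
instance cstar_algebra \<subseteq> banach ..

section \<open>Hilbert spaces\<close>

lemma scaleC_simps [simp]:
  fixes x :: "'a::complex_vector"
  shows "0 *\<^sub>C x = 0" "1 *\<^sub>C x = x" "c *\<^sub>C (0::'a) = 0" "(-1) *\<^sub>C x = - x"
    and "c *\<^sub>C (- x) = - (c *\<^sub>C x)" "(-c) *\<^sub>C x = - (c *\<^sub>C x)"
proof -
  show 1: "0 *\<^sub>C x = 0" "1 *\<^sub>C x = x" "(-1) *\<^sub>C x = - x"
    using scaleC_of_real[of 0 x] scaleC_of_real[of 1 x] scaleC_of_real[of "-1" x] by simp_all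
  show 0: "c *\<^sub>C (0::'a) = 0"
    using scaleC_add_right[of c "0::'a" 0] by simp
  show "c *\<^sub>C (- x) = - (c *\<^sub>C x)"
    using scaleC_add_right[of c x "- x"] 0 by (simp add: minus_unique)
  show "(-c) *\<^sub>C x = - (c *\<^sub>C x)"
    using scaleC_add_left[of c "- c" x] 1 by (simp add: minus_unique)
qed

lemma scaleC_diff_right: "c *\<^sub>C (x - y) = c *\<^sub>C x - c *\<^sub>C (y::'a::complex_vector)"
  using scaleC_add_right[of c x "- y"] by simp

lemma scaleC_diff_left: "(b - c) *\<^sub>C x = b *\<^sub>C x - c *\<^sub>C (x::'a::complex_vector)"
  using scaleC_add_left[of b "- c" x] by simp

lemma scaleC_scaleR: "c *\<^sub>C (r *\<^sub>R x) = r *\<^sub>R (c *\<^sub>C (x::'a::complex_vector))"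
  by (metis mult.commute scaleC_of_real scaleC_scaleC)

section \<open>The complex inner product over the real one\<close>

lemma cinner_add_left: "cinner (x + y) z = cinner x z + cinner y (z::'a::chilbert_space)"
  by (metis cinner_add_right cinner_commute complex_cnj_add)

lemma cinner_scaleC_left: "cinner (c *\<^sub>C x) y = cnj c * cinner x (y::'a::chilbert_space)"
  by (metis cinner_commute cinner_scaleC_right complex_cnj_mult)

lemma cinner_zero [simp]: "cinner 0 (x::'a::chilbert_space) = 0" "cinner x (0::'a) = 0"
  using cinner_add_left[of 0 0 x] cinner_add_right[of x 0 0] by simp_all

lemma cinner_minus [simp]: "cinner (- x) (y::'a::chilbert_space) = - cinner x y"
  "cinner x (- y) = - cinner x y"
  using cinner_scaleC_left[of "-1" x y] cinner_scaleC_right[of x "-1" y] by simp_all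

lemma cinner_diff_left: "cinner (x - y) z = cinner x z - cinner y (z::'a::chilbert_space)"
  using cinner_add_left[of x "- y" z] by simp

lemma cinner_diff_right: "cinner x (y - z) = cinner x y - cinner x (z::'a::chilbert_space)"
  using cinner_add_right[of x y "- z"] by simp

lemma cinner_scaleR_right: "cinner x (r *\<^sub>R y) = r * cinner x (y::'a::chilbert_space)"
  by (metis cinner_scaleC_right scaleC_of_real)

lemma cinner_scaleR_left: "cinner (r *\<^sub>R x) y = r * cinner x (y::'a::chilbert_space)"
  by (metis cinner_scaleC_left complex_cnj_complex_of_real scaleC_of_real)

text \<open>Since Re (i z) = - Im z, the real product against \<open>\<i> *\<^sub>C y\<close>
  recovers the imaginary part. This is how facts obtained from the real Riesz theorem become complex
  ones.\<close>

lemma cinner_conv_inner: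
  "cinner x y = Complex (inner x y) (- inner x (\<i> *\<^sub>C (y::'a::chilbert_space)))"
  by (rule complex_eqI) (simp_all add: inner_eq_Re_cinner cinner_scaleC_right)

lemma cinner_self: "cinner x x = complex_of_real ((norm (x::'a::chilbert_space))\<^sup>2)"
proof (rule complex_eqI)
  show "Re (cinner x x) = Re (complex_of_real ((norm x)\<^sup>2))"
    by (simp add: inner_eq_Re_cinner[symmetric] power2_norm_eq_inner)
  have "Im (cinner x x) = Im (cnj (cinner x x))"
    using cinner_commute[of x x] by simp
  then show "Im (cinner x x) = Im (complex_of_real ((norm x)\<^sup>2))"
    by simp
qed

lemma norm_scaleC_hilbert [simp]: "norm (c *\<^sub>C (x::'a::chilbert_space)) = cmod c * norm x"
proof -
  have "cinner (c *\<^sub>C x) (c *\<^sub>C x) = (cmod c)\<^sup>2 * cinner x x"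
    by (simp add: cinner_scaleC_left cinner_scaleC_right complex_norm_square[of c]
        mult.assoc[symmetric] del: of_real_power)
  then have "(norm (c *\<^sub>C x))\<^sup>2 = (cmod c * norm x)\<^sup>2"
    unfolding cinner_self of_real_mult[symmetric] of_real_eq_iff by (simp add: power_mult_distrib)
  then show ?thesis
    by simp
qed

lemma cinner_bound: "cmod (cinner x y) \<le> norm x * norm (y::'a::chilbert_space)"
proof (cases "cinner x y = 0")
  case False
  \<comment> \<open>The phase that rotates \<open>cinner x y\<close> onto the positive reals, where
    the real Cauchy-Schwarz inequality applies.\<close>
  define c where "c = cnj (cinner x y) / cmod (cinner x y)"
  have "c * cinner x y = complex_of_real (cmod (cinner x y))"
    using False by (simp add: c_def complex_norm_square[symmetric] power2_eq_square mult.commute)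
  then have "cmod (cinner x y) = inner x (c *\<^sub>C y)"
    by (simp add: inner_eq_Re_cinner cinner_scaleC_right)
  also have "\<dots> \<le> norm x * norm (c *\<^sub>C y)"
    by (rule norm_cauchy_schwarz)
  also have "norm (c *\<^sub>C y) = norm y"
    using False by (simp add: c_def norm_divide)
  finally show ?thesis .
qed simp

lemma bounded_bilinear_cinner: "bounded_bilinear (cinner :: 'a::chilbert_space \<Rightarrow> 'a \<Rightarrow> complex)"
  by standard
    (auto simp: cinner_add_left cinner_add_right cinner_scaleR_left cinner_scaleR_right
      scaleR_conv_of_real intro!: exI[of _ 1] cinner_bound)

lemmas continuous_on_cinner [continuous_intros] =
  bounded_bilinear.continuous_on[OF bounded_bilinear_cinner]

lemma bounded_linear_scaleC: "bounded_linear (\<lambda>x::'a::chilbert_space. c *\<^sub>C x)"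
  by (rule bounded_linear_intro[where K = "cmod c"])
    (auto simp: scaleC_add_right scaleC_scaleR mult.commute)

lemmas continuous_on_scaleC [continuous_intros] =
  bounded_linear.continuous_on[OF bounded_linear_scaleC]

lemma cinner_eq_zeroD: "(\<And>y. cinner y x = 0) \<Longrightarrow> x = (0::'a::chilbert_space)"
  using cinner_self[of x] by simp

lemma cinner_eqI: "(\<And>z. cinner z x = cinner z y) \<Longrightarrow> x = (y::'a::chilbert_space)"
  using cinner_eq_zeroD[of "x - y"] by (simp add: cinner_diff_right)

lemma csubspaceD:
  assumes "csubspace V"
  shows "0 \<in> V" "x \<in> V \<Longrightarrow> y \<in> V \<Longrightarrow> x + y \<in> V" "x \<in> V \<Longrightarrow> c *\<^sub>C x \<in> V"
  using assms unfolding csubspace_def by blast+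

lemma csubspace_imp_subspace: "csubspace V \<Longrightarrow> subspace V"
  unfolding csubspace_def subspace_def by (metis scaleC_of_real)

text \<open>The Riesz representation on a closed subspace \<open>V\<close>: the representing vector minimises
  \<open>\<parallel>x\<parallel>\<^sup>2 - 2 f x\<close> over \<open>V\<close>, and the parallelogram law makes a minimising sequence Cauchy.\<close>

lemma riesz_on_subspace:
  fixes V :: "'a::chilbert_space set" and f :: "'a \<Rightarrow> real"
  assumes "subspace V" "closed V" "bounded_linear f"
  obtains z where "z \<in> V" "\<And>x. x \<in> V \<Longrightarrow> inner z x = f x"
proof -
  interpret f: bounded_linear f by fact
  obtain K where K: "\<And>x. norm (f x) \<le> norm x * K"
    using f.nonneg_bounded by blast
  define \<phi> where "\<phi> x = (norm x)\<^sup>2 - 2 * f x" for x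
  have lower: "- K\<^sup>2 \<le> \<phi> x" for x
  proof -
    have "f x \<le> norm x * K"
      using K[of x] by simp
    moreover have "0 \<le> (norm x - K)\<^sup>2"
      by simp
    ultimately show ?thesis
      unfolding \<phi>_def power2_diff by (simp add: algebra_simps)
  qed
  define m where "m = Inf (\<phi> ` V)"
  have V0: "\<phi> ` V \<noteq> {}"
    using subspace_0[OF assms(1)] by blast
  have bdd: "bdd_below (\<phi> ` V)"
    using lower by (auto intro!: bdd_belowI)
  have m_le: "m \<le> \<phi> x" if "x \<in> V" for x
    unfolding m_def using that bdd by (auto intro: cInf_lower)
  have "\<exists>x\<in>V. \<phi> x < m + 1 / Suc n" for n
  proof -
    have "Inf (\<phi> ` V) < m + 1 / Suc n"
      by (simp add: m_def)
    then show ?thesis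
      using cInf_lessD[OF V0] by blast
  qed
  then obtain X where X: "\<And>n. X n \<in> V" "\<And>n. \<phi> (X n) < m + 1 / Suc n"
    by metis
  have par: "(norm (x - y))\<^sup>2 = 2 * (\<phi> x + \<phi> y) - 4 * \<phi> ((1/2) *\<^sub>R (x + y))" for x y
    unfolding \<phi>_def f.scaleR f.add power2_norm_eq_inner
    by (simp add: inner_simps inner_commute[of y x] algebra_simps)
  have dist_X: "(norm (X i - X j))\<^sup>2 \<le> 2 / Suc i + 2 / Suc j" for i j
  proof -
    have "m \<le> \<phi> ((1/2) *\<^sub>R (X i + X j))"
      by (intro m_le subspace_scale subspace_add assms X)
    then show ?thesis
      using X(2)[of i] X(2)[of j] unfolding par by argo
  qed
  have "Cauchy X"
    unfolding Cauchy_iff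
  proof (intro allI impI)
    fix e :: real assume "0 < e"
    then obtain N where N: "4 / Suc N < e\<^sup>2"
      using reals_Archimedean[of "e\<^sup>2 / 4"] by (auto simp: field_simps)
    show "\<exists>M. \<forall>i\<ge>M. \<forall>j\<ge>M. norm (X i - X j) < e"
    proof (intro exI allI impI)
      fix i j assume "N \<le> i" "N \<le> j"
      then have "2 / Suc i \<le> 2 / Suc N" "2 / Suc j \<le> 2 / Suc N"
        by (simp_all add: frac_le)
      then have "(norm (X i - X j))\<^sup>2 < e\<^sup>2"
        using dist_X[of i j] N by simp
      then show "norm (X i - X j) < e"
        using \<open>0 < e\<close> by (simp add: power_less_imp_less_base)
    qed
  qed
  then obtain z where z: "X \<longlonglongrightarrow> z"
    using Cauchy_convergent convergent_def by blast
  have zV: "z \<in> V"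
    using closed_sequentially[OF assms(2) _ z] X(1) by blast
  have "(\<lambda>n. \<phi> (X n)) \<longlonglongrightarrow> \<phi> z"
    unfolding \<phi>_def by (intro tendsto_intros f.tendsto z)
  moreover have "(\<lambda>n. m + 1 / Suc n) \<longlonglongrightarrow> m + 0"
    by (intro tendsto_intros LIMSEQ_Suc[OF lim_1_over_n])
  ultimately have phi_z: "\<phi> z \<le> m"
    using X(2) by (force intro: LIMSEQ_le less_imp_le)
  show thesis
  proof
    show "z \<in> V" by fact
    fix x assume x: "x \<in> V"
    define b where "b = inner z x - f x"
    have quad: "0 \<le> 2 * t * b + t\<^sup>2 * (norm x)\<^sup>2" for t
    proof -
      have "m \<le> \<phi> (z + t *\<^sub>R x)"
        by (intro m_le subspace_scale subspace_add assms zV x)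
      then have "0 \<le> \<phi> (z + t *\<^sub>R x) - \<phi> z"
        using phi_z by simp
      also have "\<dots> = 2 * t * b + t\<^sup>2 * (norm x)\<^sup>2"
        unfolding \<phi>_def f.scaleR f.add power2_norm_eq_inner b_def
        by (simp add: inner_simps inner_commute[of x z] algebra_simps power2_eq_square)
      finally show ?thesis .
    qed
    \<comment> \<open>The value t = - b s nearly minimises the quadratic. The \<open>+ 1\<close>
      allows x = 0 and keeps the factor s |x|^2 - 2 below -1, so b must vanish.\<close>
    define s where "s = 1 / ((norm x)\<^sup>2 + 1)"
    have s: "0 < s" "s * (norm x)\<^sup>2 < 1"
      by (simp_all add: s_def add_nonneg_pos)
    have "0 \<le> 2 * (- b * s) * b + (- b * s)\<^sup>2 * (norm x)\<^sup>2"
      by (rule quad)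
    also have "\<dots> = b\<^sup>2 * s * (s * (norm x)\<^sup>2 - 2)"
      by (simp add: power2_eq_square algebra_simps)
    finally have "b\<^sup>2 * s \<le> 0"
      using s(2) by (simp add: zero_le_mult_iff)
    then have "b = 0"
      using s(1) by (simp add: mult_le_0_iff)
    then show "inner z x = f x"
      by (simp add: b_def)
  qed
qed

lemma riesz:
  fixes f :: "'a::chilbert_space \<Rightarrow> real"
  assumes "bounded_linear f"
  shows "\<exists>!z. \<forall>x. inner z x = f x"
proof -
  obtain z where "z \<in> UNIV" "\<And>x. x \<in> UNIV \<Longrightarrow> inner z x = f x"
    by (metis riesz_on_subspace[OF subspace_UNIV closed_UNIV assms])
  moreover have "z' = z" if "\<forall>x. inner z' x = f x" "\<forall>x. inner z x = f x" for z z'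
    using that by (metis inner_commute vector_eq_rdot)
  ultimately show ?thesis
    by (intro ex1I[of _ z]) auto
qed

section \<open>Adjoints and complex linear operators\<close>

definition adj :: "('a::chilbert_space \<Rightarrow>\<^sub>L 'b::chilbert_space) \<Rightarrow> 'b \<Rightarrow>\<^sub>L 'a" where
  "adj T = Blinfun (\<lambda>y. THE z. \<forall>x. inner z x = inner y (blinfun_apply T x))"

lemma inner_adj: "inner (blinfun_apply (adj T) y) x = inner y (blinfun_apply T x)"
proof -
  define g where "g y = (THE z. \<forall>x. inner z x = inner y (blinfun_apply T x))" for y
  have "bounded_linear (\<lambda>x. inner y (blinfun_apply T x))" for y
    by (intro bounded_linear_inner_right_comp blinfun.bounded_linear_right)
  from theI'[OF riesz[OF this]]
  have g: "inner (g y) x = inner y (blinfun_apply T x)" for x y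
    by (simp add: g_def)
  have "bounded_linear g"
  proof (rule bounded_linear_intro[where K = "norm T"])
    show "g (x + y) = g x + g y" for x y
      by (rule vector_eq_rdot[THEN iffD1]) (simp add: inner_simps g inner_commute[of _ "g _"])
    show "g (r *\<^sub>R x) = r *\<^sub>R g x" for r x
      by (rule vector_eq_rdot[THEN iffD1]) (simp add: inner_simps g inner_commute[of _ "g _"])
    show "norm (g y) \<le> norm y * norm T" for y
    proof -
      have "(norm (g y))\<^sup>2 = inner y (blinfun_apply T (g y))"
        by (simp add: power2_norm_eq_inner g)
      also have "\<dots> \<le> norm y * (norm T * norm (g y))"
        using norm_cauchy_schwarz[of y] norm_blinfun[of T "g y"]
        by (meson dual_order.trans mult_left_mono norm_ge_zero)
      finally have "norm (g y) * norm (g y) \<le> (norm y * norm T) * norm (g y)"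
        by (simp add: power2_eq_square mult_ac)
      then show ?thesis
        by (cases "norm (g y) = 0") (auto simp: mult_le_cancel_right)
    qed
  qed
  then have "blinfun_apply (adj T) = g"
    unfolding adj_def g_def[abs_def] by (rule bounded_linear_Blinfun_apply)
  then show ?thesis
    by (simp add: g)
qed

lemma bounded_opsD: "T \<in> bounded_ops \<Longrightarrow> blinfun_apply T (c *\<^sub>C x) = c *\<^sub>C blinfun_apply T x"
  by (simp add: bounded_ops_def)

text \<open>\<open>adj\<close> is built from the real inner product alone; complex linearity of
  \<open>T\<close> extends the identity to the imaginary part, so on \<open>bounded_ops\<close> it
  is the usual adjoint.\<close>

lemma cinner_adj:
  assumes "T \<in> bounded_ops"
  shows "cinner (blinfun_apply (adj T) y) x = cinner y (blinfun_apply T x)"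
  unfolding cinner_conv_inner by (simp add: inner_adj bounded_opsD[OF assms])

lemma cinner_adj':
  assumes "T \<in> bounded_ops"
  shows "cinner x (blinfun_apply (adj T) y) = cinner (blinfun_apply T x) y"
  by (metis assms cinner_adj cinner_commute)

lemma adj_in_bounded_ops:
  assumes "T \<in> bounded_ops"
  shows "adj T \<in> bounded_ops"
  unfolding bounded_ops_def
proof (intro CollectI allI)
  fix c y
  show "blinfun_apply (adj T) (c *\<^sub>C y) = c *\<^sub>C blinfun_apply (adj T) y"
    by (rule cinner_eqI) (simp add: cinner_adj'[OF assms] cinner_scaleC_right)
qed

lemma adj_eqI:
  assumes "T \<in> bounded_ops" "\<And>x y. cinner (blinfun_apply S x) y = cinner x (blinfun_apply T y)"
  shows "S = adj T"
proof (rule blinfun_eqI, rule cinner_eqI)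
  fix x z
  show "cinner z (blinfun_apply S x) = cinner z (blinfun_apply (adj T) x)"
    using assms by (metis cinner_adj cinner_commute)
qed

lemma is_adjoint_iff: "T \<in> bounded_ops \<Longrightarrow> is_adjoint S T \<longleftrightarrow> S = adj T"
  unfolding is_adjoint_def using adj_eqI cinner_adj by blast

lemma adj_adj: "T \<in> bounded_ops \<Longrightarrow> adj (adj T) = T"
  by (intro adj_eqI[symmetric] adj_in_bounded_ops) (simp_all add: cinner_adj')

lemma bounded_ops_compose: "S \<in> bounded_ops \<Longrightarrow> T \<in> bounded_ops \<Longrightarrow> S o\<^sub>L T \<in> bounded_ops"
  by (simp add: bounded_ops_def)

lemma adj_compose:
  "S \<in> bounded_ops \<Longrightarrow> T \<in> bounded_ops \<Longrightarrow> adj (S o\<^sub>L T) = adj T o\<^sub>L adj S"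
  by (intro adj_eqI[symmetric] bounded_ops_compose) (simp_all add: cinner_adj)

text \<open>The operator type carries only real scaling, so complex multiples of operators are
  written as compositions with \<open>cmul c\<close>.\<close>

definition cmul :: "complex \<Rightarrow> 'a::chilbert_space \<Rightarrow>\<^sub>L 'a" where
  "cmul c = Blinfun (\<lambda>x. c *\<^sub>C x)"

lemma cmul_apply [simp]: "blinfun_apply (cmul c) x = c *\<^sub>C x"
  unfolding cmul_def by (simp add: bounded_linear_Blinfun_apply bounded_linear_scaleC)

lemma cmul_in_bounded_ops: "cmul c \<in> bounded_ops"
  by (simp add: bounded_ops_def scaleC_scaleC mult.commute)

lemma id_in_bounded_ops: "id_blinfun \<in> bounded_ops"
  by (simp add: bounded_ops_def)

lemma adj_id: "adj id_blinfun = id_blinfun"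
  by (intro adj_eqI[symmetric] id_in_bounded_ops) simp

lemma bounded_ops_add: "S \<in> bounded_ops \<Longrightarrow> T \<in> bounded_ops \<Longrightarrow> S + T \<in> bounded_ops"
  by (simp add: bounded_ops_def blinfun.add_left scaleC_add_right)

lemma bounded_ops_diff: "S \<in> bounded_ops \<Longrightarrow> T \<in> bounded_ops \<Longrightarrow> S - T \<in> bounded_ops"
  by (simp add: bounded_ops_def blinfun.diff_left scaleC_diff_right)

lemma bounded_ops_scaleR: "T \<in> bounded_ops \<Longrightarrow> r *\<^sub>R T \<in> bounded_ops"
  by (simp add: bounded_ops_def blinfun.scaleR_left scaleC_scaleR)

section \<open>Orthogonal projections\<close>

definition proj_onto :: "'a::chilbert_space set \<Rightarrow> 'a \<Rightarrow>\<^sub>L 'a" where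
  "proj_onto V = Blinfun (\<lambda>u. THE z. z \<in> V \<and> (\<forall>x\<in>V. cinner x z = cinner x u))"

context
  fixes V :: "'a::chilbert_space set"
  assumes V: "csubspace V" "closed V"
begin

private lemma proj_ex1: "\<exists>!z. z \<in> V \<and> (\<forall>x\<in>V. cinner x z = cinner x u)"
proof -
  note sub = csubspace_imp_subspace[OF V(1)]
  obtain z where z: "z \<in> V" "\<And>x. x \<in> V \<Longrightarrow> inner z x = inner u x"
    using riesz_on_subspace[OF sub V(2) bounded_linear_inner_right[of u]] by blast
  \<comment> \<open>\<open>V\<close> is closed under multiplication by \<open>\<i>\<close>, so the
    real identity also covers the imaginary parts.\<close>
  have "cinner z x = cinner u x" if "x \<in> V" for x
    unfolding cinner_conv_inner using z(2) csubspaceD(3)[OF V(1)] that by simp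
  then have "cinner x z = cinner x u" if "x \<in> V" for x
    using that by (metis cinner_commute)
  moreover have "z = z'" if "z \<in> V" "z' \<in> V"
    "\<forall>x\<in>V. cinner x z = cinner x u" "\<forall>x\<in>V. cinner x z' = cinner x u" for z z'
  proof -
    have "z - z' \<in> V"
      using sub that by (simp add: subspace_diff)
    then have "cinner (z - z') (z - z') = 0"
      using that by (simp add: cinner_diff_right)
    then show ?thesis
      by (simp add: cinner_self)
  qed
  ultimately show ?thesis
    using z(1) by blast
qed

private lemma proj_props:
  "bounded_linear (\<lambda>u. THE z. z \<in> V \<and> (\<forall>x\<in>V. cinner x z = cinner x u))"
  "(THE z. z \<in> V \<and> (\<forall>x\<in>V. cinner x z = cinner x u)) \<in> V"
  "v \<in> V \<Longrightarrow> cinner v (THE z. z \<in> V \<and> (\<forall>x\<in>V. cinner x z = cinner x u)) = cinner v u"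
proof -
  define g where "g u = (THE z. z \<in> V \<and> (\<forall>x\<in>V. cinner x z = cinner x u))" for u
  have g: "g u \<in> V" "\<And>x. x \<in> V \<Longrightarrow> cinner x (g u) = cinner x u" for u
    using theI'[OF proj_ex1[of u]] unfolding g_def by blast+
  have gI: "g u = z" if "z \<in> V" "\<And>x. x \<in> V \<Longrightarrow> cinner x z = cinner x u" for u z
    using proj_ex1[of u] that g by blast
  note sub = csubspace_imp_subspace[OF V(1)]
  have "bounded_linear g"
  proof (rule bounded_linear_intro[where K = 1])
    show "g (x + y) = g x + g y" for x y
      by (intro gI subspace_add sub g) (simp add: cinner_add_right g)
    show "g (r *\<^sub>R x) = r *\<^sub>R g x" for r x
      by (intro gI subspace_scale sub g) (simp add: cinner_scaleR_right g)
    show "norm (g x) \<le> norm x * 1" for x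
    proof -
      have "(norm (g x))\<^sup>2 = cmod (cinner (g x) (g x))"
        by (simp add: cinner_self del: of_real_power)
      also have "\<dots> \<le> norm (g x) * norm x"
        unfolding g(2)[OF g(1)] by (rule cinner_bound)
      finally show ?thesis
        by (cases "norm (g x) = 0") (auto simp: power2_eq_square)
    qed
  qed
  then show "bounded_linear (\<lambda>u. THE z. z \<in> V \<and> (\<forall>x\<in>V. cinner x z = cinner x u))"
    by (simp add: g_def[abs_def])
  show "(THE z. z \<in> V \<and> (\<forall>x\<in>V. cinner x z = cinner x u)) \<in> V"
    "v \<in> V \<Longrightarrow> cinner v (THE z. z \<in> V \<and> (\<forall>x\<in>V. cinner x z = cinner x u)) = cinner v u"
    using g(1)[of u] g(2)[of v u] by (simp_all add: g_def)
qed

lemma proj_onto_mem: "blinfun_apply (proj_onto V) u \<in> V"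
  unfolding proj_onto_def bounded_linear_Blinfun_apply[OF proj_props(1)] by (rule proj_props)

lemma cinner_proj_onto: "v \<in> V \<Longrightarrow> cinner v (blinfun_apply (proj_onto V) u) = cinner v u"
  unfolding proj_onto_def bounded_linear_Blinfun_apply[OF proj_props(1)] by (rule proj_props)

lemma proj_onto_eqI:
  assumes "z \<in> V" "\<And>x. x \<in> V \<Longrightarrow> cinner x z = cinner x u"
  shows "blinfun_apply (proj_onto V) u = z"
  using proj_ex1[of u] assms proj_onto_mem cinner_proj_onto by blast

lemma proj_onto_ident: "u \<in> V \<Longrightarrow> blinfun_apply (proj_onto V) u = u"
  by (rule proj_onto_eqI) auto

lemma proj_onto_bounded_ops: "proj_onto V \<in> bounded_ops"
  unfolding bounded_ops_def
  by (auto intro!: proj_onto_eqI csubspaceD[OF V(1)] proj_onto_mem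
      simp: cinner_scaleC_right cinner_proj_onto)

text \<open>The orthogonal complement of an invariant subspace of a self-adjoint family is invariant,
  so the projection commutes with the family.\<close>

lemma proj_onto_commutant:
  assumes X: "X \<subseteq> bounded_ops" "\<And>T. T \<in> X \<Longrightarrow> adj T \<in> X"
    and inv: "\<And>T v. T \<in> X \<Longrightarrow> v \<in> V \<Longrightarrow> blinfun_apply T v \<in> V"
  shows "proj_onto V \<in> commutant X"
  unfolding commutant_def
proof (intro CollectI conjI ballI proj_onto_bounded_ops blinfun_eqI)
  fix T u assume T: "T \<in> X"
  then have b: "T \<in> bounded_ops"
    using X by blast
  have "blinfun_apply (proj_onto V) (blinfun_apply T u)
      = blinfun_apply T (blinfun_apply (proj_onto V) u)"
  proof (rule proj_onto_eqI)
    show "blinfun_apply T (blinfun_apply (proj_onto V) u) \<in> V"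
      by (intro inv T proj_onto_mem)
    fix x assume "x \<in> V"
    then have "blinfun_apply (adj T) x \<in> V"
      by (intro inv X(2) T)
    then show "cinner x (blinfun_apply T (blinfun_apply (proj_onto V) u))
        = cinner x (blinfun_apply T u)"
      by (simp add: cinner_adj[OF b, symmetric] cinner_proj_onto)
  qed
  then show "blinfun_apply (proj_onto V o\<^sub>L T) u = blinfun_apply (T o\<^sub>L proj_onto V) u"
    by simp
qed

end

section \<open>Density and extension by continuity\<close>

lemma csubspace_closure:
  fixes V :: "'a::chilbert_space set"
  assumes "csubspace V"
  shows "csubspace (closure V)"
  unfolding csubspace_def
proof (intro conjI ballI allI)
  show "0 \<in> closure V"
    using csubspaceD(1)[OF assms] closure_subset by blast
next
  fix x y assume "x \<in> closure V" "y \<in> closure V"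
  then obtain X Y where XY: "\<And>n. X n \<in> V" "X \<longlonglongrightarrow> x" "\<And>n. Y n \<in> V" "Y \<longlonglongrightarrow> y"
    unfolding closure_sequential by blast
  show "x + y \<in> closure V"
    unfolding closure_sequential
    by (intro exI[of _ "\<lambda>n. X n + Y n"] conjI allI tendsto_add csubspaceD(2)[OF assms] XY)
next
  fix c x assume "x \<in> closure V"
  then obtain X where X: "\<And>n. X n \<in> V" "X \<longlonglongrightarrow> x"
    unfolding closure_sequential by blast
  show "c *\<^sub>C x \<in> closure V"
    unfolding closure_sequential
    by (intro exI[of _ "\<lambda>n. c *\<^sub>C X n"] conjI allI csubspaceD(3)[OF assms] X
        bounded_linear.tendsto[OF bounded_linear_scaleC])
qed

text \<open>The difference between \<open>u\<close> and its projection onto the closure is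
  orthogonal to \<open>V\<close>, hence zero.\<close>

lemma csubspace_dense:
  fixes V :: "'a::chilbert_space set"
  assumes "csubspace V" "\<And>u. (\<And>v. v \<in> V \<Longrightarrow> cinner v u = 0) \<Longrightarrow> u = 0"
  shows "closure V = UNIV"
proof -
  note c = csubspace_closure[OF assms(1)] closed_closure
  have "u - blinfun_apply (proj_onto (closure V)) u = 0" for u
  proof (rule assms(2))
    fix v assume "v \<in> V"
    then show "cinner v (u - blinfun_apply (proj_onto (closure V)) u) = 0"
      using closure_subset[of V] by (subst cinner_diff_right, subst cinner_proj_onto[OF c]) auto
  qed
  then have "u \<in> closure V" for u
    using proj_onto_mem[OF c, of u] by (simp add: eq_iff_diff_eq_0[symmetric])
  then show ?thesis
    by blast
qed

lemma blinfun_eq_on_dense: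
  fixes S T :: "'a::real_normed_vector \<Rightarrow>\<^sub>L 'b::real_normed_vector"
  assumes "closure D = UNIV" "\<And>x. x \<in> D \<Longrightarrow> blinfun_apply S x = blinfun_apply T x"
  shows "S = T"
proof (rule blinfun_eqI)
  fix x
  have "closed {x. blinfun_apply S x = blinfun_apply T x}"
    by (intro closed_Collect_eq linear_continuous_on blinfun.bounded_linear_right)
  then have "closure D \<subseteq> {x. blinfun_apply S x = blinfun_apply T x}"
    using assms(2) by (intro closure_minimal) auto
  then show "blinfun_apply S x = blinfun_apply T x"
    using assms(1) by auto
qed

text \<open>\<open>L\<close> is the graph of the densely defined operator.\<close>

lemma extend_from_dense:
  fixes L :: "('a::chilbert_space \<times> 'b::chilbert_space) set"
  assumes L0: "(0, 0) \<in> L"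
    and add: "\<And>x y x' y'. (x, y) \<in> L \<Longrightarrow> (x', y') \<in> L \<Longrightarrow> (x + x', y + y') \<in> L"
    and scale: "\<And>c x y. (x, y) \<in> L \<Longrightarrow> (c *\<^sub>C x, c *\<^sub>C y) \<in> L"
    and bound: "\<And>x y. (x, y) \<in> L \<Longrightarrow> norm y \<le> C * norm x"
    and dense: "closure (fst ` L) = UNIV"
  shows "\<exists>V\<in>bounded_ops. \<forall>x y. (x, y) \<in> L \<longrightarrow> blinfun_apply V x = y"
proof -
  \<comment> \<open>\<open>R\<close> is the closure of the graph \<open>L\<close>. The bound makes
    it single-valued, and together with completeness and density it makes it total.\<close>
  define R where "R x y \<longleftrightarrow> (\<exists>X Y. (\<forall>n. (X n, Y n) \<in> L) \<and> X \<longlonglongrightarrow> x \<and> Y \<longlonglongrightarrow> y)" for x y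
  have R_L: "R x y" if "(x, y) \<in> L" for x y
    unfolding R_def using that by (intro exI[of _ "\<lambda>_. x"] exI[of _ "\<lambda>_. y"]) auto
  have R_add: "R (x + x') (y + y')" if "R x y" "R x' y'" for x y x' y'
  proof -
    obtain X Y where "\<forall>n. (X n, Y n) \<in> L" "X \<longlonglongrightarrow> x" "Y \<longlonglongrightarrow> y"
      using \<open>R x y\<close> unfolding R_def by auto
    moreover obtain X' Y' where "\<forall>n. (X' n, Y' n) \<in> L" "X' \<longlonglongrightarrow> x'" "Y' \<longlonglongrightarrow> y'"
      using \<open>R x' y'\<close> unfolding R_def by auto
    ultimately show ?thesis
      unfolding R_def
      by (intro exI[of _ "\<lambda>n. X n + X' n"] exI[of _ "\<lambda>n. Y n + Y' n"]) (auto intro: add tendsto_intros)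
  qed
  have R_scale: "R (c *\<^sub>C x) (c *\<^sub>C y)" if "R x y" for c x y
  proof -
    obtain X Y where "\<forall>n. (X n, Y n) \<in> L" "X \<longlonglongrightarrow> x" "Y \<longlonglongrightarrow> y"
      using \<open>R x y\<close> unfolding R_def by auto
    then show ?thesis
      unfolding R_def
      by (intro exI[of _ "\<lambda>n. c *\<^sub>C X n"] exI[of _ "\<lambda>n. c *\<^sub>C Y n"])
        (auto intro: scale bounded_linear.tendsto[OF bounded_linear_scaleC])
  qed
  have R_bound: "norm y \<le> C * norm x" if "R x y" for x y
  proof -
    obtain X Y where "\<forall>n. (X n, Y n) \<in> L" "X \<longlonglongrightarrow> x" "Y \<longlonglongrightarrow> y"
      using \<open>R x y\<close> unfolding R_def by auto
    then show ?thesis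
      using bound by (intro LIMSEQ_le[of "\<lambda>n. norm (Y n)" _ "\<lambda>n. C * norm (X n)"])
        (auto intro!: tendsto_intros)
  qed
  have R_unique: "y = y'" if "R x y" "R x y'" for x y y'
  proof -
    have "R (x + (-1) *\<^sub>C x) (y + (-1) *\<^sub>C y')"
      using that by (intro R_add R_scale)
    then show ?thesis
      using R_bound by fastforce
  qed
  have R_ex: "\<exists>y. R x y" for x
  proof -
    have "x \<in> closure (fst ` L)"
      using dense by simp
    then obtain X where X: "\<And>n. X n \<in> fst ` L" "X \<longlonglongrightarrow> x"
      using closure_sequential by blast
    then have "\<forall>n. \<exists>y. (X n, y) \<in> L"
      by force
    then obtain Y where Y: "\<And>n. (X n, Y n) \<in> L"
      by metis
    have bnd: "norm (Y i - Y j) \<le> \<bar>C\<bar> * norm (X i - X j)" for i j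
    proof -
      have "(X i + (-1) *\<^sub>C X j, Y i + (-1) *\<^sub>C Y j) \<in> L"
        by (intro add scale Y)
      then have "norm (Y i - Y j) \<le> C * norm (X i - X j)"
        using bound by fastforce
      also have "\<dots> \<le> \<bar>C\<bar> * norm (X i - X j)"
        by (intro mult_right_mono) auto
      finally show ?thesis .
    qed
    have "Cauchy Y"
      unfolding Cauchy_iff
    proof (intro allI impI)
      fix e :: real assume "0 < e"
      then have "0 < e / (\<bar>C\<bar> + 1)"
        by simp
      moreover have "Cauchy X"
        using X(2) by (rule LIMSEQ_imp_Cauchy)
      ultimately obtain M where M: "\<And>i j. i \<ge> M \<Longrightarrow> j \<ge> M \<Longrightarrow> norm (X i - X j) < e / (\<bar>C\<bar> + 1)"
        unfolding Cauchy_iff by meson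
      have "norm (Y i - Y j) < e" if "i \<ge> M" "j \<ge> M" for i j
      proof -
        have "norm (Y i - Y j) \<le> \<bar>C\<bar> * norm (X i - X j)"
          by (rule bnd)
        also have "\<dots> \<le> (\<bar>C\<bar> + 1) * norm (X i - X j)"
          by (intro mult_right_mono) auto
        also have "\<dots> < e"
          using M[OF that] by (simp add: field_simps)
        finally show ?thesis .
      qed
      then show "\<exists>M. \<forall>i\<ge>M. \<forall>j\<ge>M. norm (Y i - Y j) < e"
        by blast
    qed
    then obtain y where "Y \<longlonglongrightarrow> y"
      using Cauchy_convergent convergent_def by blast
    then show ?thesis
      using X Y unfolding R_def by blast
  qed
  define g where "g x = (THE y. R x y)" for x
  have g: "R x (g x)" for x
    unfolding g_def using R_ex R_unique by (metis theI)
  have gI: "g x = y" if "R x y" for x y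
    using that g R_unique by blast
  have g_add: "g (x + y) = g x + g y" for x y
    by (intro gI R_add g)
  have g_scale: "g (c *\<^sub>C x) = c *\<^sub>C g x" for c x
    by (intro gI R_scale g)
  have "bounded_linear g"
    using R_bound[OF g] g_scale[of "complex_of_real _"]
    by (intro bounded_linear_intro[where K = C]) (auto simp: g_add scaleC_of_real mult.commute)
  then have "blinfun_apply (Blinfun g) = g"
    by (rule bounded_linear_Blinfun_apply)
  then show ?thesis
    using g_scale gI R_L by (intro bexI[of _ "Blinfun g"]) (auto simp: bounded_ops_def)
qed

section \<open>Square roots\<close>

text \<open>With \<open>m\<close> the multiplication of a Banach algebra, \<open>1 - y\<close> is a square root of \<open>1 - b\<close>.  The
  iterates are dominated by those of the scalar iteration with \<open>b = 1\<close>, which increase and stay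
  below \<open>1\<close>.\<close>

lemma sqrt_iteration:
  fixes m :: "'a::banach \<Rightarrow> 'a \<Rightarrow> 'a"
  assumes m: "bounded_bilinear m" "\<And>x y. norm (m x y) \<le> norm x * norm y" and b: "norm b \<le> 1"
    and P: "closed P" "0 \<in> P" "\<And>y. y \<in> P \<Longrightarrow> (1/2) *\<^sub>R (b + m y y) \<in> P"
  obtains y where "y \<in> P" "norm y \<le> 1" "2 *\<^sub>R y = b + m y y"
proof -
  interpret m: bounded_bilinear m by fact
  \<comment> \<open>Fixed-point iteration for y = (b + y^2) / 2, which is (1 - y)^2 = 1 - b
    rearranged; \<open>s\<close> is the scalar case b = 1.\<close>
  define Y where "Y n = ((\<lambda>y. (1/2) *\<^sub>R (b + m y y)) ^^ n) 0" for n
  define s where "s n = ((\<lambda>t::real. (1 + t * t) / 2) ^^ n) 0" for n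
  have Y0: "Y 0 = 0" and YS: "Y (Suc n) = (1/2) *\<^sub>R (b + m (Y n) (Y n))" for n
    by (simp_all add: Y_def)
  have s0: "s 0 = 0" and sS: "s (Suc n) = (1 + s n * s n) / 2" for n
    by (simp_all add: s_def)
  have s: "0 \<le> s n \<and> s n \<le> 1" for n
  proof (induction n)
    case (Suc n)
    then have "s n * s n \<le> 1"
      by (simp add: mult_le_one)
    then show ?case
      using Suc by (simp add: sS add_nonneg_nonneg)
  qed (simp add: s0)
  have Ys: "norm (Y n) \<le> s n" for n
  proof (induction n)
    case (Suc n)
    have "norm (b + m (Y n) (Y n)) \<le> 1 + s n * s n"
      by (intro norm_triangle_le add_mono b order_trans[OF m(2)] mult_mono Suc) (use s in auto)
    then show ?case
      by (simp add: YS sS)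
  qed (simp add: Y0 s0)
  have D: "norm (Y (Suc n) - Y n) \<le> s (Suc n) - s n" for n
  proof (induction n)
    case 0
    then show ?case
      using b by (simp add: YS Y0 sS s0 m.zero_left)
  next
    case (Suc n)
    define d where "d = Y (Suc n) - Y n"
    \<comment> \<open>Difference of squares without commutativity: u u - v v = u (u - v) + (u - v)
      v.\<close>
    have "Y (Suc (Suc n)) - Y (Suc n) = (1/2) *\<^sub>R (m (Y (Suc n)) d + m d (Y n))"
      by (simp add: YS[of "Suc n"] YS[of n] scaleR_diff_right[symmetric] m.diff_left m.diff_right d_def
          del: scaleR_right_diff_distrib)
    also have "norm \<dots> \<le> (1/2) * (s (Suc n) * (s (Suc n) - s n) + (s (Suc n) - s n) * s n)"
      using Suc.IH s by (auto intro!: norm_triangle_le add_mono order_trans[OF m(2)] mult_mono Ys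
          simp: d_def intro: order_trans[OF norm_ge_zero])
    also have "\<dots> = s (Suc (Suc n)) - s (Suc n)"
      by (simp add: sS[of "Suc n"] sS[of n]) (simp add: field_simps)
    finally show ?case .
  qed
  have D': "norm (Y (n + k) - Y n) \<le> s (n + k) - s n" for n k
  proof (induction k)
    case (Suc k)
    have "norm (Y (n + Suc k) - Y n) \<le> norm (Y (Suc (n + k)) - Y (n + k)) + norm (Y (n + k) - Y n)"
      using norm_triangle_ineq[of "Y (Suc (n + k)) - Y (n + k)" "Y (n + k) - Y n"] by simp
    then show ?case
      using D[of "n + k"] Suc by simp
  qed simp
  have "incseq s"
    using order_trans[OF norm_ge_zero D] by (intro incseq_SucI) simp
  then have "Bseq s \<and> monoseq s"
    using s by (auto intro!: BseqI'[of _ 1] incseq_imp_monoseq)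
  then have "Cauchy s"
    by (simp add: Bseq_monoseq_convergent convergent_Cauchy)
  have "Cauchy Y"
    unfolding Cauchy_altdef2 dist_norm
  proof (intro allI impI)
    fix e :: real assume "0 < e"
    then obtain N where N: "\<And>n. n \<ge> N \<Longrightarrow> norm (s n - s N) < e"
      using \<open>Cauchy s\<close> unfolding Cauchy_altdef2 dist_norm by blast
    show "\<exists>N. \<forall>n\<ge>N. norm (Y n - Y N) < e"
    proof (intro exI allI impI)
      fix n assume "N \<le> n"
      then show "norm (Y n - Y N) < e"
        using N[of n] D'[of N "n - N"] by simp
    qed
  qed
  then obtain y where y: "Y \<longlonglongrightarrow> y"
    using Cauchy_convergent convergent_def by blast
  \<comment> \<open>Closed properties of the iterates, such as self-adjointness or membership in a
    commutant, reach the limit through \<open>P\<close>.\<close>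
  have "Y n \<in> P" for n
    by (induction n) (simp_all add: Y0 YS P del: scaleR_right_distrib)
  then have "y \<in> P"
    using closed_sequentially[OF P(1) _ y] by blast
  moreover have "norm y \<le> 1"
    using Ys s by (intro LIMSEQ_le_const2[OF tendsto_norm[OF y]]) (meson order_trans)
  moreover have "2 *\<^sub>R y = b + m y y"
  proof (rule LIMSEQ_unique)
    show "(\<lambda>n. 2 *\<^sub>R Y (Suc n)) \<longlonglongrightarrow> 2 *\<^sub>R y"
      by (intro tendsto_intros LIMSEQ_Suc y)
    show "(\<lambda>n. 2 *\<^sub>R Y (Suc n)) \<longlonglongrightarrow> b + m y y"
      unfolding YS by (simp del: scaleR_right_distrib) (intro tendsto_intros m.tendsto y)
  qed
  ultimately show thesis
    by (rule that)
qed

section \<open>Commutants\<close>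

definition selfadjoint_set :: "('h::chilbert_space \<Rightarrow>\<^sub>L 'h) set \<Rightarrow> bool" where
  "selfadjoint_set X \<longleftrightarrow> X \<subseteq> bounded_ops \<and> (\<forall>T\<in>X. adj T \<in> X)"

lemma selfadjoint_setD:
  assumes "selfadjoint_set X"
  shows "X \<subseteq> bounded_ops" "T \<in> X \<Longrightarrow> T \<in> bounded_ops" "T \<in> X \<Longrightarrow> adj T \<in> X"
  using assms unfolding selfadjoint_set_def by auto

lemma commutantD:
  assumes "T \<in> commutant X"
  shows "T \<in> bounded_ops" "S \<in> X \<Longrightarrow> T o\<^sub>L S = S o\<^sub>L T"
    "S \<in> X \<Longrightarrow> blinfun_apply T (blinfun_apply S x) = blinfun_apply S (blinfun_apply T x)"
proof -
  show "T \<in> bounded_ops" and *: "S \<in> X \<Longrightarrow> T o\<^sub>L S = S o\<^sub>L T"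
    using assms unfolding commutant_def by auto
  then show "S \<in> X \<Longrightarrow> blinfun_apply T (blinfun_apply S x) = blinfun_apply S (blinfun_apply T x)"
    by (metis blinfun_apply_blinfun_compose)
qed

lemma commutantI:
  assumes "T \<in> bounded_ops"
    and "\<And>S x. S \<in> X \<Longrightarrow> blinfun_apply T (blinfun_apply S x) = blinfun_apply S (blinfun_apply T x)"
  shows "T \<in> commutant X"
  using assms unfolding commutant_def by (auto intro: blinfun_eqI)

lemma commutant_antimono: "X \<subseteq> Y \<Longrightarrow> commutant Y \<subseteq> commutant X"
  unfolding commutant_def by blast

lemma bicommutant_mono: "X \<subseteq> Y \<Longrightarrow> commutant (commutant X) \<subseteq> commutant (commutant Y)"
  by (intro commutant_antimono)

lemma subset_commutant_swap: "X \<subseteq> bounded_ops \<Longrightarrow> Y \<subseteq> commutant X \<Longrightarrow> X \<subseteq> commutant Y"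
  unfolding commutant_def by (auto simp: subset_eq)

lemma bicommutant_superset: "X \<subseteq> bounded_ops \<Longrightarrow> X \<subseteq> commutant (commutant X)"
  by (rule subset_commutant_swap) auto

lemma commutant_subset_bounded_ops: "commutant X \<subseteq> bounded_ops"
  unfolding commutant_def by blast

lemma commutant_bicommutant: "X \<subseteq> bounded_ops \<Longrightarrow> commutant (commutant (commutant X)) = commutant X"
  by (intro subset_antisym commutant_antimono bicommutant_superset commutant_subset_bounded_ops)

lemma selfadjoint_set_commutant:
  assumes "selfadjoint_set X"
  shows "selfadjoint_set (commutant X)"
  unfolding selfadjoint_set_def
proof (intro conjI ballI commutant_subset_bounded_ops)
  fix T assume T: "T \<in> commutant X"
  note b = commutantD(1)[OF T]
  show "adj T \<in> commutant X"
    unfolding commutant_def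
  proof (intro CollectI conjI ballI adj_in_bounded_ops b)
    fix S assume S: "S \<in> X"
    note bS = selfadjoint_setD(2)[OF assms S]
    have "adj T o\<^sub>L S = adj (adj S o\<^sub>L T)"
      by (simp add: adj_compose adj_adj adj_in_bounded_ops bS b)
    also have "adj S o\<^sub>L T = T o\<^sub>L adj S"
      using commutantD(2)[OF T] selfadjoint_setD(3)[OF assms S] by simp
    also have "adj \<dots> = S o\<^sub>L adj T"
      by (simp add: adj_compose adj_adj adj_in_bounded_ops bS b)
    finally show "adj T o\<^sub>L S = S o\<^sub>L adj T" .
  qed
qed

lemma commutant_add: "S \<in> commutant X \<Longrightarrow> T \<in> commutant X \<Longrightarrow> S + T \<in> commutant X"
  by (intro commutantI bounded_ops_add)
    (auto simp: commutantD blinfun.add_left blinfun.add_right)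

lemma commutant_diff: "S \<in> commutant X \<Longrightarrow> T \<in> commutant X \<Longrightarrow> S - T \<in> commutant X"
  by (intro commutantI bounded_ops_diff)
    (auto simp: commutantD blinfun.diff_left blinfun.diff_right)

lemma commutant_scaleR: "T \<in> commutant X \<Longrightarrow> r *\<^sub>R T \<in> commutant X"
  by (intro commutantI bounded_ops_scaleR)
    (auto simp: commutantD blinfun.scaleR_left blinfun.scaleR_right)

lemma commutant_compose: "S \<in> commutant X \<Longrightarrow> T \<in> commutant X \<Longrightarrow> S o\<^sub>L T \<in> commutant X"
  by (intro commutantI bounded_ops_compose) (auto simp: commutantD)

lemma cmul_in_commutant: "X \<subseteq> bounded_ops \<Longrightarrow> cmul c \<in> commutant X"
  by (intro commutantI cmul_in_bounded_ops) (auto simp: bounded_opsD)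

lemma id_in_commutant: "id_blinfun \<in> commutant X"
  by (intro commutantI id_in_bounded_ops) auto

lemma zero_in_commutant: "0 \<in> commutant X"
  using commutant_scaleR[OF id_in_commutant, of 0] by simp

lemma closed_commutant: "closed (commutant X)"
proof -
  have "commutant X = {T. \<forall>c x. blinfun_apply T (c *\<^sub>C x) = c *\<^sub>C blinfun_apply T x} \<inter>
      (\<Inter>S\<in>X. {T. \<forall>x. blinfun_apply T (blinfun_apply S x) = blinfun_apply S (blinfun_apply T x)})"
    unfolding bounded_ops_def[symmetric] by (auto intro: commutantI commutantD)
  also have "closed \<dots>"
    by (intro closed_Int closed_INT ballI closed_Collect_all closed_Collect_eq
        continuous_intros blinfun.continuous_on)
  finally show ?thesis .
qed

text \<open>Irreducibility in the form in which the argument consumes it: purity and Schur's lemma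
  both deliver it.\<close>

definition trivial_commutant :: "('h::chilbert_space \<Rightarrow>\<^sub>L 'h) set \<Rightarrow> bool" where
  "trivial_commutant X \<longleftrightarrow> (\<forall>T\<in>commutant X. \<exists>c. T = cmul c)"

lemma trivial_commutant_bicommutant:
  "trivial_commutant X \<Longrightarrow> commutant (commutant X) = bounded_ops"
  unfolding trivial_commutant_def
  by (intro subset_antisym commutant_subset_bounded_ops)
    (fastforce intro: commutantI simp: bounded_opsD)

lemma adj_cmul: "adj (cmul c) = cmul (cnj c)"
  by (intro adj_eqI[symmetric] cmul_in_bounded_ops)
    (simp add: cinner_scaleC_left cinner_scaleC_right)

lemma adj_add: "S \<in> bounded_ops \<Longrightarrow> T \<in> bounded_ops \<Longrightarrow> adj (S + T) = adj S + adj T"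
  by (intro adj_eqI[symmetric] bounded_ops_add)
    (simp_all add: blinfun.add_left cinner_add_left cinner_add_right cinner_adj)

lemma adj_diff: "S \<in> bounded_ops \<Longrightarrow> T \<in> bounded_ops \<Longrightarrow> adj (S - T) = adj S - adj T"
  by (intro adj_eqI[symmetric] bounded_ops_diff)
    (simp_all add: blinfun.diff_left cinner_diff_left cinner_diff_right cinner_adj)

lemma adj_scaleR: "T \<in> bounded_ops \<Longrightarrow> adj (r *\<^sub>R T) = r *\<^sub>R adj T"
  by (intro adj_eqI[symmetric] bounded_ops_scaleR)
    (simp_all add: blinfun.scaleR_left cinner_scaleR_left cinner_scaleR_right cinner_adj)

text \<open>Every \<open>T\<close> is a complex combination of the self-adjoint operators
  \<open>T + adj T\<close> and \<open>\<i>\<close> times \<open>T - adj T\<close>, and both stay in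
  the commutant of a self-adjoint set.\<close>

lemma trivial_commutant_selfadjointI:
  assumes X: "selfadjoint_set X"
    and *: "\<And>T. T \<in> commutant X \<Longrightarrow> adj T = T \<Longrightarrow> \<exists>c. T = cmul c"
  shows "trivial_commutant X"
  unfolding trivial_commutant_def
proof
  fix T assume T: "T \<in> commutant X"
  note b = commutantD(1)[OF T]
  have aT: "adj T \<in> commutant X"
    using selfadjoint_setD(3)[OF selfadjoint_set_commutant[OF X] T] .
  note ba = adj_in_bounded_ops[OF b]
  define B where "B = cmul \<i> o\<^sub>L (T - adj T)"
  have "\<exists>c. T + adj T = cmul c"
    by (intro * commutant_add T aT) (simp add: adj_add b ba adj_adj)
  then obtain c1 where c1: "T + adj T = cmul c1" ..
  have "adj B = (adj T - T) o\<^sub>L cmul (- \<i>)"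
    unfolding B_def
    by (simp add: adj_compose cmul_in_bounded_ops bounded_ops_diff b ba adj_cmul adj_diff adj_adj)
  also have "\<dots> = B"
    unfolding B_def
    by (rule blinfun_eqI)
      (simp add: blinfun.diff_left blinfun.minus_right bounded_opsD[OF b] bounded_opsD[OF ba] scaleC_diff_right)
  finally have "\<exists>c. B = cmul c"
    using * unfolding B_def
    by (meson T aT X cmul_in_commutant commutant_compose commutant_diff selfadjoint_setD(1))
  then obtain c2 where c2: "B = cmul c2" ..
  have "T = cmul (c1 / 2 + c2 / (2 * \<i>))"
  proof (rule blinfun_eqI)
    fix x
    define u where "u = blinfun_apply T x"
    define v where "v = blinfun_apply (adj T) x"
    have 1: "c1 *\<^sub>C x = u + v"
      using arg_cong[OF c1, of "\<lambda>S. blinfun_apply S x"] by (simp add: blinfun.add_left u_def v_def)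
    have 2: "c2 *\<^sub>C x = \<i> *\<^sub>C (u - v)"
      using arg_cong[OF c2, of "\<lambda>S. blinfun_apply S x"]
      by (simp add: blinfun.diff_left u_def v_def B_def)
    have "(c1 / 2 + c2 / (2 * \<i>)) *\<^sub>C x = (1/2) *\<^sub>C c1 *\<^sub>C x + (1 / (2 * \<i>)) *\<^sub>C c2 *\<^sub>C x"
      by (simp add: scaleC_add_left scaleC_diff_left scaleC_scaleC)
    also have "\<dots> = (1/2) *\<^sub>C (u + v) + (1/2) *\<^sub>C (u - v)"
      unfolding 1 2 by (simp add: scaleC_scaleC)
    also have "\<dots> = (1/2 + 1/2) *\<^sub>C u"
      unfolding scaleC_add_left by (simp add: scaleC_add_right scaleC_diff_right)
    finally show "blinfun_apply T x = blinfun_apply (cmul (c1 / 2 + c2 / (2 * \<i>))) x"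
      by (simp add: u_def)
  qed
  then show "\<exists>c. T = cmul c" ..
qed

text \<open>The iteration stays in the closed set of symmetric operators in the commutant of
  \<open>X\<close>. As \<open>X\<close> is free, the root can be made to commute with anything that
  \<open>b\<close> commutes with. The bound on \<open>id_blinfun - R\<close> stands in for
  positivity of \<open>R\<close>.\<close>

lemma op_sqrt:
  assumes b: "b \<in> commutant X" "adj b = b" "norm b \<le> 1"
  obtains R where "R \<in> commutant X" "adj R = R" "R o\<^sub>L R = id_blinfun - b"
    "norm (id_blinfun - R) \<le> 1"
proof -
  have ib: "inner (blinfun_apply b x) y = inner x (blinfun_apply b y)" for x y
    using inner_adj[of b] b(2) by simp
  define P where "P = {Y \<in> commutant X. \<forall>x y. inner (blinfun_apply Y x) y = inner x (blinfun_apply Y y)}"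
  have "closed P"
    unfolding P_def Collect_conj_eq
    by (intro closed_Int closed_Collect_all closed_Collect_eq continuous_intros
        blinfun.continuous_on) (simp add: closed_commutant)
  moreover have "0 \<in> P"
    by (simp add: P_def zero_in_commutant)
  moreover have "(1/2) *\<^sub>R (b + (y o\<^sub>L y)) \<in> P" if "y \<in> P" for y
    using that b(1) unfolding P_def
    by (auto intro!: commutant_scaleR commutant_add commutant_compose
        simp: blinfun.add_left blinfun.scaleR_left inner_simps ib)
  ultimately obtain Y where Y: "Y \<in> P" "norm Y \<le> 1" "2 *\<^sub>R Y = b + (Y o\<^sub>L Y)"
    by (rule sqrt_iteration[OF bounded_bilinear_blinfun_compose norm_blinfun_compose b(3)])
  show thesis
  proof
    show "id_blinfun - Y \<in> commutant X"
      using Y(1) by (intro commutant_diff id_in_commutant) (simp add: P_def)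
    show "adj (id_blinfun - Y) = id_blinfun - Y"
      using Y(1) unfolding P_def
      by (intro blinfun_eqI vector_eq_rdot[THEN iffD1])
        (simp add: inner_adj blinfun.diff_left inner_simps)
    show "(id_blinfun - Y) o\<^sub>L (id_blinfun - Y) = id_blinfun - b"
    proof (rule blinfun_eqI)
      fix x
      have "2 *\<^sub>R blinfun_apply Y x = blinfun_apply b x + blinfun_apply Y (blinfun_apply Y x)"
        using arg_cong[OF Y(3), of "\<lambda>S. blinfun_apply S x"]
        by (simp add: blinfun.add_left blinfun.scaleR_left)
      then show "blinfun_apply ((id_blinfun - Y) o\<^sub>L (id_blinfun - Y)) x = blinfun_apply (id_blinfun - b) x"
        by (simp add: blinfun.diff_left blinfun.diff_right scaleR_2 algebra_simps)
    qed
    show "norm (id_blinfun - (id_blinfun - Y)) \<le> 1"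
      using Y(2) by simp
  qed
qed

text \<open>Schur's lemma.  A self-adjoint \<open>C\<close> in the commutant with \<open>\<langle>x\<^sub>0, C x\<^sub>0\<rangle> = 0\<close> kills \<open>x\<^sub>0\<close>: the
  kernel of \<open>\<bar>C\<bar> - C\<close> is invariant, so \<open>C = \<plusminus>\<bar>C\<bar>\<close>.\<close>

context
  fixes X :: "('h::chilbert_space \<Rightarrow>\<^sub>L 'h) set"
  assumes X: "selfadjoint_set X"
    and irr: "\<And>V. csubspace V \<Longrightarrow> closed V \<Longrightarrow>
      (\<And>T x. T \<in> X \<Longrightarrow> x \<in> V \<Longrightarrow> blinfun_apply T x \<in> V) \<Longrightarrow> V = {0} \<or> V = UNIV"
begin

private lemma kernel_cases:
  assumes S: "S \<in> commutant X"
  shows "(\<forall>x. blinfun_apply S x = 0 \<longrightarrow> x = 0) \<or> S = 0"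
proof -
  define V where "V = {x. blinfun_apply S x = 0}"
  have "V = {0} \<or> V = UNIV"
  proof (rule irr)
    show "csubspace V"
      unfolding csubspace_def V_def
      by (auto simp: blinfun.add_right bounded_opsD[OF commutantD(1)[OF S]])
    show "closed V"
      unfolding V_def by (intro closed_Collect_eq continuous_intros)
    show "blinfun_apply T x \<in> V" if "T \<in> X" "x \<in> V" for T x
      using that commutantD(3)[OF S] by (simp add: V_def)
  qed
  then show ?thesis
  proof
    assume "V = UNIV"
    then have "S = 0"
      by (intro blinfun_eqI) (auto simp: V_def)
    then show ?thesis ..
  qed (auto simp: V_def)
qed

private lemma selfadjoint_expectation_zero:
  assumes C: "C \<in> commutant X" "adj C = C" and x0: "inner x0 (blinfun_apply C x0) = 0"
  shows "blinfun_apply C x0 = 0"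
proof -
  \<comment> \<open>Scaling to norm at most 1 makes \<open>b\<close> = 1 - A^2 a contraction, and
    the root \<open>R\<close> of 1 - b = A^2 is the absolute value of \<open>A\<close>. The
    \<open>+ 1\<close> covers C = 0.\<close>
  define A where "A = (1 / (norm C + 1)) *\<^sub>R C"
  have nA: "norm A \<le> 1"
    by (simp add: A_def divide_le_eq not_less add_nonneg_nonneg)
  have A: "A \<in> commutant X" and aA: "adj A = A"
    using C by (simp_all add: A_def commutant_scaleR adj_scaleR commutantD(1))
  have iA: "inner (blinfun_apply A x) y = inner x (blinfun_apply A y)" for x y
    using inner_adj[of A] aA by simp
  define b where "b = id_blinfun - (A o\<^sub>L A)"
  have "norm b \<le> 1"
  proof (rule norm_blinfun_bound)
    fix x
    define u where "u = blinfun_apply A x"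
    have Au: "norm (blinfun_apply A u) \<le> norm u"
      using norm_blinfun[of A u] nA by (meson mult_left_le_one_le norm_ge_zero order_trans)
    have "(norm (blinfun_apply b x))\<^sup>2
        = (norm x)\<^sup>2 - 2 * inner x (blinfun_apply A u) + (norm (blinfun_apply A u))\<^sup>2"
      unfolding power2_norm_eq_inner b_def
      by (simp add: blinfun.diff_left inner_simps u_def inner_commute algebra_simps)
    also have "inner x (blinfun_apply A u) = (norm u)\<^sup>2"
      unfolding power2_norm_eq_inner by (simp add: iA[symmetric] u_def)
    also have "(norm x)\<^sup>2 - 2 * (norm u)\<^sup>2 + (norm (blinfun_apply A u))\<^sup>2 \<le> (norm x)\<^sup>2"
      using power_mono[OF Au norm_ge_zero, of 2] zero_le_power2[of "norm u"] by linarith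
    finally have "(norm (blinfun_apply b x))\<^sup>2 \<le> (norm x)\<^sup>2" .
    from power2_le_imp_le[OF this norm_ge_zero] show "norm (blinfun_apply b x) \<le> 1 * norm x"
      by simp
  qed simp
  have "adj b = b"
    unfolding b_def by (simp add: adj_diff adj_id adj_compose aA id_in_bounded_ops
        bounded_ops_compose commutantD(1)[OF A])
  \<comment> \<open>Inserting \<open>A\<close> makes \<open>R\<close> commute with \<open>A\<close>
    as well, which gives (R - A) (R + A) = 0.\<close>
  have "b \<in> commutant (insert A X)"
    unfolding b_def using A
    by (intro commutant_diff id_in_commutant commutant_compose) (auto simp: commutant_def)
  then obtain R where R': "R \<in> commutant (insert A X)" "R o\<^sub>L R = id_blinfun - b"
      "norm (id_blinfun - R) \<le> 1"
    using op_sqrt \<open>adj b = b\<close> \<open>norm b \<le> 1\<close> by metis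
  define Y where "Y = id_blinfun - R"
  have R: "R \<in> commutant X"
    using R'(1) by (auto simp: commutant_def)
  have RR: "blinfun_apply R (blinfun_apply R x) = blinfun_apply A (blinfun_apply A x)" for x
    using arg_cong[OF R'(2), of "\<lambda>S. blinfun_apply S x"] by (simp add: b_def)
  have RA: "blinfun_apply (R - A) (blinfun_apply (R + A) x) = 0" for x
    by (simp add: blinfun.diff_left blinfun.add_left blinfun.add_right RR)
      (simp add: commutantD(3)[OF R'(1)])
  have AR: "A = R \<or> A = - R"
    using kernel_cases[OF commutant_diff[OF R A]]
  proof
    assume "\<forall>x. blinfun_apply (R - A) x = 0 \<longrightarrow> x = 0"
    then have "R + A = 0"
      using RA by (intro blinfun_eqI) auto
    then show ?thesis
      by (simp add: eq_neg_iff_add_eq_0 add.commute)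
  qed simp
  have "inner x0 (blinfun_apply A x0) = 0"
    using x0 by (simp add: A_def blinfun.scaleR_left)
  then have "inner x0 (blinfun_apply R x0) = 0"
    using AR by (auto simp: blinfun.minus_left)
  \<comment> \<open>Equality case of Cauchy-Schwarz: \<open>Y\<close> is a contraction whose
    expectation at \<open>x0\<close> is |x0|^2, so \<open>Y\<close> fixes \<open>x0\<close> and
    \<open>R\<close> kills it.\<close>
  then have "inner x0 (blinfun_apply Y x0) = inner x0 x0"
    by (simp add: Y_def blinfun.diff_left inner_simps)
  moreover have "norm (blinfun_apply Y x0) \<le> norm x0"
    using norm_blinfun[of Y x0] R'(3) unfolding Y_def by (meson mult_left_le_one_le norm_ge_zero order_trans)
  then have "inner (blinfun_apply Y x0) (blinfun_apply Y x0) \<le> inner x0 x0"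
    unfolding power2_norm_eq_inner[symmetric] by (simp add: power_mono)
  ultimately have "(norm (x0 - blinfun_apply Y x0))\<^sup>2 \<le> 0"
    unfolding power2_norm_eq_inner by (simp add: inner_simps inner_commute)
  then have "blinfun_apply R x0 = 0"
    by (simp add: Y_def blinfun.diff_left)
  then have "blinfun_apply A x0 = 0"
    using AR by (auto simp: blinfun.minus_left)
  then show ?thesis
    by (simp add: A_def blinfun.scaleR_left add_nonneg_eq_0_iff)
qed

lemma schur: "trivial_commutant X"
proof (rule trivial_commutant_selfadjointI[OF X])
  fix T assume T: "T \<in> commutant X" "adj T = T"
  show "\<exists>c. T = cmul c"
  proof (cases "\<exists>x0::'h. x0 \<noteq> 0")
    case False
    then have "T = cmul 0"
      by (intro blinfun_eqI) auto
    then show ?thesis ..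
  next
    case True
    then obtain x0 :: 'h where x0: "x0 \<noteq> 0" ..
    \<comment> \<open>\<open>r\<close> is the expectation of \<open>T\<close> at \<open>x0\<close>,
      so that \<open>C\<close> has expectation zero there; killing the nonzero \<open>x0\<close>
      then forces C = 0.\<close>
    define r where "r = inner x0 (blinfun_apply T x0) / inner x0 x0"
    define C where "C = T - r *\<^sub>R id_blinfun"
    have C: "C \<in> commutant X"
      unfolding C_def by (intro commutant_diff commutant_scaleR id_in_commutant T)
    have "adj C = C"
      by (simp add: C_def adj_diff adj_scaleR adj_id id_in_bounded_ops bounded_ops_scaleR
          commutantD(1)[OF T(1)] T(2))
    moreover have "inner x0 (blinfun_apply C x0) = 0"
      using x0 by (simp add: C_def r_def blinfun.diff_left blinfun.scaleR_left inner_simps)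
    ultimately have "blinfun_apply C x0 = 0"
      using C by (intro selfadjoint_expectation_zero)
    then have "C = 0"
      using kernel_cases[OF C] x0 by blast
    then have "T = cmul (complex_of_real r)"
      by (intro blinfun_eqI) (simp add: C_def scaleC_of_real blinfun.scaleR_left)
    then show ?thesis ..
  qed
qed

end

text \<open>With \<open>M\<close> the bicommutant of \<open>X\<close>, the vectors \<open>v\<close> such that \<open>E m v = 0\<close> for all \<open>m \<in> M\<close> form a
  subspace invariant under \<open>M\<close> and \<open>M'\<close>, so its projection is central.\<close>

lemma factor_product_zero:
  assumes X: "selfadjoint_set X"
    and center: "\<And>Z. Z \<in> commutant X \<Longrightarrow> Z \<in> commutant (commutant X) \<Longrightarrow> \<exists>c. Z = cmul c"
    and E: "E \<in> commutant (commutant X)" "E \<noteq> 0"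
    and Y: "Y \<in> commutant X" "E o\<^sub>L Y = 0"
  shows "Y = 0"
proof -
  note X' = selfadjoint_set_commutant[OF X]
  note X'' = selfadjoint_set_commutant[OF X']
  define W where "W = {v. \<forall>m\<in>commutant (commutant X). blinfun_apply E (blinfun_apply m v) = 0}"
  have W: "csubspace W"
    unfolding csubspace_def W_def
    by (auto simp: blinfun.add_right bounded_opsD[OF commutantD(1)] bounded_opsD[OF commutantD(1)[OF E(1)]])
  have W': "closed W"
    unfolding W_def Collect_ball_eq by (intro closed_INT ballI closed_Collect_eq continuous_intros)
  have "proj_onto W \<in> commutant (commutant (commutant X))"
  proof (intro proj_onto_commutant[OF W W'])
    show "commutant (commutant X) \<subseteq> bounded_ops"
      "\<And>T. T \<in> commutant (commutant X) \<Longrightarrow> adj T \<in> commutant (commutant X)"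
      using selfadjoint_setD[OF X''] by auto
    show "blinfun_apply T v \<in> W" if T: "T \<in> commutant (commutant X)" and v: "v \<in> W" for T v
      unfolding W_def
    proof (intro CollectI ballI)
      fix m assume "m \<in> commutant (commutant X)"
      then have "m o\<^sub>L T \<in> commutant (commutant X)"
        using T by (rule commutant_compose)
      then have "blinfun_apply E (blinfun_apply (m o\<^sub>L T) v) = 0"
        using v unfolding W_def by blast
      then show "blinfun_apply E (blinfun_apply m (blinfun_apply T v)) = 0"
        by simp
    qed
  qed
  then have 1: "proj_onto W \<in> commutant X"
    by (simp add: commutant_bicommutant selfadjoint_setD(1)[OF X])
  have "proj_onto W \<in> commutant (commutant X)"
  proof (intro proj_onto_commutant[OF W W'])
    show "commutant X \<subseteq> bounded_ops" "\<And>T. T \<in> commutant X \<Longrightarrow> adj T \<in> commutant X"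
      using selfadjoint_setD[OF X'] by auto
    show "blinfun_apply n v \<in> W" if n: "n \<in> commutant X" and v: "v \<in> W" for n v
      using v commutantD(3)[OF _ n] E(1) by (auto simp: W_def)
  qed
  from center[OF 1 this] obtain c where c: "proj_onto W = cmul c" ..
  have "W = {0}"
  proof (cases "c = 0")
    case True
    then show ?thesis
      using proj_onto_ident[OF W W'] c csubspaceD(1)[OF W] by auto
  next
    case False
    have "v \<in> W" for v
    proof -
      have "v = (1 / c) *\<^sub>C (c *\<^sub>C v)"
        using False by (simp add: scaleC_scaleC)
      also have "c *\<^sub>C v \<in> W"
        using proj_onto_mem[OF W W', of v] c by simp
      then have "(1 / c) *\<^sub>C (c *\<^sub>C v) \<in> W"
        by (rule csubspaceD[OF W])
      finally show ?thesis .
    qed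
    then have "blinfun_apply E v = 0" for v
      using id_in_commutant[of "commutant X"] unfolding W_def by force
    then have "E = 0"
      by (intro blinfun_eqI) simp
    with E show ?thesis
      by simp
  qed
  moreover have "blinfun_apply Y v \<in> W" for v
  proof -
    have "blinfun_apply E (blinfun_apply m (blinfun_apply Y v)) = 0"
      if m: "m \<in> commutant (commutant X)" for m
    proof -
      have "blinfun_apply E (blinfun_apply m (blinfun_apply Y v))
          = blinfun_apply (E o\<^sub>L Y) (blinfun_apply m v)"
        using commutantD(3)[OF m Y(1)] by simp
      then show ?thesis
        unfolding Y by simp
    qed
    then show ?thesis
      by (simp add: W_def)
  qed
  ultimately show ?thesis
    by (intro blinfun_eqI) auto
qed

section \<open>Representations\<close>

lemma norm_star: "norm (star a) = norm (a::'a::cstar_algebra)"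
proof -
  have *: "norm a \<le> norm (star a)" for a :: 'a
  proof (cases "norm a = 0")
    case False
    have "norm a * norm a \<le> norm (star a) * norm a"
      using norm_mult_ineq[of "star a" a] by (simp add: cstar_identity power2_eq_square)
    with False show ?thesis
      by (simp add: mult_le_cancel_right)
  qed simp
  show ?thesis
    using *[of a] *[of "star a"] by (simp add: star_star)
qed

lemma bounded_linear_star: "bounded_linear (star :: 'a::cstar_algebra \<Rightarrow> 'a)"
proof (rule bounded_linear_intro[where K = 1])
  show "star (r *\<^sub>R x) = r *\<^sub>R star x" for r and x :: 'a
    using star_scaleC[of "complex_of_real r" x] by (simp add: scaleC_of_real)
qed (simp_all add: star_add norm_star)

lemmas star_diff = linear_diff[OF bounded_linear.linear[OF bounded_linear_star]]
lemmas star_zero = linear_0[OF bounded_linear.linear[OF bounded_linear_star]]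
lemmas continuous_on_star [continuous_intros] = bounded_linear.continuous_on[OF bounded_linear_star]

lemma star_one [simp]: "star (1::'a::cstar_algebra) = 1"
  by (metis mult.left_neutral mult.right_neutral star_mult star_star)

lemma star_representationD:
  assumes "star_representation A \<pi>"
  shows "a \<in> A \<Longrightarrow> \<pi> a \<in> bounded_ops"
    and "a \<in> A \<Longrightarrow> b \<in> A \<Longrightarrow> \<pi> (a + b) = \<pi> a + \<pi> b"
    and "a \<in> A \<Longrightarrow> \<pi> (c *\<^sub>C a) = cmul c o\<^sub>L \<pi> a"
    and "a \<in> A \<Longrightarrow> b \<in> A \<Longrightarrow> \<pi> (a * b) = \<pi> a o\<^sub>L \<pi> b"
    and "a \<in> A \<Longrightarrow> \<pi> (star a) = adj (\<pi> a)"
  using assms unfolding star_representation_def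
  by (auto simp: is_adjoint_iff intro: blinfun_eqI)

text \<open>Non-degeneracy is the point: \<open>\<pi> 1\<close> fixes every vector of the form
  \<open>\<pi> a\<close> x, and these span a dense subspace.\<close>

lemma star_representation_one:
  assumes "star_representation A \<pi>" "1 \<in> A"
  shows "\<pi> 1 = id_blinfun"
proof -
  define D where "D = {blinfun_apply (\<pi> a) x |a x. a \<in> A}"
  have "\<pi> (1 * a) = \<pi> 1 o\<^sub>L \<pi> a" if "a \<in> A" for a
    using star_representationD(4)[OF assms that] .
  then have "D \<subseteq> {x. blinfun_apply (\<pi> 1) x = x}"
    unfolding D_def by (auto simp: blinfun_apply_blinfun_compose[symmetric]
        simp del: blinfun_apply_blinfun_compose)
  moreover have "subspace {x. blinfun_apply (\<pi> 1) x = x}"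
    by (auto simp: subspace_def blinfun.add_right blinfun.scaleR_right)
  ultimately have "span D \<subseteq> {x. blinfun_apply (\<pi> 1) x = x}"
    by (rule span_minimal)
  moreover have "closure (span D) = UNIV"
    using assms unfolding star_representation_def D_def by blast
  ultimately show ?thesis
    by (intro blinfun_eq_on_dense[of "span D"]) auto
qed

lemma selfadjoint_set_image:
  assumes "star_representation B \<pi>" "A \<subseteq> B" "\<And>a. a \<in> A \<Longrightarrow> star a \<in> A"
  shows "selfadjoint_set (\<pi> ` A)"
  unfolding selfadjoint_set_def
proof (intro conjI subsetI ballI)
  fix T assume "T \<in> \<pi> ` A"
  then obtain a where a: "a \<in> A" "T = \<pi> a"
    by blast
  then show "T \<in> bounded_ops"
    using star_representationD(1)[OF assms(1)] assms(2) by blast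
  have "adj T = \<pi> (star a)"
    using star_representationD(5)[OF assms(1)] assms(2) a by auto
  then show "adj T \<in> \<pi> ` A"
    using assms(3)[OF a(1)] by blast
qed

context
  fixes \<pi> :: "'a::cstar_algebra \<Rightarrow> 'h::chilbert_space \<Rightarrow>\<^sub>L 'h"
  assumes rep: "star_representation UNIV \<pi>"
begin

lemma rep_bounded_ops: "\<pi> a \<in> bounded_ops"
  and rep_add: "\<pi> (a + b) = \<pi> a + \<pi> b"
  and rep_scaleC: "\<pi> (c *\<^sub>C a) = cmul c o\<^sub>L \<pi> a"
  and rep_mult: "\<pi> (a * b) = \<pi> a o\<^sub>L \<pi> b"
  and rep_star: "\<pi> (star a) = adj (\<pi> a)"
  using star_representationD[OF rep] by auto

lemma rep_one: "\<pi> 1 = id_blinfun"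
  by (rule star_representation_one[OF rep]) simp

lemma rep_scaleR: "\<pi> (r *\<^sub>R a) = r *\<^sub>R \<pi> a"
proof -
  have "\<pi> (r *\<^sub>R a) = cmul (complex_of_real r) o\<^sub>L \<pi> a"
    by (metis rep_scaleC scaleC_of_real)
  then show ?thesis
    by (intro blinfun_eqI) (simp add: scaleC_of_real blinfun.scaleR_left)
qed

lemma rep_diff: "\<pi> (a - b) = \<pi> a - \<pi> b"
  using rep_add[of a "(-1) *\<^sub>R b"] by (simp only: rep_scaleR) simp

lemma cinner_rep: "cinner (blinfun_apply (\<pi> a) x) y = cinner x (blinfun_apply (\<pi> (star a)) y)"
  by (simp add: rep_star cinner_adj' rep_bounded_ops)

lemma cinner_rep2:
  "cinner (blinfun_apply (\<pi> a) x) (blinfun_apply (\<pi> b) y) = cinner x (blinfun_apply (\<pi> (star a * b)) y)"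
  by (simp add: cinner_rep rep_mult)

text \<open>When \<open>\<parallel>c\<parallel> \<le> 1\<close>, the element \<open>1 - c\<^sup>* c\<close> is the square of a self-adjoint one.\<close>

lemma norm_rep_le: "norm (\<pi> c) \<le> norm c"
proof -
  have *: "norm (blinfun_apply (\<pi> c) x) \<le> norm x" if "norm c \<le> 1" for c x
  proof -
    define b where "b = star c * c"
    have nb: "norm b \<le> 1"
      using that by (simp add: b_def cstar_identity power_le_one)
    have sb: "star b = b"
      by (simp add: b_def star_mult star_star)
    define P where "P = {y::'a. star y = y}"
    have "closed P"
      unfolding P_def by (intro closed_Collect_eq continuous_intros)
    moreover have "0 \<in> P"
      by (simp add: P_def star_zero)
    moreover have "(1/2) *\<^sub>R (b + y * y) \<in> P" if "y \<in> P" for y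
      using that sb by (simp add: P_def star_add star_mult linear_scale[OF bounded_linear.linear[OF bounded_linear_star]])
    ultimately obtain y where y: "y \<in> P" "2 *\<^sub>R y = b + y * y"
      by (rule sqrt_iteration[OF bounded_bilinear_mult norm_mult_ineq nb])
    have "(1 - y) * (1 - y) = 1 - b"
      using y(2) by (simp add: algebra_simps scaleR_2)
    moreover have "star (1 - y) = 1 - y"
      using y(1) by (simp add: P_def star_diff)
    ultimately have "star (1 - y) * (1 - y) = 1 - star c * c"
      by (simp add: b_def)
    then have "cinner (blinfun_apply (\<pi> (1 - y)) x) (blinfun_apply (\<pi> (1 - y)) x)
        = cinner x x - cinner (blinfun_apply (\<pi> c) x) (blinfun_apply (\<pi> c) x)"
      unfolding cinner_rep2 by (simp add: rep_diff rep_one blinfun.diff_left cinner_diff_right)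
    then have "(norm (blinfun_apply (\<pi> (1 - y)) x))\<^sup>2 = (norm x)\<^sup>2 - (norm (blinfun_apply (\<pi> c) x))\<^sup>2"
      unfolding cinner_self of_real_diff[symmetric] of_real_eq_iff .
    then have "(norm (blinfun_apply (\<pi> c) x))\<^sup>2 \<le> (norm x)\<^sup>2"
      using zero_le_power2[of "norm (blinfun_apply (\<pi> (1 - y)) x)"] by linarith
    then show ?thesis
      by (rule power2_le_imp_le) simp
  qed
  show ?thesis
  proof (cases "c = 0")
    case True
    then show ?thesis
      using rep_scaleR[of 0 c] by simp
  next
    case False
    have "norm ((1 / norm c) *\<^sub>R blinfun_apply (\<pi> c) x) \<le> norm x" for x
      using *[of "(1 / norm c) *\<^sub>R c" x] False by (simp add: rep_scaleR blinfun.scaleR_left)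
    then have "norm (blinfun_apply (\<pi> c) x) \<le> norm c * norm x" for x
      using False by (simp add: divide_le_eq mult.commute)
    then show ?thesis
      by (intro norm_blinfun_bound) auto
  qed
qed

lemma bounded_linear_rep: "bounded_linear \<pi>"
  by (rule bounded_linear_intro[where K = 1]) (simp_all add: rep_add rep_scaleR norm_rep_le)

lemma csubspace_orbit: "csubspace (range (\<lambda>a. blinfun_apply (\<pi> a) x))"
proof -
  have "0 = blinfun_apply (\<pi> 0) x" 
    using rep_scaleR[of 0 0] by simp
  moreover have "blinfun_apply (\<pi> a) x + blinfun_apply (\<pi> b) x = blinfun_apply (\<pi> (a + b)) x" for a b
    by (simp add: rep_add blinfun.add_left)
  moreover have "c *\<^sub>C blinfun_apply (\<pi> a) x = blinfun_apply (\<pi> (c *\<^sub>C a)) x" for c a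
    by (simp add: rep_scaleC)
  ultimately show ?thesis
    unfolding csubspace_def by blast
qed

lemma closure_orbit_invariant:
  assumes "v \<in> closure (range (\<lambda>a. blinfun_apply (\<pi> a) x))"
  shows "blinfun_apply (\<pi> b) v \<in> closure (range (\<lambda>a. blinfun_apply (\<pi> a) x))"
proof -
  have "blinfun_apply (\<pi> b) ` closure (range (\<lambda>a. blinfun_apply (\<pi> a) x))
      \<subseteq> closure (blinfun_apply (\<pi> b) ` range (\<lambda>a. blinfun_apply (\<pi> a) x))"
    by (intro closure_bounded_linear_image_subset blinfun.bounded_linear_right)
  also have "\<dots> \<subseteq> closure (range (\<lambda>a. blinfun_apply (\<pi> a) x))"
    by (intro closure_mono) (auto simp flip: blinfun_apply_blinfun_compose rep_mult)
  finally show ?thesis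
    using assms by blast
qed

lemma mem_closure_orbit: "x \<in> closure (range (\<lambda>a. blinfun_apply (\<pi> a) x))"
proof -
  have "blinfun_apply (\<pi> 1) x \<in> closure (range (\<lambda>a. blinfun_apply (\<pi> a) x))"
    by (rule subsetD[OF closure_subset]) (rule rangeI)
  then show ?thesis
    by (simp add: rep_one)
qed

text \<open>The projection onto the closed orbit of \<open>x\<close> commutes with
  \<open>\<pi>\<close>, so it is a scalar; it fixes \<open>x\<close>, so the scalar is 1.\<close>

lemma trivial_commutant_cyclic:
  assumes "trivial_commutant (range \<pi>)" "x \<noteq> 0"
  shows "closure (range (\<lambda>a. blinfun_apply (\<pi> a) x)) = UNIV"
proof -
  define V where "V = closure (range (\<lambda>a. blinfun_apply (\<pi> a) x))"
  have V: "csubspace V" "closed V"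
    unfolding V_def by (auto intro: csubspace_closure csubspace_orbit)
  have "proj_onto V \<in> commutant (range \<pi>)"
    using V by (rule proj_onto_commutant)
      (auto simp: rep_bounded_ops V_def closure_orbit_invariant simp flip: rep_star)
  then obtain c where c: "proj_onto V = cmul c"
    using assms(1) unfolding trivial_commutant_def by blast
  have "c *\<^sub>C x = x"
    using proj_onto_ident[OF V, of x] mem_closure_orbit c by (simp add: V_def)
  then have "(c - 1) *\<^sub>C x = 0"
    by (simp add: scaleC_diff_left)
  then have "c = 1"
    using norm_scaleC_hilbert[of "c - 1" x] assms(2) by simp
  then have "v \<in> V" for v
    using proj_onto_mem[OF V, of v] c by simp
  then show ?thesis
    unfolding V_def by blast
qed

end

lemma cinner_eq_on_dense:
  fixes x y :: "'h::chilbert_space"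
  assumes "closure D = UNIV" "\<And>z. z \<in> D \<Longrightarrow> cinner z x = cinner z y"
  shows "x = y"
proof (rule cinner_eqI)
  fix z
  have "closed {z. cinner z x = cinner z y}"
    by (intro closed_Collect_eq continuous_intros)
  then have "closure D \<subseteq> {z. cinner z x = cinner z y}"
    using assms(2) by (intro closure_minimal) auto
  then show "cinner z x = cinner z y"
    using assms(1) by blast
qed

text \<open>The GNS uniqueness argument: the norm of \<open>\<pi> a\<close> g is sqrt |s| times that
  of \<open>\<rho> a\<close> h, so sending the latter vector to the former is well defined and
  bounded. The factor \<open>s\<close> admits vectors \<open>g\<close> of any norm, including
  0.\<close>

lemma cyclic_intertwiner:
  fixes \<rho> :: "'a::cstar_algebra \<Rightarrow> 'h::chilbert_space \<Rightarrow>\<^sub>L 'h"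
    and \<pi> :: "'a \<Rightarrow> 'k::chilbert_space \<Rightarrow>\<^sub>L 'k"
  assumes \<rho>: "star_representation UNIV \<rho>" and \<pi>: "star_representation UNIV \<pi>"
    and cyc: "closure (range (\<lambda>a. blinfun_apply (\<rho> a) h)) = UNIV"
    and eq: "\<And>a. cinner g (blinfun_apply (\<pi> a) g) = s * cinner h (blinfun_apply (\<rho> a) h)"
  obtains V where "V \<in> bounded_ops" "\<And>a. blinfun_apply V (blinfun_apply (\<rho> a) h) = blinfun_apply (\<pi> a) g"
    "\<And>a. V o\<^sub>L \<rho> a = \<pi> a o\<^sub>L V"
proof -
  define L where "L = range (\<lambda>a. (blinfun_apply (\<rho> a) h, blinfun_apply (\<pi> a) g))"
  have "\<exists>V\<in>bounded_ops. \<forall>x y. (x, y) \<in> L \<longrightarrow> blinfun_apply V x = y"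
  proof (rule extend_from_dense[of L "sqrt (cmod s)"])
    show "(0, 0) \<in> L"
      unfolding L_def using rep_scaleR[OF \<rho>, of 0 0] rep_scaleR[OF \<pi>, of 0 0]
      by (intro image_eqI[of _ _ 0]) auto
    show "(x + x', y + y') \<in> L" if "(x, y) \<in> L" "(x', y') \<in> L" for x y x' y'
    proof -
      obtain a where "x = blinfun_apply (\<rho> a) h" "y = blinfun_apply (\<pi> a) g"
        using \<open>(x, y) \<in> L\<close> unfolding L_def by auto
      moreover obtain b where "x' = blinfun_apply (\<rho> b) h" "y' = blinfun_apply (\<pi> b) g"
        using \<open>(x', y') \<in> L\<close> unfolding L_def by auto
      ultimately show ?thesis
        unfolding L_def by (intro image_eqI[of _ _ "a + b"]) (auto simp: rep_add[OF \<rho>] rep_add[OF \<pi>] blinfun.add_left)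
    qed
    show "(c *\<^sub>C x, c *\<^sub>C y) \<in> L" if "(x, y) \<in> L" for c x y
    proof -
      obtain a where "x = blinfun_apply (\<rho> a) h" "y = blinfun_apply (\<pi> a) g"
        using \<open>(x, y) \<in> L\<close> unfolding L_def by auto
      then show ?thesis
        unfolding L_def by (intro image_eqI[of _ _ "c *\<^sub>C a"]) (auto simp: rep_scaleC[OF \<rho>] rep_scaleC[OF \<pi>])
    qed
    show "norm y \<le> sqrt (cmod s) * norm x" if "(x, y) \<in> L" for x y
    proof -
      obtain a where a: "x = blinfun_apply (\<rho> a) h" "y = blinfun_apply (\<pi> a) g"
        using \<open>(x, y) \<in> L\<close> unfolding L_def by auto
      have "cinner y y = s * cinner x x"
        unfolding a cinner_rep2[OF \<rho>] cinner_rep2[OF \<pi>] by (rule eq)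
      then have "cmod (cinner y y) = cmod s * cmod (cinner x x)"
        by (simp only: norm_mult)
      then have "(norm y)\<^sup>2 = (sqrt (cmod s) * norm x)\<^sup>2"
        by (simp add: cinner_self norm_power power_mult_distrib)
      then show ?thesis
        by (simp only: power2_eq_iff_nonneg[OF norm_ge_zero mult_nonneg_nonneg] real_sqrt_ge_zero norm_ge_zero)
    qed
    show "closure (fst ` L) = UNIV"
      using cyc unfolding L_def by (simp add: image_image)
  qed
  then obtain V where V: "V \<in> bounded_ops" "\<And>x y. (x, y) \<in> L \<Longrightarrow> blinfun_apply V x = y"
    by blast
  have 1: "blinfun_apply V (blinfun_apply (\<rho> a) h) = blinfun_apply (\<pi> a) g" for a
    using V(2) unfolding L_def by blast
  have "V o\<^sub>L \<rho> a = \<pi> a o\<^sub>L V" for a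
    using cyc
  proof (rule blinfun_eq_on_dense)
    fix x assume "x \<in> range (\<lambda>a. blinfun_apply (\<rho> a) h)"
    then obtain b where "x = blinfun_apply (\<rho> b) h" ..
    then show "blinfun_apply (V o\<^sub>L \<rho> a) x = blinfun_apply (\<pi> a o\<^sub>L V) x"
      using 1[of "a * b"] by (simp add: 1 rep_mult[OF \<rho>] rep_mult[OF \<pi>])
  qed
  with V(1) 1 show thesis
    by (rule that)
qed

text \<open>\<open>adj V o\<^sub>L W\<close> is determined by its matrix elements on the dense orbit
  of \<open>h\<close>. Allowing two different vectors \<open>g\<close> and \<open>k\<close> yields
  the relations between different copies of \<open>\<rho>\<close>, not only the norms.\<close>

lemma cyclic_intertwiner_inner:
  fixes \<rho> :: "'a::cstar_algebra \<Rightarrow> 'h::chilbert_space \<Rightarrow>\<^sub>L 'h"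
    and \<pi> :: "'a \<Rightarrow> 'k::chilbert_space \<Rightarrow>\<^sub>L 'k"
  assumes \<rho>: "star_representation UNIV \<rho>" and \<pi>: "star_representation UNIV \<pi>"
    and cyc: "closure (range (\<lambda>a. blinfun_apply (\<rho> a) h)) = UNIV"
    and V: "V \<in> bounded_ops" "\<And>a. blinfun_apply V (blinfun_apply (\<rho> a) h) = blinfun_apply (\<pi> a) g"
    and W: "W \<in> bounded_ops" "\<And>a. blinfun_apply W (blinfun_apply (\<rho> a) h) = blinfun_apply (\<pi> a) k"
    and eq: "\<And>a. cinner g (blinfun_apply (\<pi> a) k) = s * cinner h (blinfun_apply (\<rho> a) h)"
  shows "cinner (blinfun_apply V x) (blinfun_apply W y) = s * cinner x y"
proof -
  have "adj V o\<^sub>L W = cmul s"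
    using cyc
  proof (rule blinfun_eq_on_dense)
    fix y assume "y \<in> range (\<lambda>a. blinfun_apply (\<rho> a) h)"
    then obtain b where b: "y = blinfun_apply (\<rho> b) h" ..
    show "blinfun_apply (adj V o\<^sub>L W) y = blinfun_apply (cmul s) y"
      using cyc
    proof (rule cinner_eq_on_dense)
      fix x assume "x \<in> range (\<lambda>a. blinfun_apply (\<rho> a) h)"
      then obtain a where a: "x = blinfun_apply (\<rho> a) h" ..
      show "cinner x (blinfun_apply (adj V o\<^sub>L W) y) = cinner x (blinfun_apply (cmul s) y)"
        by (simp add: a b cinner_adj' V W cinner_scaleC_right cinner_rep2[OF \<rho>] cinner_rep2[OF \<pi>] eq)
    qed
  qed
  then show ?thesis
    by (metis V(1) blinfun_apply_blinfun_compose cinner_adj' cinner_scaleC_right cmul_apply)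
qed

section \<open>Lattice algebras\<close>

lemma finite_configs: "finite \<Lambda> \<Longrightarrow> finite (configs d \<Lambda>)"
  unfolding configs_def by (intro finite_PiE) auto

lemma configs_eqI:
  assumes "s \<in> configs d \<Lambda>" "t \<in> configs d \<Lambda>" "\<And>x. x \<in> \<Lambda> \<Longrightarrow> s x = t x"
  shows "s = t"
  using assms unfolding configs_def by (rule PiE_ext)

lemma restrict_configs: "s \<in> configs d \<Lambda> \<Longrightarrow> A \<subseteq> \<Lambda> \<Longrightarrow> restrict s A \<in> configs d A"
  unfolding configs_def by auto

lemma restrict_eqD: "restrict f A = restrict g A \<Longrightarrow> x \<in> A \<Longrightarrow> f x = g x"
  by (metis restrict_apply)

lemma local_incl_in_local_ops: "local_incl d A \<Lambda> M \<in> local_ops d \<Lambda>"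
  unfolding local_incl_def local_ops_def by auto

text \<open>The right-hand side is the Kronecker product. In the sum over intermediate
  configurations only \<open>w\<close> survives: it has to agree with \<open>s\<close> off
  \<open>A\<close> and with \<open>t\<close> off \<open>B\<close>.\<close>

lemma local_mult_incl:
  assumes "finite \<Lambda>" "\<Lambda> = A \<union> B" "A \<inter> B = {}"
  shows "local_mult d \<Lambda> (local_incl d A \<Lambda> M) (local_incl d B \<Lambda> N) =
    (\<lambda>s t. if s \<in> configs d \<Lambda> \<and> t \<in> configs d \<Lambda>
      then M (restrict s A) (restrict t A) * N (restrict s B) (restrict t B) else 0)"
proof (intro ext)
  fix s t
  show "local_mult d \<Lambda> (local_incl d A \<Lambda> M) (local_incl d B \<Lambda> N) s t =
    (if s \<in> configs d \<Lambda> \<and> t \<in> configs d \<Lambda>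
      then M (restrict s A) (restrict t A) * N (restrict s B) (restrict t B) else 0)"
  proof (cases "s \<in> configs d \<Lambda> \<and> t \<in> configs d \<Lambda>")
    case False
    then show ?thesis
      by (auto simp: local_mult_def local_incl_def intro!: sum.neutral)
  next
    case True
    define w where "w = restrict (\<lambda>x. if x \<in> A then t x else s x) \<Lambda>"
    have w: "w \<in> configs d \<Lambda>"
      using True unfolding w_def configs_def by (auto simp: PiE_iff)
    have wA: "restrict w A = restrict t A" and wB: "restrict w B = restrict s B"
      using assms by (auto simp: w_def restrict_def fun_eq_iff)
    have iff: "(\<forall>x\<in>\<Lambda> - A. s x = u x) \<and> (\<forall>x\<in>\<Lambda> - B. u x = t x) \<longleftrightarrow> u = w"
      if "u \<in> configs d \<Lambda>" for u
    proof
      assume *: "(\<forall>x\<in>\<Lambda> - A. s x = u x) \<and> (\<forall>x\<in>\<Lambda> - B. u x = t x)"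
      show "u = w"
        by (rule configs_eqI[OF that w]) (use * assms in \<open>auto simp: w_def\<close>)
    qed (use assms in \<open>auto simp: w_def\<close>)
    have "local_mult d \<Lambda> (local_incl d A \<Lambda> M) (local_incl d B \<Lambda> N) s t
        = (\<Sum>u\<in>configs d \<Lambda>. if u = w then M (restrict s A) (restrict w A) * N (restrict w B) (restrict t B) else 0)"
      unfolding local_mult_def
    proof (rule sum.cong[OF refl])
      fix u assume u: "u \<in> configs d \<Lambda>"
      show "local_incl d A \<Lambda> M s u * local_incl d B \<Lambda> N u t
          = (if u = w then M (restrict s A) (restrict w A) * N (restrict w B) (restrict t B) else 0)"
        using True u iff[OF u] by (auto simp: local_incl_def)
    qed
    also have "\<dots> = M (restrict s A) (restrict t A) * N (restrict s B) (restrict t B)"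
      using finite_configs[OF assms(1)] w by (simp add: wA wB)
    finally show ?thesis
      using True by simp
  qed
qed

context quantum_spin_system
begin

lemma embed_mult_incl:
  assumes "finite \<Lambda>" "\<Lambda> = A \<union> B" "A \<inter> B = {}" "M \<in> local_ops d A" "N \<in> local_ops d B"
  shows "\<iota> A M * \<iota> B N = \<iota> \<Lambda> (\<lambda>s t. if s \<in> configs d \<Lambda> \<and> t \<in> configs d \<Lambda>
      then M (restrict s A) (restrict t A) * N (restrict s B) (restrict t B) else 0)"
proof -
  have "\<iota> A M = \<iota> \<Lambda> (local_incl d A \<Lambda> M)" "\<iota> B N = \<iota> \<Lambda> (local_incl d B \<Lambda> N)"
    using assms by (auto simp: embed_incl)
  then show ?thesis
    by (simp add: embed_mult[OF assms(1) local_incl_in_local_ops local_incl_in_local_ops, symmetric]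
        local_mult_incl[OF assms(1-3)])
qed

lemma local_part_subset_algebra_of: "local_part d \<iota> \<Lambda> \<subseteq> algebra_of d \<iota> \<Lambda>"
  unfolding algebra_of_def by (rule closure_subset)

lemma algebra_of_mono: "\<Lambda> \<subseteq> \<Lambda>' \<Longrightarrow> algebra_of d \<iota> \<Lambda> \<subseteq> algebra_of d \<iota> \<Lambda>'"
  unfolding algebra_of_def local_part_def by (intro closure_mono) blast

lemma one_in_algebra_of: "1 \<in> algebra_of d \<iota> \<Lambda>"
proof -
  have "\<iota> {} (local_one d {}) \<in> local_part d \<iota> \<Lambda>"
    unfolding local_part_def by (auto simp: local_ops_def local_one_def intro!: exI[of _ "{}"] image_eqI)
  then show ?thesis
    using local_part_subset_algebra_of embed_one[of "{}"] by auto
qed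

lemma star_in_algebra_of:
  assumes "a \<in> algebra_of d \<iota> \<Lambda>"
  shows "star a \<in> algebra_of d \<iota> \<Lambda>"
proof -
  have "star ` closure (local_part d \<iota> \<Lambda>) \<subseteq> closure (star ` local_part d \<iota> \<Lambda>)"
    by (rule closure_bounded_linear_image_subset[OF bounded_linear_star])
  also have "star ` local_part d \<iota> \<Lambda> \<subseteq> local_part d \<iota> \<Lambda>"
  proof (rule image_subsetI)
    fix a assume "a \<in> local_part d \<iota> \<Lambda>"
    then obtain F M where F: "finite F" "F \<subseteq> \<Lambda>" "M \<in> local_ops d F" "a = \<iota> F M"
      unfolding local_part_def by blast
    then have "star a = \<iota> F (local_star M)" "local_star M \<in> local_ops d F"
      by (simp_all add: embed_star) (auto simp: local_ops_def local_star_def)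
    with F show "star a \<in> local_part d \<iota> \<Lambda>"
      unfolding local_part_def by blast
  qed
  then have "closure (star ` local_part d \<iota> \<Lambda>) \<subseteq> closure (local_part d \<iota> \<Lambda>)"
    by (rule closure_mono)
  finally show ?thesis
    using assms unfolding algebra_of_def by blast
qed

text \<open>For local elements both products are the same Kronecker product over the union of the
  supports, as scalars commute. Continuity then extends this to the closures, one variable at a
  time.\<close>

lemma algebra_of_commute:
  assumes "\<Lambda> \<inter> \<Lambda>' = {}" "a \<in> algebra_of d \<iota> \<Lambda>" "b \<in> algebra_of d \<iota> \<Lambda>'"
  shows "a * b = b * a"
proof -
  have loc: "a * b = b * a" if a: "a \<in> local_part d \<iota> \<Lambda>" and b: "b \<in> local_part d \<iota> \<Lambda>'" for a b
  proof -
    obtain F M where F: "finite F" "F \<subseteq> \<Lambda>" "M \<in> local_ops d F" "a = \<iota> F M"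
      using a unfolding local_part_def by blast
    obtain G N where G: "finite G" "G \<subseteq> \<Lambda>'" "N \<in> local_ops d G" "b = \<iota> G N"
      using b unfolding local_part_def by blast
    have FG: "finite (F \<union> G)" "F \<union> G = G \<union> F" "F \<inter> G = {}" "G \<inter> F = {}"
      using F G assms(1) by auto
    show ?thesis
      unfolding F(4) G(4) embed_mult_incl[OF FG(1) refl FG(3) F(3) G(3)]
        embed_mult_incl[OF FG(1,2,4) G(3) F(3)]
      by (simp only: mult.commute)
  qed
  have 1: "a * b = b * a" if b: "b \<in> local_part d \<iota> \<Lambda>'" and a: "a \<in> algebra_of d \<iota> \<Lambda>" for a b
  proof -
    have "closed {a. a * b = b * a}"
      by (intro closed_Collect_eq continuous_intros)
    then have "closure (local_part d \<iota> \<Lambda>) \<subseteq> {a. a * b = b * a}"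
      using loc b by (intro closure_minimal) auto
    then show ?thesis
      using a unfolding algebra_of_def by blast
  qed
  have "closed {b. a * b = b * a}"
    by (intro closed_Collect_eq continuous_intros)
  then have "closure (local_part d \<iota> \<Lambda>') \<subseteq> {b. a * b = b * a}"
    using 1 assms(2) by (intro closure_minimal) auto
  then show ?thesis
    using assms(3) unfolding algebra_of_def by blast
qed

text \<open>Every matrix unit of \<open>\<Lambda>\<^sub>1 \<union> \<Lambda>\<^sub>2\<close> is a product of matrix units of \<open>\<Lambda>\<^sub>1\<close> and \<open>\<Lambda>\<^sub>2\<close>.\<close>

lemma algebra_of_Un_subset:
  assumes "\<Lambda>\<^sub>1 \<inter> \<Lambda>\<^sub>2 = {}" and S: "csubspace S" "closed S"
    and prod: "\<And>a b. a \<in> algebra_of d \<iota> \<Lambda>\<^sub>1 \<Longrightarrow> b \<in> algebra_of d \<iota> \<Lambda>\<^sub>2 \<Longrightarrow> a * b \<in> S"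
  shows "algebra_of d \<iota> (\<Lambda>\<^sub>1 \<union> \<Lambda>\<^sub>2) \<subseteq> S"
proof -
  have "local_part d \<iota> (\<Lambda>\<^sub>1 \<union> \<Lambda>\<^sub>2) \<subseteq> S"
  proof
    fix a assume "a \<in> local_part d \<iota> (\<Lambda>\<^sub>1 \<union> \<Lambda>\<^sub>2)"
    then obtain F M where F: "finite F" "F \<subseteq> \<Lambda>\<^sub>1 \<union> \<Lambda>\<^sub>2" "M \<in> local_ops d F" "a = \<iota> F M"
      unfolding local_part_def by blast
    define A where "A = F \<inter> \<Lambda>\<^sub>1"
    define B where "B = F \<inter> \<Lambda>\<^sub>2"
    have AB: "F = A \<union> B" "A \<inter> B = {}" "A \<subseteq> \<Lambda>\<^sub>1" "B \<subseteq> \<Lambda>\<^sub>2" "finite A" "finite B"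
      using F assms(1) by (auto simp: A_def B_def)
    define e where "e p q = (\<lambda>s t. if s = p \<and> t = q then 1 else (0::complex))" for p q :: config
    have e: "e p q \<in> local_ops d G" if "p \<in> configs d G" "q \<in> configs d G" for p q G
      using that by (auto simp: e_def local_ops_def)
    have e_S: "\<iota> F (e p q) \<in> S" if p: "p \<in> configs d F" and q: "q \<in> configs d F" for p q
    proof -
      have pA: "restrict p A \<in> configs d A" "restrict q A \<in> configs d A"
        and pB: "restrict p B \<in> configs d B" "restrict q B \<in> configs d B"
        using p q AB by (auto intro: restrict_configs)
      have *: "s = p" if "s \<in> configs d F" "p \<in> configs d F" "restrict s A = restrict p A" "restrict s B = restrict p B" for s p
        using AB that by (intro configs_eqI[OF that(1,2)]) (auto dest: restrict_eqD)
      have "(\<lambda>s t. if s \<in> configs d F \<and> t \<in> configs d F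
          then e (restrict p A) (restrict q A) (restrict s A) (restrict t A) *
            e (restrict p B) (restrict q B) (restrict s B) (restrict t B) else 0) = e p q"
      proof (intro ext)
        fix s t
        show "(if s \<in> configs d F \<and> t \<in> configs d F
          then e (restrict p A) (restrict q A) (restrict s A) (restrict t A) *
            e (restrict p B) (restrict q B) (restrict s B) (restrict t B) else 0) = e p q s t"
          using p q *[OF _ p, of s] *[OF _ q, of t] by (cases "s = p"; cases "t = q") (auto simp: e_def)
      qed
      then have "\<iota> F (e p q) = \<iota> A (e (restrict p A) (restrict q A)) * \<iota> B (e (restrict p B) (restrict q B))"
        using embed_mult_incl[OF F(1) AB(1,2) e[OF pA] e[OF pB]] by simp
      also have "\<dots> \<in> S"
        using AB e[OF pA] e[OF pB] local_part_subset_algebra_of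
        by (intro prod) (unfold local_part_def, blast+)
      finally show ?thesis .
    qed
    \<comment> \<open>\<open>M\<close> with the entries outside \<open>K\<close> erased, so that
      induction on \<open>K\<close> adds one matrix unit at a time.\<close>
    define m where "m K = (\<lambda>s t. if (s, t) \<in> K then M s t else 0)" for K
    have m_ops: "m K \<in> local_ops d F" for K
      using F(3) by (auto simp: m_def local_ops_def)
    have "\<iota> F (m K) \<in> S" if "finite K" "K \<subseteq> configs d F \<times> configs d F" for K
      using that
    proof (induction K rule: finite_induct)
      case empty
      have "\<iota> F (m {}) = 0 *\<^sub>C \<iota> F M"
        using embed_scaleC[OF F(1,3), of 0] by (simp add: m_def)
      then show ?case
        using csubspaceD(1)[OF S(1)] by simp
    next
      case (insert x K)
      obtain p q where x: "x = (p, q)"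
        by force
      have pq: "p \<in> configs d F" "q \<in> configs d F"
        using insert.prems x by auto
      have ce: "(\<lambda>s t. M p q * e p q s t) \<in> local_ops d F"
        using e[OF pq] by (auto simp: local_ops_def)
      have "m (insert x K) = (\<lambda>s t. m K s t + M p q * e p q s t)"
        using insert.hyps(2) unfolding x m_def e_def by (intro ext) auto
      then have "\<iota> F (m (insert x K)) = \<iota> F (m K) + M p q *\<^sub>C \<iota> F (e p q)"
        by (simp add: embed_add[OF F(1) m_ops ce] embed_scaleC[OF F(1) e[OF pq]])
      then show ?case
        using insert by (auto intro!: csubspaceD[OF S(1)] e_S pq)
    qed
    from this[OF finite_cartesian_product subset_refl, OF finite_configs finite_configs, OF F(1) F(1)]
    have "\<iota> F (m (configs d F \<times> configs d F)) \<in> S" .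
    moreover have "m (configs d F \<times> configs d F) = M"
      using F(3) by (intro ext) (auto simp: m_def local_ops_def)
    ultimately show "a \<in> S"
      by (simp add: F(4))
  qed
  then show ?thesis
    unfolding algebra_of_def by (intro closure_minimal S)
qed

end

section \<open>Isomorphisms of von Neumann algebras\<close>

lemma norm_adj_le: "norm (adj T) \<le> norm T"
proof (rule norm_blinfun_bound)
  fix y
  have "(norm (blinfun_apply (adj T) y))\<^sup>2 = inner y (blinfun_apply T (blinfun_apply (adj T) y))"
    by (simp add: power2_norm_eq_inner inner_adj)
  also have "\<dots> \<le> norm y * (norm T * norm (blinfun_apply (adj T) y))"
    using norm_cauchy_schwarz[of y] norm_blinfun[of T "blinfun_apply (adj T) y"]
    by (meson dual_order.trans mult_left_mono norm_ge_zero)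
  finally have "norm (blinfun_apply (adj T) y) * norm (blinfun_apply (adj T) y)
      \<le> (norm T * norm y) * norm (blinfun_apply (adj T) y)"
    by (simp add: power2_eq_square mult_ac)
  then show "norm (blinfun_apply (adj T) y) \<le> norm T * norm y"
    by (cases "norm (blinfun_apply (adj T) y) = 0") (auto simp: mult_le_cancel_right)
qed simp

context
  fixes X :: "('h::chilbert_space \<Rightarrow>\<^sub>L 'h) set" and Y :: "('k::chilbert_space \<Rightarrow>\<^sub>L 'k) set"
    and M N \<tau>
  assumes iso: "star_isomorphism M N \<tau>"
    and X: "selfadjoint_set X" "M = commutant X"
    and Y: "selfadjoint_set Y" "N = commutant Y"
begin

lemma star_isomorphism_mem: "S \<in> M \<Longrightarrow> \<tau> S \<in> N"
  and star_isomorphism_add: "S \<in> M \<Longrightarrow> T \<in> M \<Longrightarrow> \<tau> (S + T) = \<tau> S + \<tau> T"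
  and star_isomorphism_compose: "S \<in> M \<Longrightarrow> T \<in> M \<Longrightarrow> \<tau> (S o\<^sub>L T) = \<tau> S o\<^sub>L \<tau> T"
  and star_isomorphism_inj: "S \<in> M \<Longrightarrow> T \<in> M \<Longrightarrow> \<tau> S = \<tau> T \<Longrightarrow> S = T"
  and star_isomorphism_surj: "U \<in> N \<Longrightarrow> \<exists>S\<in>M. \<tau> S = U"
  using iso unfolding star_isomorphism_def bij_betw_def inj_on_def by blast+

lemma star_isomorphism_cmul_compose:
  assumes "S \<in> M"
  shows "\<tau> (cmul c o\<^sub>L S) = cmul c o\<^sub>L \<tau> S"
proof (rule blinfun_eqI)
  fix y
  have "cmul c o\<^sub>L S \<in> M"
    using assms unfolding X(2)
    by (intro commutant_compose cmul_in_commutant selfadjoint_setD(1)[OF X(1)])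
  then show "blinfun_apply (\<tau> (cmul c o\<^sub>L S)) y = blinfun_apply (cmul c o\<^sub>L \<tau> S) y"
    using iso assms unfolding star_isomorphism_def by simp
qed

lemma star_isomorphism_adj:
  assumes "S \<in> M"
  shows "\<tau> (adj S) = adj (\<tau> S)"
proof -
  have "adj S \<in> M"
    using selfadjoint_setD(3)[OF selfadjoint_set_commutant[OF X(1)]] assms X(2) by simp
  moreover have "is_adjoint (adj S) S"
    using assms commutantD(1)[of S X] X(2) by (subst is_adjoint_iff) auto
  ultimately have "is_adjoint (\<tau> (adj S)) (\<tau> S)"
    using iso assms unfolding star_isomorphism_def by blast
  moreover have "\<tau> S \<in> bounded_ops"
    using star_isomorphism_mem[OF assms] Y(2) commutantD(1) by blast
  ultimately show ?thesis
    by (simp add: is_adjoint_iff)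
qed

lemma star_isomorphism_zero: "\<tau> 0 = 0"
  using star_isomorphism_add[of 0 0] X(2) by (simp add: zero_in_commutant)

text \<open>Preservation of the unit comes from surjectivity: for the preimage \<open>u\<close> of
  the identity, apply \<open>\<tau>\<close> to 1 u = u.\<close>

lemma star_isomorphism_id: "\<tau> id_blinfun = id_blinfun"
proof -
  obtain u where u: "u \<in> M" "\<tau> u = id_blinfun"
    using star_isomorphism_surj[of id_blinfun] Y(2) id_in_commutant by blast
  have "\<tau> (id_blinfun o\<^sub>L u) = \<tau> id_blinfun o\<^sub>L \<tau> u"
    using u X(2) id_in_commutant by (intro star_isomorphism_compose) auto
  moreover have "id_blinfun o\<^sub>L u = u" "\<tau> id_blinfun o\<^sub>L id_blinfun = \<tau> id_blinfun"
    by (auto intro: blinfun_eqI)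
  ultimately show ?thesis
    using u by simp
qed

lemma star_isomorphism_cmul: "\<tau> (cmul c) = cmul c"
proof -
  have 1: "cmul c o\<^sub>L id_blinfun = (cmul c :: 'h \<Rightarrow>\<^sub>L 'h)" 
    and 2: "cmul c o\<^sub>L id_blinfun = (cmul c :: 'k \<Rightarrow>\<^sub>L 'k)"
    by (auto intro: blinfun_eqI)
  show ?thesis
    using star_isomorphism_cmul_compose[of id_blinfun c] X(2) id_in_commutant[of X]
    by (simp add: 1 2 star_isomorphism_id)
qed

lemma star_isomorphism_inverse: "star_isomorphism N M (inv_into M \<tau>)"
proof -
  let ?\<rho> = "inv_into M \<tau>"
  have bij: "bij_betw \<tau> M N"
    using iso unfolding star_isomorphism_def by blast
  have mem: "?\<rho> S \<in> M" and r: "\<tau> (?\<rho> S) = S" if "S \<in> N" for S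
    using bij that unfolding bij_betw_def by (auto intro: inv_into_into f_inv_into_f)
  have l: "?\<rho> U = S" if "S \<in> M" "\<tau> S = U" for S U
    using bij that unfolding bij_betw_def by (auto intro: inv_into_f_f)
  show ?thesis
    unfolding star_isomorphism_def
  proof (intro conjI ballI allI impI)
    show "bij_betw ?\<rho> N M"
      using bij by (rule bij_betw_inv_into)
    fix S T assume ST: "S \<in> N" "T \<in> N"
    note m = mem[OF ST(1)] mem[OF ST(2)]
    have mm: "?\<rho> S + ?\<rho> T \<in> M" "?\<rho> S o\<^sub>L ?\<rho> T \<in> M"
      using m X(2) commutant_add commutant_compose by auto
    show "?\<rho> (S + T) = ?\<rho> S + ?\<rho> T"
      by (intro l mm) (simp add: star_isomorphism_add m r ST)
    show "?\<rho> (S o\<^sub>L T) = ?\<rho> S o\<^sub>L ?\<rho> T"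
      by (intro l mm) (simp add: star_isomorphism_compose m r ST)
    show "is_adjoint (?\<rho> S) (?\<rho> T)" if "is_adjoint S T"
    proof -
      have "?\<rho> S = adj (?\<rho> T)"
      proof (rule l)
        show "adj (?\<rho> T) \<in> M"
          using selfadjoint_setD(3)[OF selfadjoint_set_commutant[OF X(1)]] m X(2) by simp
        have "T \<in> bounded_ops"
          using ST Y(2) commutantD(1) by blast
        then show "\<tau> (adj (?\<rho> T)) = S"
          using that by (simp add: star_isomorphism_adj m r ST is_adjoint_iff)
      qed
      moreover have "?\<rho> T \<in> bounded_ops"
        using m X(2) commutantD(1) by blast
      ultimately show ?thesis
        by (simp add: is_adjoint_iff)
    qed
    fix c y assume c: "\<forall>x. blinfun_apply T x = c *\<^sub>C blinfun_apply S x"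
    have "?\<rho> T = cmul c o\<^sub>L ?\<rho> S"
    proof (rule l)
      show "cmul c o\<^sub>L ?\<rho> S \<in> M"
        using m unfolding X(2)
        by (intro commutant_compose cmul_in_commutant selfadjoint_setD(1)[OF X(1)])
      show "\<tau> (cmul c o\<^sub>L ?\<rho> S) = T"
        by (rule blinfun_eqI) (simp add: star_isomorphism_cmul_compose m r ST c)
    qed
    then show "blinfun_apply (?\<rho> T) y = c *\<^sub>C blinfun_apply (?\<rho> S) y"
      by simp
  qed
qed

text \<open>Being a factor is purely algebraic. This is how the algebras of \<open>\<pi>\<close>
  inherit the property from those of \<open>\<pi>\<^sub>0\<close>.\<close>

lemma star_isomorphism_center:
  assumes center: "\<And>Z. Z \<in> M \<Longrightarrow> Z \<in> commutant M \<Longrightarrow> \<exists>c. Z = cmul c"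
    and Z: "Z \<in> N" "Z \<in> commutant N"
  shows "\<exists>c. Z = cmul c"
proof -
  obtain S where S: "S \<in> M" "\<tau> S = Z"
    using star_isomorphism_surj[OF Z(1)] by blast
  have "S \<in> commutant M"
    unfolding commutant_def
  proof (intro CollectI conjI ballI)
    show "S \<in> bounded_ops"
      using S(1) X(2) commutantD(1) by blast
    fix T assume T: "T \<in> M"
    have "S o\<^sub>L T \<in> M" "T o\<^sub>L S \<in> M"
      using S(1) T X(2) commutant_compose by auto
    moreover have "\<tau> (S o\<^sub>L T) = \<tau> (T o\<^sub>L S)"
      using commutantD(2)[OF Z(2) star_isomorphism_mem[OF T]]
      by (simp add: star_isomorphism_compose S T)
    ultimately show "S o\<^sub>L T = T o\<^sub>L S"
      using star_isomorphism_inj by blast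
  qed
  then obtain c where "S = cmul c"
    using center[OF S(1)] by blast
  then show ?thesis
    using S(2) star_isomorphism_cmul by metis
qed

end

lemma quasi_equivalent_sym:
  assumes "quasi_equivalent A \<pi>\<^sub>1 \<pi>\<^sub>2" "selfadjoint_set (\<pi>\<^sub>1 ` A)" "selfadjoint_set (\<pi>\<^sub>2 ` A)"
  shows "quasi_equivalent A \<pi>\<^sub>2 \<pi>\<^sub>1"
proof -
  obtain \<tau> where \<tau>: "star_isomorphism (commutant (commutant (\<pi>\<^sub>1 ` A))) (commutant (commutant (\<pi>\<^sub>2 ` A))) \<tau>"
    "\<And>a. a \<in> A \<Longrightarrow> \<tau> (\<pi>\<^sub>1 a) = \<pi>\<^sub>2 a"
    using assms(1) unfolding quasi_equivalent_def by blast
  let ?\<rho> = "inv_into (commutant (commutant (\<pi>\<^sub>1 ` A))) \<tau>"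
  have "?\<rho> (\<pi>\<^sub>2 a) = \<pi>\<^sub>1 a" if "a \<in> A" for a
  proof -
    have "\<pi>\<^sub>1 a \<in> commutant (commutant (\<pi>\<^sub>1 ` A))"
      using bicommutant_superset[OF selfadjoint_setD(1)[OF assms(2)]] that by blast
    then show ?thesis
      using \<tau> that unfolding star_isomorphism_def bij_betw_def by (metis inv_into_f_f)
  qed
  moreover have "star_isomorphism (commutant (commutant (\<pi>\<^sub>2 ` A))) (commutant (commutant (\<pi>\<^sub>1 ` A))) ?\<rho>"
    using \<tau>(1) by (rule star_isomorphism_inverse) (use assms selfadjoint_set_commutant in auto)
  ultimately show ?thesis
    unfolding quasi_equivalent_def by blast
qed

section \<open>Pure states\<close>

text \<open>For \<open>T\<close> in the commutant with \<open>0 < T < 1\<close>, the functional \<open>a \<mapsto> \<langle>\<Omega>, T \<pi>(a) \<Omega>\<rangle>\<close> is dominated by the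
  state, so by purity it is proportional to it.\<close>

lemma pure_state_trivial_commutant:
  fixes \<pi> :: "'a::cstar_algebra \<Rightarrow> 'h::chilbert_space \<Rightarrow>\<^sub>L 'h"
  assumes pure: "pure_state \<omega>" and gns: "GNS_representation \<omega> \<pi> \<Omega>"
  shows "trivial_commutant (range \<pi>)"
proof -
  have rep: "star_representation UNIV \<pi>"
    and om: "\<And>a. \<omega> a = cinner \<Omega> (blinfun_apply (\<pi> a) \<Omega>)"
    and cyc: "closure (range (\<lambda>a. blinfun_apply (\<pi> a) \<Omega>)) = UNIV"
    using gns unfolding GNS_representation_def by auto
  have st: "state \<omega>"
    using pure unfolding pure_state_def by blast
  have sa: "selfadjoint_set (range \<pi>)"
    by (rule selfadjoint_set_image[OF rep]) auto
  have norm_Om: "cinner \<Omega> \<Omega> = 1"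
    using om[of 1] st rep_one[OF rep] unfolding state_def by simp
  then have norm_Om': "norm \<Omega> = 1"
    using cinner_self[of \<Omega>] by (metis norm_ge_zero norm_of_real norm_one abs_of_nonneg
        power2_eq_iff_nonneg one_power2 zero_le_power2 zero_le_one)
  show ?thesis
  proof (rule trivial_commutant_selfadjointI[OF sa])
    fix T assume T: "T \<in> commutant (range \<pi>)" "adj T = T"
    \<comment> \<open>Chosen so that \<open>r * norm T\<close> is at most 1/4: then
      \<open>T'\<close> lies between 1/4 and 3/4, both \<open>T'\<close> and 1 - \<open>T'\<close>
      are positive, and the weight \<open>t\<close> stays strictly between 0 and 1.\<close>
    define r where "r = 1 / (4 * (norm T + 1))"
    have r0: "0 < r" and r: "r * norm T \<le> 1/4"
      by (simp_all add: r_def add_nonneg_pos field_simps add_pos_nonneg)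
    define T' where "T' = (1/2) *\<^sub>R id_blinfun + r *\<^sub>R T"
    have T': "T' \<in> commutant (range \<pi>)"
      unfolding T'_def by (intro commutant_add commutant_scaleR id_in_commutant T)
    have aT': "adj T' = T'"
      by (simp add: T'_def adj_add adj_scaleR adj_id bounded_ops_scaleR id_in_bounded_ops
          commutantD(1)[OF T(1)] T(2))
    note bT' = commutantD(1)[OF T']
    have im: "Im (cinner x (blinfun_apply T' x)) = 0" for x
    proof -
      have "cinner x (blinfun_apply T' x) = cnj (cinner x (blinfun_apply T' x))"
        using cinner_adj[OF bT', of x x] aT' cinner_commute by metis
      then show ?thesis
        by (metis Reals_cnj_iff complex_is_Real_iff)
    qed
    have bd: "Re (cinner x (blinfun_apply T' x)) \<in> {(1/4) * (norm x)\<^sup>2 .. (3/4) * (norm x)\<^sup>2}" for x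
    proof -
      have "\<bar>inner x (blinfun_apply T x)\<bar> \<le> norm x * (norm T * norm x)"
        using Cauchy_Schwarz_ineq2[of x "blinfun_apply T x"] norm_blinfun[of T x]
        by (meson dual_order.trans mult_left_mono norm_ge_zero)
      then have "r * \<bar>inner x (blinfun_apply T x)\<bar> \<le> (r * norm T) * (norm x)\<^sup>2"
        using r0 by (simp add: power2_eq_square mult_ac)
      also have "\<dots> \<le> (1/4) * (norm x)\<^sup>2"
        by (intro mult_right_mono r) auto
      finally have "\<bar>r * inner x (blinfun_apply T x)\<bar> \<le> (1/4) * (norm x)\<^sup>2"
        using r0 by (simp add: abs_mult)
      moreover have "Re (cinner x (blinfun_apply T' x)) = (1/2) * (norm x)\<^sup>2 + r * inner x (blinfun_apply T x)"
        by (simp add: inner_eq_Re_cinner[symmetric] T'_def blinfun.add_left blinfun.scaleR_left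
            inner_simps power2_norm_eq_inner)
      ultimately show ?thesis
        by auto
    qed
    define \<phi> where "\<phi> a = cinner \<Omega> (blinfun_apply T' (blinfun_apply (\<pi> a) \<Omega>))" for a
    define t where "t = Re (cinner \<Omega> (blinfun_apply T' \<Omega>))"
    have t: "1/4 \<le> t" "t \<le> 3/4"
      using bd[of \<Omega>] norm_Om' by (simp_all add: t_def)
    have t_eq: "cinner \<Omega> (blinfun_apply T' \<Omega>) = complex_of_real t"
      by (rule complex_eqI) (simp_all add: t_def im)
    have phi_add: "\<phi> (a + b) = \<phi> a + \<phi> b" for a b
      by (simp add: \<phi>_def rep_add[OF rep] blinfun.add_left blinfun.add_right cinner_add_right)
    have phi_scale: "\<phi> (c *\<^sub>C a) = c * \<phi> a" for c a
      by (simp add: \<phi>_def rep_scaleC[OF rep] bounded_opsD[OF bT'] cinner_scaleC_right)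
    have phi_sq: "\<phi> (star a * a) = cinner (blinfun_apply (\<pi> a) \<Omega>) (blinfun_apply T' (blinfun_apply (\<pi> a) \<Omega>))" for a
      by (simp add: \<phi>_def rep_mult[OF rep] cinner_rep[OF rep] commutantD(3)[OF T'])
    have om_sq: "\<omega> (star a * a) = complex_of_real ((norm (blinfun_apply (\<pi> a) \<Omega>))\<^sup>2)" for a
      unfolding om cinner_rep2[OF rep, symmetric] by (rule cinner_self)
    have phi_one: "\<phi> 1 = complex_of_real t"
      by (simp add: \<phi>_def rep_one[OF rep] t_eq)
    define \<omega>\<^sub>1 where "\<omega>\<^sub>1 a = \<phi> a / complex_of_real t" for a
    \<comment> \<open>The complementary part, induced by 1 - \<open>T'\<close>, so that the state is
      the mixture of the two with weights t and 1 - t.\<close>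
    define \<omega>\<^sub>2 where "\<omega>\<^sub>2 a = (\<omega> a - \<phi> a) / complex_of_real (1 - t)" for a
    have "state \<omega>\<^sub>1"
      unfolding state_def
    proof (intro conjI allI)
      show "\<omega>\<^sub>1 1 = 1"
        using t by (simp add: \<omega>\<^sub>1_def phi_one)
      show "Im (\<omega>\<^sub>1 (star a * a)) = 0" for a
        unfolding \<omega>\<^sub>1_def Im_divide_of_real phi_sq by (simp add: im)
      have "0 \<le> Re (\<phi> (star a * a))" for a
        unfolding phi_sq using bd[of "blinfun_apply (\<pi> a) \<Omega>"]
        by (meson atLeastAtMost_iff order_trans mult_nonneg_nonneg zero_le_power2 zero_le_divide_1_iff zero_le_numeral)
      then show "0 \<le> Re (\<omega>\<^sub>1 (star a * a))" for a
        unfolding \<omega>\<^sub>1_def Re_divide_of_real using t by simp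
    qed (simp_all add: \<omega>\<^sub>1_def phi_add phi_scale add_divide_distrib)
    moreover have "state \<omega>\<^sub>2"
      unfolding state_def
    proof (intro conjI allI)
      show "\<omega>\<^sub>2 1 = 1"
        using t st by (simp add: \<omega>\<^sub>2_def phi_one state_def)
      show "Im (\<omega>\<^sub>2 (star a * a)) = 0" for a
        unfolding \<omega>\<^sub>2_def Im_divide_of_real phi_sq om_sq by (simp add: im)
      have "0 \<le> Re (\<omega> (star a * a) - \<phi> (star a * a))" for a
        unfolding phi_sq om_sq using bd[of "blinfun_apply (\<pi> a) \<Omega>"]
          zero_le_power2[of "norm (blinfun_apply (\<pi> a) \<Omega>)"] by simp
      then show "0 \<le> Re (\<omega>\<^sub>2 (star a * a))" for a
        unfolding \<omega>\<^sub>2_def Re_divide_of_real using t by simp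
      show "\<omega>\<^sub>2 (a + b) = \<omega>\<^sub>2 a + \<omega>\<^sub>2 b" for a b
        using st unfolding state_def \<omega>\<^sub>2_def add_divide_distrib[symmetric] by (simp add: phi_add)
      show "\<omega>\<^sub>2 (c *\<^sub>C a) = c * \<omega>\<^sub>2 a" for c a
        using st unfolding state_def \<omega>\<^sub>2_def by (simp add: phi_scale right_diff_distrib)
    qed
    moreover have "\<omega> a = complex_of_real t * \<omega>\<^sub>1 a + complex_of_real (1 - t) * \<omega>\<^sub>2 a" for a
    proof -
      have "complex_of_real t \<noteq> 0" "complex_of_real (1 - t) \<noteq> 0"
        using t by (simp_all only: of_real_eq_0_iff)
      then show ?thesis
        by (simp add: \<omega>\<^sub>1_def \<omega>\<^sub>2_def del: of_real_diff)
    qed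
    moreover have "0 < t" "t < 1"
      using t by simp_all
    ultimately have "\<omega>\<^sub>1 = \<omega>"
      using pure unfolding pure_state_def by blast
    then have "\<phi> a / complex_of_real t = \<omega> a" for a
      unfolding \<omega>\<^sub>1_def by (rule fun_cong)
    then have phi: "\<phi> a = complex_of_real t * \<omega> a" for a
      using t by (simp add: field_simps)
    \<comment> \<open>Proportionality of the functionals says that \<open>T'\<close> acts on the
      cyclic vector as t; since \<open>T'\<close> commutes with \<open>\<pi>\<close>, it is t
      everywhere.\<close>
    have T'Om: "blinfun_apply T' \<Omega> = t *\<^sub>R \<Omega>"
      using cyc
    proof (rule cinner_eq_on_dense)
      fix z assume "z \<in> range (\<lambda>a. blinfun_apply (\<pi> a) \<Omega>)"
      then obtain a where a: "z = blinfun_apply (\<pi> a) \<Omega>" ..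
      have "cinner (blinfun_apply (\<pi> a) \<Omega>) (blinfun_apply T' \<Omega>) = \<phi> (star a)"
        by (simp add: \<phi>_def cinner_rep[OF rep] commutantD(3)[OF T'])
      then show "cinner z (blinfun_apply T' \<Omega>) = cinner z (t *\<^sub>R \<Omega>)"
        by (simp add: a phi om cinner_scaleR_right cinner_rep[OF rep])
    qed
    have "T' = t *\<^sub>R id_blinfun"
      using cyc
    proof (rule blinfun_eq_on_dense)
      fix z assume "z \<in> range (\<lambda>a. blinfun_apply (\<pi> a) \<Omega>)"
      then obtain a where a: "z = blinfun_apply (\<pi> a) \<Omega>" ..
      show "blinfun_apply T' z = blinfun_apply (t *\<^sub>R id_blinfun) z"
        by (simp add: a commutantD(3)[OF T'] T'Om blinfun.scaleR_left blinfun.scaleR_right)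
    qed
    then have T_eq: "r *\<^sub>R T = (t - 1/2) *\<^sub>R id_blinfun"
      unfolding T'_def by (simp add: scaleR_diff_left algebra_simps)
    have "T = (1 / r) *\<^sub>R (r *\<^sub>R T)"
      using r0 by simp
    then have "T = ((t - 1/2) / r) *\<^sub>R id_blinfun"
      unfolding T_eq by simp
    then have "T = cmul (complex_of_real ((t - 1/2) / r))"
      by (intro blinfun_eqI) (simp only: cmul_apply scaleC_of_real blinfun.scaleR_left blinfun_apply_id_blinfun id_apply)
    then show "\<exists>c. T = cmul c" ..
  qed
qed

section \<open>Tensor products\<close>

text \<open>The slicing and projection results are proved for the first factor and read for the
  second through this symmetry.\<close>

lemma hilbert_tensor_swap:
  assumes "hilbert_tensor tens"
  shows "hilbert_tensor (\<lambda>y x. tens x y)"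
proof -
  have "{tens y x |x y. True} = {tens x y |x y. True}"
    by blast
  then show ?thesis
    using assms unfolding hilbert_tensor_def by (simp add: mult.commute)
qed

context
  fixes tens :: "'h1::chilbert_space \<Rightarrow> 'h2::chilbert_space \<Rightarrow> 't::chilbert_space"
  assumes tens: "hilbert_tensor tens"
begin

lemma cinner_tens: "cinner (tens x y) (tens x' y') = cinner x x' * cinner y y'"
  and tens_scaleC_left: "tens (c *\<^sub>C x) y = c *\<^sub>C tens x y"
  and tens_scaleC_right: "tens x (c *\<^sub>C y) = c *\<^sub>C tens x y"
  using tens unfolding hilbert_tensor_def by auto

lemma norm_tens: "norm (tens x y) = norm x * norm y"
proof -
  have "complex_of_real ((norm (tens x y))\<^sup>2) = complex_of_real ((norm x * norm y)\<^sup>2)"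
    using cinner_tens[of x y x y] by (simp add: cinner_self power_mult_distrib)
  then have "(norm (tens x y))\<^sup>2 = (norm x * norm y)\<^sup>2"
    by (rule of_real_eq_iff[THEN iffD1])
  then show ?thesis
    by simp
qed

lemma tens_blinfun_eqI:
  fixes S T :: "'t \<Rightarrow>\<^sub>L 'b::real_normed_vector"
  assumes "\<And>x y. blinfun_apply S (tens x y) = blinfun_apply T (tens x y)"
  shows "S = T"
proof (rule blinfun_eq_on_dense)
  show "closure (span {tens x y |x y. True}) = UNIV"
    using tens unfolding hilbert_tensor_def by blast
  have "span {tens x y |x y. True} \<subseteq> {u. blinfun_apply S u = blinfun_apply T u}"
    using assms by (intro span_minimal) (auto simp: subspace_def blinfun.add_right blinfun.scaleR_right)
  then show "blinfun_apply S u = blinfun_apply T u" if "u \<in> span {tens x y |x y. True}" for u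
    using that by blast
qed

lemma tens_cinner_eqI:
  assumes "\<And>x y. cinner (tens x y) u = cinner (tens x y) v"
  shows "u = v"
proof (rule cinner_eq_on_dense)
  show "closure (span {tens x y |x y. True}) = UNIV"
    using tens unfolding hilbert_tensor_def by blast
  have "span {tens x y |x y. True} \<subseteq> {z. cinner z u = cinner z v}"
    using assms by (intro span_minimal) (auto simp: subspace_def cinner_add_left cinner_scaleR_left)
  then show "cinner z u = cinner z v" if "z \<in> span {tens x y |x y. True}" for z
    using that by blast
qed

lemma tens_left_operator:
  "\<exists>W\<in>bounded_ops. \<forall>x. blinfun_apply W x = tens x y"
proof -
  have "bounded_linear (\<lambda>x. tens x y)"
    using tens tens_scaleC_left[of "complex_of_real _"] unfolding hilbert_tensor_def
    by (intro bounded_linear_intro[where K = "norm y"]) (auto simp: norm_tens scaleC_of_real)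
  then have "blinfun_apply (Blinfun (\<lambda>x. tens x y)) x = tens x y" for x
    by (simp add: bounded_linear_Blinfun_apply)
  then show ?thesis
    by (intro bexI[of _ "Blinfun (\<lambda>x. tens x y)"]) (auto simp: bounded_ops_def tens_scaleC_left)
qed

text \<open>Slicing \<open>T\<close> with vectors of the second factor gives operators that commute with \<open>\<pi>\<^sub>1\<close>.\<close>

lemma tens_slice:
  fixes \<pi>\<^sub>1 :: "'a::cstar_algebra \<Rightarrow> 'h1 \<Rightarrow>\<^sub>L 'h1" and \<sigma> :: "'a \<Rightarrow> 't \<Rightarrow>\<^sub>L 't"
  assumes \<sigma>: "star_representation UNIV \<sigma>" and \<pi>\<^sub>1: "star_representation A \<pi>\<^sub>1"
    and A: "\<And>a. a \<in> A \<Longrightarrow> star a \<in> A"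
    and triv: "trivial_commutant (\<pi>\<^sub>1 ` A)"
    and eq: "\<And>a x y. a \<in> A \<Longrightarrow> blinfun_apply (\<sigma> a) (tens x y) = tens (blinfun_apply (\<pi>\<^sub>1 a) x) y"
    and T: "T \<in> commutant (\<sigma> ` A)"
  obtains f where "\<And>x y x' y'. cinner (tens x y) (blinfun_apply T (tens x' y')) = cinner x x' * f y y'"
proof -
  have "\<exists>c. \<forall>x x'. cinner (tens x y) (blinfun_apply T (tens x' y')) = cinner x x' * c" for y y'
  proof -
    obtain W where W: "W \<in> bounded_ops" "\<And>x. blinfun_apply W x = tens x y"
      using tens_left_operator by blast
    obtain W' where W': "W' \<in> bounded_ops" "\<And>x. blinfun_apply W' x = tens x y'"
      using tens_left_operator by blast
    have Z: "adj W o\<^sub>L T o\<^sub>L W' \<in> bounded_ops"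
      by (intro bounded_ops_compose adj_in_bounded_ops W W' commutantD(1)[OF T])
    have "adj W o\<^sub>L T o\<^sub>L W' \<in> commutant (\<pi>\<^sub>1 ` A)"
    proof (rule commutantI[OF Z])
      fix S x assume "S \<in> \<pi>\<^sub>1 ` A"
      then obtain a where a: "a \<in> A" "S = \<pi>\<^sub>1 a"
        by blast
      note sa = star_representationD[OF \<pi>\<^sub>1]
      have "blinfun_apply (adj W) (blinfun_apply T (blinfun_apply (\<sigma> a) (blinfun_apply W' x)))
          = blinfun_apply (\<pi>\<^sub>1 a) (blinfun_apply (adj W) (blinfun_apply T (blinfun_apply W' x)))"
      proof (rule cinner_eqI)
        fix z
        have "cinner z (blinfun_apply (adj W) (blinfun_apply T (blinfun_apply (\<sigma> a) (blinfun_apply W' x))))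
            = cinner (blinfun_apply (\<sigma> (star a)) (tens z y)) (blinfun_apply T (blinfun_apply W' x))"
          using T a by (simp add: cinner_adj'[OF W(1)] W(2) commutantD(3)[OF T] cinner_rep[OF \<sigma>] star_star)
        also have "\<dots> = cinner (blinfun_apply (adj (\<pi>\<^sub>1 a)) z) (blinfun_apply (adj W) (blinfun_apply T (blinfun_apply W' x)))"
          using a by (simp add: eq A cinner_adj'[OF W(1)] W(2) sa)
        finally show "cinner z (blinfun_apply (adj W) (blinfun_apply T (blinfun_apply (\<sigma> a) (blinfun_apply W' x))))
            = cinner z (blinfun_apply (\<pi>\<^sub>1 a) (blinfun_apply (adj W) (blinfun_apply T (blinfun_apply W' x))))"
          using a by (simp add: cinner_adj sa)
      qed
      then show "blinfun_apply (adj W o\<^sub>L T o\<^sub>L W') (blinfun_apply S x)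
          = blinfun_apply S (blinfun_apply (adj W o\<^sub>L T o\<^sub>L W') x)"
        using a by (simp add: W' eq)
    qed
    then obtain c where c: "adj W o\<^sub>L T o\<^sub>L W' = cmul c"
      using triv unfolding trivial_commutant_def by blast
    have "cinner (tens x y) (blinfun_apply T (tens x' y')) = cinner x x' * c" for x x'
    proof -
      have "cinner (tens x y) (blinfun_apply T (tens x' y')) = cinner x (blinfun_apply (adj W o\<^sub>L T o\<^sub>L W') x')"
        by (simp add: cinner_adj'[OF W(1)] W W')
      then show ?thesis
        unfolding c by (simp add: cinner_scaleC_right mult.commute)
    qed
    then show ?thesis
      by blast
  qed
  then show thesis
    using that by metis
qed

text \<open>\<open>E\<close> is the rank-one projection onto \<open>\<xi>\<close> tensored with the
  identity, obtained as \<open>W o\<^sub>L adj W\<close> from the isometry W y =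
  \<open>tens \<xi> y\<close>. By slicing, an operator commuting with the first factor acts on the
  second one only, hence commutes with \<open>E\<close>.\<close>

lemma tens_projection:
  fixes \<pi>\<^sub>1 :: "'a::cstar_algebra \<Rightarrow> 'h1 \<Rightarrow>\<^sub>L 'h1" and \<sigma> :: "'a \<Rightarrow> 't \<Rightarrow>\<^sub>L 't"
  assumes \<sigma>: "star_representation UNIV \<sigma>" and \<pi>\<^sub>1: "star_representation A \<pi>\<^sub>1"
    and A: "\<And>a. a \<in> A \<Longrightarrow> star a \<in> A"
    and triv: "trivial_commutant (\<pi>\<^sub>1 ` A)"
    and eq: "\<And>a x y. a \<in> A \<Longrightarrow> blinfun_apply (\<sigma> a) (tens x y) = tens (blinfun_apply (\<pi>\<^sub>1 a) x) y"
    and \<xi>: "norm \<xi> = 1"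
  obtains E where "E \<in> commutant (commutant (\<sigma> ` A))" "adj E = E" "E o\<^sub>L E = E"
    "\<And>x y. blinfun_apply E (tens x y) = cinner \<xi> x *\<^sub>C tens \<xi> y"
    "\<And>a. a \<in> A \<Longrightarrow> E o\<^sub>L \<sigma> a o\<^sub>L E = cmul (cinner \<xi> (blinfun_apply (\<pi>\<^sub>1 a) \<xi>)) o\<^sub>L E"
proof -
  have xx: "cinner \<xi> \<xi> = 1"
    by (simp add: cinner_self \<xi>)
  have "bounded_linear (tens \<xi>)"
    using tens tens_scaleC_right[of _ "complex_of_real _"] unfolding hilbert_tensor_def
    by (intro bounded_linear_intro[where K = 1]) (auto simp: norm_tens scaleC_of_real \<xi>)
  then have W: "blinfun_apply (Blinfun (tens \<xi>)) y = tens \<xi> y" for y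
    by (simp add: bounded_linear_Blinfun_apply)
  define W where "W = Blinfun (tens \<xi>)"
  have W: "W \<in> bounded_ops" "blinfun_apply W y = tens \<xi> y" for y
    using W by (auto simp: W_def bounded_ops_def tens_scaleC_right)
  have aW: "blinfun_apply (adj W) (tens x y) = cinner \<xi> x *\<^sub>C y" for x y
    by (rule cinner_eqI) (simp add: cinner_adj'[OF W(1)] W(2) cinner_tens cinner_scaleC_right)
  define E where "E = W o\<^sub>L adj W"
  have bE: "E \<in> bounded_ops"
    unfolding E_def by (intro bounded_ops_compose adj_in_bounded_ops W)
  have aE: "adj E = E"
    by (simp add: E_def adj_compose adj_adj adj_in_bounded_ops W)
  have E: "blinfun_apply E (tens x y) = cinner \<xi> x *\<^sub>C tens \<xi> y" for x y
    by (simp add: E_def aW W tens_scaleC_right)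
  show thesis
  proof
    show "E \<in> commutant (commutant (\<sigma> ` A))"
    proof (rule commutantI[OF bE])
      fix T u assume T: "T \<in> commutant (\<sigma> ` A)"
      obtain f where f: "\<And>x y x' y'. cinner (tens x y) (blinfun_apply T (tens x' y')) = cinner x x' * f y y'"
        using tens_slice[OF \<sigma> \<pi>\<^sub>1 A triv eq T] by metis
      have "E o\<^sub>L T = T o\<^sub>L E"
      proof (rule tens_blinfun_eqI, rule tens_cinner_eqI)
        fix x y x' y'
        have "cinner (tens x' y') (blinfun_apply E (blinfun_apply T (tens x y)))
            = cinner (blinfun_apply E (tens x' y')) (blinfun_apply T (tens x y))"
          using cinner_adj[OF bE] aE by metis
        also have "\<dots> = cinner x' \<xi> * (cinner \<xi> x * f y' y)"
          by (simp add: E cinner_scaleC_left f cinner_commute[of x' \<xi>])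
        also have "\<dots> = cinner (tens x' y') (blinfun_apply T (blinfun_apply E (tens x y)))"
          by (simp add: E bounded_opsD[OF commutantD(1)[OF T]] cinner_scaleC_right f)
        finally show "cinner (tens x' y') (blinfun_apply (E o\<^sub>L T) (tens x y))
            = cinner (tens x' y') (blinfun_apply (T o\<^sub>L E) (tens x y))"
          by simp
      qed
      then show "blinfun_apply E (blinfun_apply T u) = blinfun_apply T (blinfun_apply E u)"
        by (metis blinfun_apply_blinfun_compose)
    qed
    show "adj E = E" "\<And>x y. blinfun_apply E (tens x y) = cinner \<xi> x *\<^sub>C tens \<xi> y"
      by (fact aE, fact E)
    show "E o\<^sub>L E = E"
      by (rule tens_blinfun_eqI) (simp add: E bounded_opsD[OF bE] xx)
    show "E o\<^sub>L \<sigma> a o\<^sub>L E = cmul (cinner \<xi> (blinfun_apply (\<pi>\<^sub>1 a) \<xi>)) o\<^sub>L E" if "a \<in> A" for a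
      by (rule tens_blinfun_eqI)
        (simp add: E bounded_opsD[OF bE] bounded_opsD[OF rep_bounded_ops[OF \<sigma>]] eq[OF that]
          scaleC_scaleC mult.commute)
  qed
qed

end

text \<open>Slicing both ways writes the matrix elements of \<open>T\<close> as
  \<open>cinner x x'\<close> times a function of y, y' and as \<open>cinner y y'\<close> times a
  function of x, x'. Evaluating the first variables at \<open>\<xi>\<close> shows that
  \<open>T\<close> is a scalar.\<close>

lemma tens_trivial_commutant:
  fixes \<pi>\<^sub>1 :: "'a::cstar_algebra \<Rightarrow> 'h1::chilbert_space \<Rightarrow>\<^sub>L 'h1" and \<pi>\<^sub>2 :: "'a \<Rightarrow> 'h2::chilbert_space \<Rightarrow>\<^sub>L 'h2"
    and \<sigma> :: "'a \<Rightarrow> 't::chilbert_space \<Rightarrow>\<^sub>L 't"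
  assumes tens: "hilbert_tensor tens" and \<sigma>: "star_representation UNIV \<sigma>"
    and \<pi>\<^sub>1: "star_representation A \<pi>\<^sub>1" "\<And>a. a \<in> A \<Longrightarrow> star a \<in> A" "trivial_commutant (\<pi>\<^sub>1 ` A)"
      "\<And>a x y. a \<in> A \<Longrightarrow> blinfun_apply (\<sigma> a) (tens x y) = tens (blinfun_apply (\<pi>\<^sub>1 a) x) y"
    and \<pi>\<^sub>2: "star_representation B \<pi>\<^sub>2" "\<And>b. b \<in> B \<Longrightarrow> star b \<in> B" "trivial_commutant (\<pi>\<^sub>2 ` B)"
      "\<And>b x y. b \<in> B \<Longrightarrow> blinfun_apply (\<sigma> b) (tens x y) = tens x (blinfun_apply (\<pi>\<^sub>2 b) y)"
    and ne: "norm (\<xi>::'h1) = 1"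
  shows "trivial_commutant (range \<sigma>)"
  unfolding trivial_commutant_def
proof
  fix T assume T: "T \<in> commutant (range \<sigma>)"
  have TA: "T \<in> commutant (\<sigma> ` A)" and TB: "T \<in> commutant (\<sigma> ` B)"
    by (rule subsetD[OF commutant_antimono[OF image_mono[OF subset_UNIV]] T])+
  obtain f where f: "\<And>x y x' y'. cinner (tens x y) (blinfun_apply T (tens x' y')) = cinner x x' * f y y'"
    using tens_slice[OF tens \<sigma> \<pi>\<^sub>1 TA] by metis
  obtain g where g: "\<And>x y x' y'. cinner (tens x y) (blinfun_apply T (tens x' y')) = cinner y y' * g x x'"
    using tens_slice[OF hilbert_tensor_swap[OF tens] \<sigma> \<pi>\<^sub>2 TB] by metis
  have "f y y' = cinner y y' * g \<xi> \<xi>" for y y'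
    using f[of \<xi> y \<xi> y'] g[of \<xi> y \<xi> y'] by (simp add: cinner_self ne)
  then have "cinner (tens x y) (blinfun_apply T (tens x' y')) = g \<xi> \<xi> * (cinner x x' * cinner y y')" for x y x' y'
    by (simp add: f)
  then have "T = cmul (g \<xi> \<xi>)"
    by (intro tens_blinfun_eqI[OF tens] tens_cinner_eqI[OF tens])
      (simp add: cinner_scaleC_right cinner_tens[OF tens])
  then show "\<exists>c. T = cmul c" ..
qed

text \<open>Equal vector states make the intertwiner isometric, and \<open>U o\<^sub>L adj U\<close>
  fixes the orbit of \<open>g\<close>, which is dense.\<close>

lemma cyclic_unitary:
  fixes \<rho> :: "'a::cstar_algebra \<Rightarrow> 'h::chilbert_space \<Rightarrow>\<^sub>L 'h"
    and \<pi> :: "'a \<Rightarrow> 'k::chilbert_space \<Rightarrow>\<^sub>L 'k"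
  assumes \<rho>: "star_representation UNIV \<rho>" and \<pi>: "star_representation UNIV \<pi>"
    and cyc: "closure (range (\<lambda>a. blinfun_apply (\<rho> a) h)) = UNIV"
    and cyc': "closure (range (\<lambda>a. blinfun_apply (\<pi> a) g)) = UNIV"
    and eq: "\<And>a. cinner g (blinfun_apply (\<pi> a) g) = cinner h (blinfun_apply (\<rho> a) h)"
  obtains U where "U \<in> bounded_ops" "adj U o\<^sub>L U = id_blinfun" "U o\<^sub>L adj U = id_blinfun"
    "\<And>a. U o\<^sub>L \<rho> a = \<pi> a o\<^sub>L U"
proof -
  obtain U where U: "U \<in> bounded_ops" "\<And>a. blinfun_apply U (blinfun_apply (\<rho> a) h) = blinfun_apply (\<pi> a) g"
    "\<And>a. U o\<^sub>L \<rho> a = \<pi> a o\<^sub>L U"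
    using cyclic_intertwiner[OF \<rho> \<pi> cyc, of g 1] eq by auto
  have inner: "cinner (blinfun_apply U x) (blinfun_apply U y) = cinner x y" for x y
    using cyclic_intertwiner_inner[OF \<rho> \<pi> cyc U(1,2) U(1,2), of 1] eq by simp
  have 1: "adj U o\<^sub>L U = id_blinfun"
    by (rule blinfun_eqI, rule cinner_eqI) (simp add: cinner_adj'[OF U(1)] inner)
  have "U o\<^sub>L adj U = id_blinfun"
    using cyc'
  proof (rule blinfun_eq_on_dense)
    fix x assume "x \<in> range (\<lambda>a. blinfun_apply (\<pi> a) g)"
    then obtain a where "x = blinfun_apply U (blinfun_apply (\<rho> a) h)"
      using U(2) by auto
    moreover have "blinfun_apply (adj U) (blinfun_apply U y) = y" for y
      using arg_cong[OF 1, of "\<lambda>S. blinfun_apply S y"] by simp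
    ultimately show "blinfun_apply (U o\<^sub>L adj U) x = blinfun_apply id_blinfun x"
      by simp
  qed
  with U(1) 1 show thesis
    using U(3) by (rule that)
qed

lemma closure_orbit_irreducible:
  assumes irr: "irreducible_rep UNIV \<pi>" and "g \<noteq> 0"
  shows "closure (range (\<lambda>a. blinfun_apply (\<pi> a) g)) = UNIV"
proof -
  have rep: "star_representation UNIV \<pi>"
    using irr unfolding irreducible_rep_def by blast
  let ?V = "closure (range (\<lambda>a. blinfun_apply (\<pi> a) g))"
  have "csubspace ?V \<and> closed ?V \<and> (\<forall>a\<in>UNIV. \<forall>x\<in>?V. blinfun_apply (\<pi> a) x \<in> ?V)"
    using csubspace_closure[OF csubspace_orbit[OF rep]] closure_orbit_invariant[OF rep] by auto
  then have "?V = {0} \<or> ?V = UNIV"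
    using irr unfolding irreducible_rep_def by blast
  then show ?thesis
    using mem_closure_orbit[OF rep, of g] assms(2) by auto
qed

lemma irreducible_trivial_commutant:
  assumes "irreducible_rep A \<pi>" "\<And>a. a \<in> A \<Longrightarrow> star a \<in> A"
  shows "trivial_commutant (\<pi> ` A)"
proof (rule schur)
  show "selfadjoint_set (\<pi> ` A)"
    using assms by (intro selfadjoint_set_image[of A]) (auto simp: irreducible_rep_def)
  show "V = {0} \<or> V = UNIV"
    if "csubspace V" "closed V" "\<And>T x. T \<in> \<pi> ` A \<Longrightarrow> x \<in> V \<Longrightarrow> blinfun_apply T x \<in> V" for V
    using assms(1) that unfolding irreducible_rep_def by blast
qed

section \<open>Multiples of an irreducible representation\<close>

text \<open>The vectors \<open>k\<close> in the range of \<open>G\<close> all induce multiples of the vector state of \<open>\<eta>\<close>, hence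
  intertwiners \<open>V k\<close> from \<open>\<rho>\<close> to \<open>\<pi>\<close>.  Since no nonzero operator of the commutant is killed by \<open>G\<close>,
  their ranges span, and \<open>\<pi>\<close> is a multiple of \<open>\<rho>\<close>.\<close>

context
  fixes \<rho> :: "'a::cstar_algebra \<Rightarrow> 'h::chilbert_space \<Rightarrow>\<^sub>L 'h" and \<eta> :: 'h
    and \<pi> :: "'a \<Rightarrow> 'k::chilbert_space \<Rightarrow>\<^sub>L 'k" and G :: "'k \<Rightarrow>\<^sub>L 'k"
  assumes \<rho>: "star_representation UNIV \<rho>" and \<pi>: "star_representation UNIV \<pi>"
    and triv: "trivial_commutant (range \<rho>)" and eta: "norm \<eta> = 1"
    and G: "G \<in> commutant (commutant (range \<pi>))" "adj G = G" "G o\<^sub>L G = G"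
    and G_state: "\<And>a. G o\<^sub>L \<pi> a o\<^sub>L G = cmul (cinner \<eta> (blinfun_apply (\<rho> a) \<eta>)) o\<^sub>L G"
    and faithful: "\<And>P. P \<in> commutant (range \<pi>) \<Longrightarrow> G o\<^sub>L P = 0 \<Longrightarrow> P = 0"
    and nonzero: "G \<noteq> 0"
begin

text \<open>\<open>R\<close> serves as the multiplicity space: \<open>V k\<close> x behaves like the
  elementary tensor of \<open>x\<close> and \<open>k\<close>, as \<open>V_inner\<close>
  shows.\<close>

private definition R where "R = range (blinfun_apply G)"

private lemma G_R: "k \<in> R \<Longrightarrow> blinfun_apply G k = k"
  unfolding R_def using G(3) by (metis blinfun_apply_blinfun_compose imageE)

private lemma G_bounded: "G \<in> bounded_ops"
  using commutantD(1)[OF G(1)] .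

private lemma cyc: "closure (range (\<lambda>a. blinfun_apply (\<rho> a) \<eta>)) = UNIV"
  using eta by (intro trivial_commutant_cyclic[OF \<rho> triv]) auto

private lemma G_inner: "cinner (blinfun_apply G x) y = cinner x (blinfun_apply G y)"
  using cinner_adj[OF G_bounded] G(2) by metis

private lemma R_state:
  assumes "k \<in> R" "l \<in> R"
  shows "cinner k (blinfun_apply (\<pi> a) l) = cinner k l * cinner \<eta> (blinfun_apply (\<rho> a) \<eta>)"
proof -
  have "cinner k (blinfun_apply (\<pi> a) l) = cinner (blinfun_apply G k) (blinfun_apply (\<pi> a) (blinfun_apply G l))"
    using assms by (simp add: G_R)
  also have "\<dots> = cinner k (blinfun_apply (G o\<^sub>L \<pi> a o\<^sub>L G) l)"
    by (simp add: G_inner)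
  finally show ?thesis
    using assms unfolding G_state by (simp add: G_R cinner_scaleC_right)
qed

private lemma intertwiner_ex:
  "\<exists>V. \<forall>k\<in>R. V k \<in> bounded_ops \<and> (\<forall>a. blinfun_apply (V k) (blinfun_apply (\<rho> a) \<eta>) = blinfun_apply (\<pi> a) k) \<and>
    (\<forall>a. V k o\<^sub>L \<rho> a = \<pi> a o\<^sub>L V k)"
proof (rule bchoice, rule ballI)
  fix k assume "k \<in> R"
  then show "\<exists>V. V \<in> bounded_ops \<and> (\<forall>a. blinfun_apply V (blinfun_apply (\<rho> a) \<eta>) = blinfun_apply (\<pi> a) k) \<and>
    (\<forall>a. V o\<^sub>L \<rho> a = \<pi> a o\<^sub>L V)"
    using cyclic_intertwiner[OF \<rho> \<pi> cyc R_state] by metis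
qed

private definition V where
  "V = (SOME V. \<forall>k\<in>R. V k \<in> bounded_ops \<and> (\<forall>a. blinfun_apply (V k) (blinfun_apply (\<rho> a) \<eta>) = blinfun_apply (\<pi> a) k) \<and>
    (\<forall>a. V k o\<^sub>L \<rho> a = \<pi> a o\<^sub>L V k))"

private lemma V:
  assumes "k \<in> R"
  shows "V k \<in> bounded_ops" "blinfun_apply (V k) (blinfun_apply (\<rho> a) \<eta>) = blinfun_apply (\<pi> a) k"
    "V k o\<^sub>L \<rho> a = \<pi> a o\<^sub>L V k"
  using someI_ex[OF intertwiner_ex] assms unfolding V_def by blast+

private lemma V_inner:
  assumes "k \<in> R" "l \<in> R"
  shows "cinner (blinfun_apply (V k) x) (blinfun_apply (V l) y) = cinner k l * cinner x y"
  by (rule cyclic_intertwiner_inner[OF \<rho> \<pi> cyc V(1,2)[OF assms(1)] V(1,2)[OF assms(2)] R_state[OF assms]])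

private lemma adj_V_V: "k \<in> R \<Longrightarrow> l \<in> R \<Longrightarrow> adj (V k) o\<^sub>L V l = cmul (cinner k l)"
  by (rule blinfun_eqI, rule cinner_eqI)
    (simp add: cinner_adj' V V_inner cinner_scaleC_right)

private lemma adj_V_rep:
  assumes "k \<in> R"
  shows "adj (V k) o\<^sub>L \<pi> a = \<rho> a o\<^sub>L adj (V k)"
proof -
  have "adj (V k o\<^sub>L \<rho> (star a)) = adj (\<pi> (star a) o\<^sub>L V k)"
    using V(3)[OF assms] by simp
  then show ?thesis
    by (simp add: adj_compose V(1)[OF assms] rep_bounded_ops[OF \<rho>] rep_bounded_ops[OF \<pi>]
        rep_star[OF \<rho>, symmetric] rep_star[OF \<pi>, symmetric] star_star)
qed

text \<open>\<open>W\<close> consists of the vectors whose whole orbit \<open>G\<close> kills. It is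
  invariant, so its projection commutes with \<open>\<pi>\<close>, is killed by \<open>G\<close>,
  and vanishes by \<open>faithful\<close>. Orthogonality to all ranges puts \<open>v\<close> into
  \<open>W\<close>.\<close>

private lemma orthogonal_zero:
  assumes "\<And>k x. k \<in> R \<Longrightarrow> cinner (blinfun_apply (V k) x) v = 0"
  shows "v = 0"
proof -
  define W where "W = {v. \<forall>a. blinfun_apply G (blinfun_apply (\<pi> a) v) = 0}"
  have W: "csubspace W"
    unfolding csubspace_def W_def
    by (auto simp: blinfun.add_right bounded_opsD[OF rep_bounded_ops[OF \<pi>]] bounded_opsD[OF G_bounded])
  have W': "closed W"
    unfolding W_def by (intro closed_Collect_all closed_Collect_eq continuous_intros)
  have "proj_onto W \<in> commutant (range \<pi>)"
    using W W'
  proof (rule proj_onto_commutant)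
    show "range \<pi> \<subseteq> bounded_ops" "T \<in> range \<pi> \<Longrightarrow> adj T \<in> range \<pi>" for T
      using rep_bounded_ops[OF \<pi>] by (auto simp flip: rep_star[OF \<pi>])
    fix T v assume "T \<in> range \<pi>" and v: "v \<in> W"
    then obtain b where b: "T = \<pi> b"
      by blast
    have "blinfun_apply G (blinfun_apply (\<pi> (a * b)) v) = 0" for a
      using v unfolding W_def by blast
    then show "blinfun_apply T v \<in> W"
      by (simp add: W_def b rep_mult[OF \<pi>])
  qed
  moreover have "G o\<^sub>L proj_onto W = 0"
  proof (rule blinfun_eqI)
    fix u
    have "blinfun_apply G (blinfun_apply (\<pi> 1) (blinfun_apply (proj_onto W) u)) = 0"
      using proj_onto_mem[OF W W', of u] unfolding W_def by blast
    then show "blinfun_apply (G o\<^sub>L proj_onto W) u = blinfun_apply 0 u"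
      by (simp add: rep_one[OF \<pi>])
  qed
  ultimately have "proj_onto W = 0"
    by (rule faithful)
  moreover have "v \<in> W"
    unfolding W_def
  proof (intro CollectI allI)
    fix a
    show "blinfun_apply G (blinfun_apply (\<pi> a) v) = 0"
    proof (rule cinner_eq_zeroD)
      fix u
      have "blinfun_apply G u \<in> R"
        by (simp add: R_def)
      then have "cinner (blinfun_apply (\<pi> (star a)) (blinfun_apply G u)) v = 0"
        using assms V(2) by metis
      then show "cinner u (blinfun_apply G (blinfun_apply (\<pi> a) v)) = 0"
        by (simp add: cinner_rep[OF \<pi>] star_star G_inner)
    qed
  qed
  ultimately show ?thesis
    using proj_onto_ident[OF W W', of v] by simp
qed

private lemma operator_zero:
  assumes S: "S \<in> bounded_ops" "\<And>k x. k \<in> R \<Longrightarrow> blinfun_apply S (blinfun_apply (V k) x) = 0"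
  shows "S = 0"
proof -
  have "blinfun_apply (adj S) u = 0" for u
    by (rule orthogonal_zero) (simp add: cinner_adj' S)
  then have "cinner u (blinfun_apply S v) = 0" for u v
    by (simp add: cinner_adj[OF S(1), symmetric])
  then show ?thesis
    by (intro blinfun_eqI) (simp add: cinner_eq_zeroD)
qed

private lemma unit_vector_ex: "\<exists>g\<in>R. cinner g g = 1"
proof -
  obtain x where x: "blinfun_apply G x \<noteq> 0"
    using nonzero by (metis blinfun_eqI zero_blinfun.rep_eq)
  define g where "g = blinfun_apply G ((1 / norm (blinfun_apply G x)) *\<^sub>R x)"
  have "norm g = 1"
    using x by (simp add: g_def blinfun.scaleR_right)
  then have "g \<in> R \<and> cinner g g = 1"
    by (auto simp: R_def g_def cinner_self)
  then show ?thesis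
    by blast
qed

private definition g where "g = (SOME g. g \<in> R \<and> cinner g g = 1)"

private lemma g: "g \<in> R" "cinner g g = 1"
  using unit_vector_ex someI_ex[of "\<lambda>g. g \<in> R \<and> cinner g g = 1"] unfolding g_def by blast+

private lemma adj_Vg: "blinfun_apply (adj (V g)) (blinfun_apply (V g) x) = x"
  using arg_cong[OF adj_V_V[OF g(1) g(1)], of "\<lambda>S. blinfun_apply S x"] g(2) by simp

private definition \<tau> where "\<tau> S = adj (V g) o\<^sub>L S o\<^sub>L V g"

text \<open>\<open>V k o\<^sub>L adj (V g)\<close> carries the copy of \<open>\<rho>\<close> at
  \<open>g\<close> to the copy at \<open>k\<close> and commutes with \<open>\<pi>\<close>, so
  \<open>S\<close> acts on every copy as it does on the one at \<open>g\<close>.\<close>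

private lemma bicommutant_V:
  assumes S: "S \<in> commutant (commutant (range \<pi>))" and k: "k \<in> R"
  shows "blinfun_apply S (blinfun_apply (V k) x) = blinfun_apply (V k) (blinfun_apply (\<tau> S) x)"
proof -
  have "V k o\<^sub>L adj (V g) \<in> commutant (range \<pi>)"
  proof (rule commutantI)
    show "V k o\<^sub>L adj (V g) \<in> bounded_ops"
      by (intro bounded_ops_compose adj_in_bounded_ops V k g)
    fix T x assume "T \<in> range \<pi>"
    then obtain a where T: "T = \<pi> a"
      by blast
    have "blinfun_apply (adj (V g)) (blinfun_apply (\<pi> a) x) = blinfun_apply (\<rho> a) (blinfun_apply (adj (V g)) x)"
      using arg_cong[OF adj_V_rep[OF g(1), of a], of "\<lambda>S. blinfun_apply S x"] by simp
    moreover have "blinfun_apply (V k) (blinfun_apply (\<rho> a) y) = blinfun_apply (\<pi> a) (blinfun_apply (V k) y)" for y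
      using arg_cong[OF V(3)[OF k, of a], of "\<lambda>S. blinfun_apply S y"] by simp
    ultimately show "blinfun_apply (V k o\<^sub>L adj (V g)) (blinfun_apply T x)
        = blinfun_apply T (blinfun_apply (V k o\<^sub>L adj (V g)) x)"
      by (simp add: T)
  qed
  from commutantD(3)[OF S this, of "blinfun_apply (V g) x"] show ?thesis
    by (simp add: adj_Vg \<tau>_def)
qed

text \<open>The lift of \<open>A\<close> acts as \<open>V k x \<mapsto> V k (A x)\<close>.  It is contractive because the square root \<open>B\<close> of
  \<open>1 - A\<^sup>* A\<close> lifts along with \<open>A\<close>.\<close>

private lemma lift_contraction:
  assumes A: "A \<in> bounded_ops" "norm A \<le> 1"
  shows "\<exists>S\<in>bounded_ops. \<forall>k\<in>R. \<forall>x. blinfun_apply S (blinfun_apply (V k) x) = blinfun_apply (V k) (blinfun_apply A x)"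
proof -
  define b where "b = adj A o\<^sub>L A"
  have bb: "b \<in> commutant {}"
    unfolding b_def by (intro commutantI bounded_ops_compose adj_in_bounded_ops A) auto
  have ab: "adj b = b"
    unfolding b_def by (simp add: adj_compose adj_adj adj_in_bounded_ops A)
  have "norm b \<le> norm (adj A) * norm A"
    unfolding b_def by (rule norm_blinfun_compose)
  also have "\<dots> \<le> 1"
    using A(2) norm_adj_le[of A] by (intro mult_le_one) auto
  finally obtain B where B: "B \<in> commutant {}" "adj B = B" "B o\<^sub>L B = id_blinfun - b"
    using op_sqrt[OF bb ab] by metis
  have pyth: "cinner (blinfun_apply A x) (blinfun_apply A y) + cinner (blinfun_apply B x) (blinfun_apply B y) = cinner x y" for x y
  proof -
    have "cinner (blinfun_apply B x) (blinfun_apply B y) = cinner x (blinfun_apply (B o\<^sub>L B) y)"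
      using cinner_adj[OF commutantD(1)[OF B(1)]] B(2) by (metis blinfun_apply_blinfun_compose)
    then show ?thesis
      unfolding B(3) by (simp add: b_def blinfun.diff_left cinner_diff_right cinner_adj' A)
  qed
  \<comment> \<open>Sums of vectors \<open>V k\<close> x have no unique representation, so the lift
    is built as a graph. The third component records the lift of \<open>B\<close>; the identity
    \<open>Q\<close>, bilinear and thus stable under spans, then bounds the second component by the
    first.\<close>
  define Gen where "Gen = {(blinfun_apply (V k) x, blinfun_apply (V k) (blinfun_apply A x), blinfun_apply (V k) (blinfun_apply B x)) |k x. k \<in> R}"
  define Q where "Q p q \<longleftrightarrow> inner (fst (snd p)) (fst (snd q)) + inner (snd (snd p)) (snd (snd q)) = inner (fst p) (fst q)"
    for p q :: "'k \<times> 'k \<times> 'k"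
  have Q_gen: "Q p q" if "p \<in> Gen" "q \<in> Gen" for p q
  proof -
    obtain k x where p: "k \<in> R" "p = (blinfun_apply (V k) x, blinfun_apply (V k) (blinfun_apply A x), blinfun_apply (V k) (blinfun_apply B x))"
      using \<open>p \<in> Gen\<close> unfolding Gen_def by blast
    obtain l y where q: "l \<in> R" "q = (blinfun_apply (V l) y, blinfun_apply (V l) (blinfun_apply A y), blinfun_apply (V l) (blinfun_apply B y))"
      using \<open>q \<in> Gen\<close> unfolding Gen_def by blast
    have "cinner k l * cinner (blinfun_apply A x) (blinfun_apply A y) + cinner k l * cinner (blinfun_apply B x) (blinfun_apply B y)
        = cinner k l * cinner x y"
      unfolding distrib_left[symmetric] pyth ..
    then show ?thesis
      using p(1) q(1) unfolding Q_def p(2) q(2) inner_eq_Re_cinner plus_complex.sel(1)[symmetric]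
      by (simp add: V_inner)
  qed
  have Q1: "Q p q" if p: "p \<in> span Gen" and q: "q \<in> Gen" for p q
  proof -
    have "subspace {p. Q p q}"
      by (auto simp: subspace_def Q_def inner_simps) (simp flip: distrib_left)
    then have "span Gen \<subseteq> {p. Q p q}"
      using Q_gen[OF _ q] by (intro span_minimal) blast+
    then show ?thesis
      using p by blast
  qed
  have Q2: "Q p q" if p: "p \<in> span Gen" and q: "q \<in> span Gen" for p q
  proof -
    have "subspace {q. Q p q}"
      by (auto simp: subspace_def Q_def inner_simps) (simp flip: distrib_left)
    then have "span Gen \<subseteq> {q. Q p q}"
      using Q1[OF p] by (intro span_minimal) blast+
    then show ?thesis
      using q by blast
  qed
  define L where "L = (\<lambda>p. (fst p, fst (snd p))) ` span Gen"
  \<comment> \<open>\<open>span\<close> is the real span, so stability under complex scalars is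
    shown separately.\<close>
  have scale: "(c *\<^sub>C fst p, c *\<^sub>C fst (snd p), c *\<^sub>C snd (snd p)) \<in> span Gen" if "p \<in> span Gen" for c p
  proof -
    have "subspace {p. (c *\<^sub>C fst p, c *\<^sub>C fst (snd p), c *\<^sub>C snd (snd p)) \<in> span Gen}"
      unfolding subspace_def
    proof (intro conjI ballI allI CollectI; (elim CollectE)?)
      show "(c *\<^sub>C fst 0, c *\<^sub>C fst (snd 0), c *\<^sub>C snd (snd 0)) \<in> span Gen"
        using span_zero[of Gen] by (simp add: zero_prod_def)
    next
      fix p q assume "(c *\<^sub>C fst p, c *\<^sub>C fst (snd p), c *\<^sub>C snd (snd p)) \<in> span Gen"
        "(c *\<^sub>C fst q, c *\<^sub>C fst (snd q), c *\<^sub>C snd (snd q)) \<in> span Gen"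
      from span_add[OF this]
      show "(c *\<^sub>C fst (p + q), c *\<^sub>C fst (snd (p + q)), c *\<^sub>C snd (snd (p + q))) \<in> span Gen"
        by (simp add: scaleC_add_right)
    next
      fix r p assume "(c *\<^sub>C fst p, c *\<^sub>C fst (snd p), c *\<^sub>C snd (snd p)) \<in> span Gen"
      from span_scale[OF this, of r]
      show "(c *\<^sub>C fst (r *\<^sub>R p), c *\<^sub>C fst (snd (r *\<^sub>R p)), c *\<^sub>C snd (snd (r *\<^sub>R p))) \<in> span Gen"
        by (simp add: scaleC_scaleR)
    qed
    moreover have "(c *\<^sub>C fst p, c *\<^sub>C fst (snd p), c *\<^sub>C snd (snd p)) \<in> span Gen" if "p \<in> Gen" for p
    proof -
      obtain k x where p: "k \<in> R" "p = (blinfun_apply (V k) x, blinfun_apply (V k) (blinfun_apply A x), blinfun_apply (V k) (blinfun_apply B x))"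
        using \<open>p \<in> Gen\<close> unfolding Gen_def by blast
      have "(c *\<^sub>C fst p, c *\<^sub>C fst (snd p), c *\<^sub>C snd (snd p)) =
        (blinfun_apply (V k) (c *\<^sub>C x), blinfun_apply (V k) (blinfun_apply A (c *\<^sub>C x)), blinfun_apply (V k) (blinfun_apply B (c *\<^sub>C x)))"
        by (simp add: p(2) bounded_opsD[OF V(1)[OF p(1)]] bounded_opsD[OF A(1)] bounded_opsD[OF commutantD(1)[OF B(1)]])
      also have "\<dots> \<in> Gen"
        unfolding Gen_def using p(1) by blast
      finally show ?thesis
        by (rule span_base)
    qed
    ultimately have "span Gen \<subseteq> {p. (c *\<^sub>C fst p, c *\<^sub>C fst (snd p), c *\<^sub>C snd (snd p)) \<in> span Gen}"
      by (intro span_minimal) auto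
    then show ?thesis
      using that by blast
  qed
  have V_L: "(blinfun_apply (V k) x, blinfun_apply (V k) (blinfun_apply A x)) \<in> L" if "k \<in> R" for k x
  proof -
    have "(blinfun_apply (V k) x, blinfun_apply (V k) (blinfun_apply A x), blinfun_apply (V k) (blinfun_apply B x)) \<in> span Gen"
      using that unfolding Gen_def by (intro span_base) blast
    then show ?thesis
      unfolding L_def by force
  qed
  have "\<exists>S\<in>bounded_ops. \<forall>x y. (x, y) \<in> L \<longrightarrow> blinfun_apply S x = y"
  proof (rule extend_from_dense[of _ 1])
    show L0: "(0, 0) \<in> L"
      unfolding L_def using span_zero[of Gen] by force
    show L_add: "(x + x', y + y') \<in> L" if "(x, y) \<in> L" "(x', y') \<in> L" for x y x' y'
    proof -
      obtain z where "(x, y, z) \<in> span Gen"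
        using \<open>(x, y) \<in> L\<close> unfolding L_def by auto
      moreover obtain z' where "(x', y', z') \<in> span Gen"
        using \<open>(x', y') \<in> L\<close> unfolding L_def by auto
      ultimately have "(x, y, z) + (x', y', z') \<in> span Gen"
        by (rule span_add)
      then show ?thesis
        unfolding L_def by force
    qed
    show L_scale: "(c *\<^sub>C x, c *\<^sub>C y) \<in> L" if "(x, y) \<in> L" for c x y
    proof -
      obtain z where "(x, y, z) \<in> span Gen"
        using \<open>(x, y) \<in> L\<close> unfolding L_def by auto
      from scale[OF this] show ?thesis
        unfolding L_def by force
    qed
    show "norm y \<le> 1 * norm x" if "(x, y) \<in> L" for x y
    proof -
      obtain z where "(x, y, z) \<in> span Gen"
        using \<open>(x, y) \<in> L\<close> unfolding L_def by auto
      from Q2[OF this this] have "(norm y)\<^sup>2 + (norm z)\<^sup>2 = (norm x)\<^sup>2"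
        by (simp add: Q_def power2_norm_eq_inner)
      then have "(norm y)\<^sup>2 \<le> (norm x)\<^sup>2"
        using zero_le_power2[of "norm z"] by linarith
      from power2_le_imp_le[OF this] show ?thesis
        by simp
    qed
    show "closure (fst ` L) = UNIV"
    proof (rule csubspace_dense)
      show "csubspace (fst ` L)"
        unfolding csubspace_def
      proof (intro conjI ballI allI)
        show "0 \<in> fst ` L"
          using image_eqI[OF _ L0, of 0 fst] by simp
      next
        fix x x' assume "x \<in> fst ` L" "x' \<in> fst ` L"
        then obtain y y' where "(x, y) \<in> L" "(x', y') \<in> L"
          by auto
        from L_add[OF this] show "x + x' \<in> fst ` L"
          by (rule image_eqI[rotated]) simp
      next
        fix c x assume "x \<in> fst ` L"
        then obtain y where "(x, y) \<in> L"
          by auto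
        from L_scale[OF this] show "c *\<^sub>C x \<in> fst ` L"
          by (rule image_eqI[rotated]) simp
      qed
      show "u = 0" if u: "\<And>v. v \<in> fst ` L \<Longrightarrow> cinner v u = 0" for u
        by (rule orthogonal_zero) (use V_L u in force)
    qed
  qed
  then show ?thesis
    using V_L by blast
qed

text \<open>An \<open>X\<close> commuting with \<open>\<pi>\<close> maps \<open>R\<close> into
  itself and satisfies \<open>X o\<^sub>L V k = V (X k)\<close>, so it only moves vectors between
  copies, while the lift acts alike inside each copy. Hence the two commute.\<close>

private lemma lift_operator:
  assumes A: "A \<in> bounded_ops"
  shows "\<exists>S\<in>commutant (commutant (range \<pi>)). \<tau> S = A"
proof -
  define c where "c = norm A + 1"
  have c: "0 < c"
    by (simp add: c_def add_nonneg_pos)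
  define A' where "A' = (1 / c) *\<^sub>R A"
  have "A' \<in> bounded_ops" "norm A' \<le> 1"
    using A c by (auto simp: A'_def bounded_ops_scaleR c_def)
  then obtain S' where S': "S' \<in> bounded_ops"
    "\<And>k x. k \<in> R \<Longrightarrow> blinfun_apply S' (blinfun_apply (V k) x) = blinfun_apply (V k) (blinfun_apply A' x)"
    using lift_contraction by blast
  define S where "S = c *\<^sub>R S'"
  have S: "S \<in> bounded_ops"
    unfolding S_def by (intro bounded_ops_scaleR S')
  have SV: "blinfun_apply S (blinfun_apply (V k) x) = blinfun_apply (V k) (blinfun_apply A x)" if "k \<in> R" for k x
    using c that by (simp add: S_def A'_def S' blinfun.scaleR_left blinfun.scaleR_right)
  have "S \<in> commutant (commutant (range \<pi>))"
    unfolding commutant_def[of "commutant (range \<pi>)"]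
  proof (intro CollectI conjI ballI S)
    fix X assume X: "X \<in> commutant (range \<pi>)"
    note bX = commutantD(1)[OF X]
    have XR: "blinfun_apply X k \<in> R" if "k \<in> R" for k
    proof -
      have "blinfun_apply G (blinfun_apply X k) = blinfun_apply X k"
        using commutantD(3)[OF G(1) X, of k] that by (simp add: G_R)
      then show ?thesis
        unfolding R_def by (metis rangeI)
    qed
    have XV: "blinfun_apply X (blinfun_apply (V k) x) = blinfun_apply (V (blinfun_apply X k)) x" if "k \<in> R" for k x
    proof -
      have "X o\<^sub>L V k = V (blinfun_apply X k)"
        using cyc
      proof (rule blinfun_eq_on_dense)
        fix y assume "y \<in> range (\<lambda>a. blinfun_apply (\<rho> a) \<eta>)"
        then obtain a where "y = blinfun_apply (\<rho> a) \<eta>" ..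
        then show "blinfun_apply (X o\<^sub>L V k) y = blinfun_apply (V (blinfun_apply X k)) y"
          using that XR[OF that] commutantD(3)[OF X, of "\<pi> a" k] by (simp add: V)
      qed
      then show ?thesis
        by (metis blinfun_apply_blinfun_compose)
    qed
    have "(S o\<^sub>L X) - (X o\<^sub>L S) = 0"
    proof (rule operator_zero)
      show "(S o\<^sub>L X) - (X o\<^sub>L S) \<in> bounded_ops"
        by (intro bounded_ops_diff bounded_ops_compose S bX)
      show "blinfun_apply ((S o\<^sub>L X) - (X o\<^sub>L S)) (blinfun_apply (V k) x) = 0" if "k \<in> R" for k x
        using that XR by (simp add: blinfun.diff_left XV SV)
    qed
    then show "S o\<^sub>L X = X o\<^sub>L S"
      by simp
  qed
  moreover have "\<tau> S = A"
    by (rule blinfun_eqI) (simp add: \<tau>_def SV g adj_Vg)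
  ultimately show ?thesis
    by blast
qed

text \<open>The target is all of \<open>bounded_ops\<close> because \<open>\<rho>\<close> is
  irreducible. Lifting makes \<open>\<tau>\<close> surjective; it is injective because
  \<open>\<tau> S\<close> fixes \<open>S\<close> on every copy and the copies together are
  total.\<close>

lemma quasi_equivalent_of_projection: "quasi_equivalent UNIV \<pi> \<rho>"
proof -
  let ?M = "commutant (commutant (range \<pi>))"
  have N: "commutant (commutant (range \<rho>)) = bounded_ops"
    by (rule trivial_commutant_bicommutant[OF triv])
  have b: "S \<in> bounded_ops" if "S \<in> ?M" for S
    using that by (rule commutantD(1))
  note bV = V(1)[OF g(1)]
  have "star_isomorphism ?M bounded_ops \<tau>"
    unfolding star_isomorphism_def
  proof (intro conjI ballI allI impI)
    show "bij_betw \<tau> ?M bounded_ops"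
      unfolding bij_betw_def
    proof
      show "inj_on \<tau> ?M"
      proof (rule inj_onI)
        fix S T assume ST: "S \<in> ?M" "T \<in> ?M" "\<tau> S = \<tau> T"
        have "S - T = 0"
          by (rule operator_zero) (auto simp: bounded_ops_diff b ST bicommutant_V blinfun.diff_left)
        then show "S = T"
          by simp
      qed
      show "\<tau> ` ?M = bounded_ops"
        using lift_operator by (auto simp: \<tau>_def image_iff intro!: bounded_ops_compose adj_in_bounded_ops bV b)
    qed
    fix S T assume ST: "S \<in> ?M" "T \<in> ?M"
    show "\<tau> (S + T) = \<tau> S + \<tau> T"
      by (rule blinfun_eqI) (simp add: \<tau>_def blinfun.add_left blinfun.add_right)
    \<comment> \<open>This compression is multiplicative because \<open>T\<close> preserves the
      range of \<open>V g\<close>.\<close>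
    show "\<tau> (S o\<^sub>L T) = \<tau> S o\<^sub>L \<tau> T"
    proof (rule blinfun_eqI)
      fix x
      have "blinfun_apply (\<tau> (S o\<^sub>L T)) x = blinfun_apply (adj (V g)) (blinfun_apply S (blinfun_apply T (blinfun_apply (V g) x)))"
        by (simp add: \<tau>_def)
      also have "blinfun_apply T (blinfun_apply (V g) x) = blinfun_apply (V g) (blinfun_apply (\<tau> T) x)"
        by (rule bicommutant_V[OF ST(2) g(1)])
      finally show "blinfun_apply (\<tau> (S o\<^sub>L T)) x = blinfun_apply (\<tau> S o\<^sub>L \<tau> T) x"
        by (simp add: \<tau>_def)
    qed
    show "is_adjoint (\<tau> S) (\<tau> T)" if "is_adjoint S T"
      using that unfolding is_adjoint_def by (simp add: \<tau>_def cinner_adj cinner_adj' bV)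
    fix c y assume "\<forall>x. blinfun_apply T x = c *\<^sub>C blinfun_apply S x"
    then show "blinfun_apply (\<tau> T) y = c *\<^sub>C blinfun_apply (\<tau> S) y"
      by (simp add: \<tau>_def bounded_opsD[OF adj_in_bounded_ops[OF bV]])
  qed
  moreover have "\<tau> (\<pi> a) = \<rho> a" for a
  proof (rule blinfun_eqI)
    fix x
    have "blinfun_apply (\<tau> (\<pi> a)) x = blinfun_apply (adj (V g)) (blinfun_apply (V g o\<^sub>L \<rho> a) x)"
      unfolding V(3)[OF g(1)] by (simp add: \<tau>_def)
    then show "blinfun_apply (\<tau> (\<pi> a)) x = blinfun_apply (\<rho> a) x"
      by (simp add: adj_Vg)
  qed
  ultimately show ?thesis
    unfolding quasi_equivalent_def N by blast
qed

text \<open>The unit vector \<open>g\<close> in \<open>R\<close> has the vector state of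
  \<open>\<eta>\<close>, and irreducibility makes it cyclic, so GNS uniqueness applies.\<close>

lemma unitarily_equivalent_of_projection:
  assumes irr: "irreducible_rep UNIV \<pi>"
  shows "unitarily_equivalent UNIV \<pi> \<rho>"
proof -
  have "g \<noteq> 0"
    using g(2) by auto
  then have cyc': "closure (range (\<lambda>a. blinfun_apply (\<pi> a) g)) = UNIV"
    by (rule closure_orbit_irreducible[OF irr])
  have "cinner \<eta> (blinfun_apply (\<rho> a) \<eta>) = cinner g (blinfun_apply (\<pi> a) g)" for a
    using R_state[OF g(1) g(1)] g(2) by simp
  then obtain U where U: "U \<in> bounded_ops" "adj U o\<^sub>L U = id_blinfun" "U o\<^sub>L adj U = id_blinfun"
    "\<And>a. U o\<^sub>L \<pi> a = \<rho> a o\<^sub>L U"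
    using cyclic_unitary[OF \<pi> \<rho> cyc' cyc] by blast
  have 1: "blinfun_apply (adj U) (blinfun_apply U x) = x" for x
    using arg_cong[OF U(2), of "\<lambda>S. blinfun_apply S x"] by simp
  have 2: "blinfun_apply U (blinfun_apply (adj U) x) = x" for x
    using arg_cong[OF U(3), of "\<lambda>S. blinfun_apply S x"] by simp
  have "unitary_op U"
    unfolding unitary_op_def
  proof (intro conjI allI)
    show "surj (blinfun_apply U)"
      using 2 by (metis surjI)
    show "cinner (blinfun_apply U x) (blinfun_apply U y) = cinner x y" for x y
      by (simp add: cinner_adj'[OF U(1), symmetric] 1)
  qed (rule U)
  then show ?thesis
    using U(4) unfolding unitarily_equivalent_def by blast
qed

end

section \<open>Superselection sectors\<close>

lemma blinfun_compose_assoc: "(S o\<^sub>L T) o\<^sub>L U = S o\<^sub>L (T o\<^sub>L U)"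
  by (rule blinfun_eqI) simp

text \<open>Reverse the axis at the same apex: opposite numbers cannot both exceed |x - a| cos
  \<open>\<theta>\<close>, which is nonnegative as \<open>\<theta>\<close> is below pi / 2.\<close>

lemma cone_disjoint_opposite:
  assumes "is_cone \<Lambda>"
  obtains \<Lambda>' where "is_cone \<Lambda>'" "\<Lambda> \<inter> \<Lambda>' = {}"
proof -
  obtain a e \<theta> where c: "norm e = 1" "0 < \<theta>" "\<theta> < pi / 2" "\<Lambda> = cone a e \<theta>"
    using assms unfolding is_cone_def by blast
  have "is_cone (cone a (- e) \<theta>)"
    unfolding is_cone_def using c by (metis norm_minus_cancel)
  moreover have "False" if x: "x \<in> cone a e \<theta>" "x \<in> cone a (- e) \<theta>" for x
  proof -
    have "0 \<le> norm (site_point x - a) * cos \<theta>"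
      using c by (intro mult_nonneg_nonneg) (auto intro: cos_ge_zero)
    then show False
      using x unfolding cone_def by simp
  qed
  ultimately show thesis
    using that c(4) by blast
qed

context quantum_spin_system
begin

text \<open>These are the conditions of \<open>algebra_of_Un_subset\<close>: commutation need only
  be checked on products over two disjoint regions.\<close>

lemma intertwining_space:
  fixes \<pi> :: "'a \<Rightarrow> 'h::chilbert_space \<Rightarrow>\<^sub>L 'h"
  assumes \<pi>: "star_representation UNIV \<pi>" and T: "T \<in> bounded_ops"
  shows "csubspace {c. T o\<^sub>L \<pi> c = \<pi> c o\<^sub>L T}" "closed {c. T o\<^sub>L \<pi> c = \<pi> c o\<^sub>L T}"
proof -
  have "{c. T o\<^sub>L \<pi> c = \<pi> c o\<^sub>L T} = {c. \<forall>x. blinfun_apply T (blinfun_apply (\<pi> c) x) = blinfun_apply (\<pi> c) (blinfun_apply T x)}"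
    by (intro Collect_cong) (metis blinfun_apply_blinfun_compose blinfun_eqI)
  moreover have "csubspace \<dots>"
    using rep_scaleR[OF \<pi>, of 0 0] unfolding csubspace_def
    by (auto simp: rep_add[OF \<pi>] rep_scaleC[OF \<pi>] blinfun.add_left blinfun.add_right bounded_opsD[OF T])
  moreover have "closed \<dots>"
    by (intro closed_Collect_all closed_Collect_eq continuous_intros blinfun.continuous_on
        bounded_linear.continuous_on[OF bounded_linear_rep[OF \<pi>]])
  ultimately show "csubspace {c. T o\<^sub>L \<pi> c = \<pi> c o\<^sub>L T}" "closed {c. T o\<^sub>L \<pi> c = \<pi> c o\<^sub>L T}"
    by simp_all
qed

lemma commutant_Un:
  fixes \<pi> :: "'a \<Rightarrow> 'h::chilbert_space \<Rightarrow>\<^sub>L 'h"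
  assumes \<pi>: "star_representation UNIV \<pi>" and disj: "\<Lambda>\<^sub>1 \<inter> \<Lambda>\<^sub>2 = {}"
    and T: "T \<in> commutant (\<pi> ` algebra_of d \<iota> \<Lambda>\<^sub>1)" "T \<in> commutant (\<pi> ` algebra_of d \<iota> \<Lambda>\<^sub>2)"
  shows "T \<in> commutant (\<pi> ` algebra_of d \<iota> (\<Lambda>\<^sub>1 \<union> \<Lambda>\<^sub>2))"
proof -
  note b = commutantD(1)[OF T(1)]
  have "algebra_of d \<iota> (\<Lambda>\<^sub>1 \<union> \<Lambda>\<^sub>2) \<subseteq> {c. T o\<^sub>L \<pi> c = \<pi> c o\<^sub>L T}"
    using disj intertwining_space[OF \<pi> b]
  proof (rule algebra_of_Un_subset)
    fix x y assume xy: "x \<in> algebra_of d \<iota> \<Lambda>\<^sub>1" "y \<in> algebra_of d \<iota> \<Lambda>\<^sub>2"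
    have "T o\<^sub>L \<pi> (x * y) = \<pi> (x * y) o\<^sub>L T"
      by (rule blinfun_eqI) (simp add: rep_mult[OF \<pi>] commutantD(3)[OF T(1) imageI[OF xy(1)]] commutantD(3)[OF T(2) imageI[OF xy(2)]])
    then show "x * y \<in> {c. T o\<^sub>L \<pi> c = \<pi> c o\<^sub>L T}"
      by simp
  qed
  then show ?thesis
    using b unfolding commutant_def by blast
qed

context
  fixes \<pi> :: "'a \<Rightarrow> 'h::chilbert_space \<Rightarrow>\<^sub>L 'h"
  assumes \<pi>: "star_representation UNIV \<pi>"
begin

lemma selfadjoint_set_algebra_of: "selfadjoint_set (\<pi> ` algebra_of d \<iota> \<Lambda>)"
  using selfadjoint_set_image[OF \<pi>] star_in_algebra_of by blast

lemma image_subset_commutant: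
  assumes "\<Lambda>\<^sub>1 \<inter> \<Lambda>\<^sub>2 = {}"
  shows "\<pi> ` algebra_of d \<iota> \<Lambda>\<^sub>1 \<subseteq> commutant (\<pi> ` algebra_of d \<iota> \<Lambda>\<^sub>2)"
  unfolding commutant_def
  using arg_cong[OF algebra_of_commute[OF assms], of _ _ \<pi>]
  by (auto simp: rep_bounded_ops[OF \<pi>] rep_mult[OF \<pi>])

lemma bicommutant_subset_commutant:
  assumes "\<Lambda>\<^sub>1 \<inter> \<Lambda>\<^sub>2 = {}"
  shows "commutant (commutant (\<pi> ` algebra_of d \<iota> \<Lambda>\<^sub>1)) \<subseteq> commutant (\<pi> ` algebra_of d \<iota> \<Lambda>\<^sub>2)"
  using assms by (intro commutant_antimono image_subset_commutant) auto

lemma bicommutant_algebra_of_mono: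
  assumes "\<Lambda>\<^sub>1 \<subseteq> \<Lambda>\<^sub>2"
  shows "commutant (commutant (\<pi> ` algebra_of d \<iota> \<Lambda>\<^sub>1)) \<subseteq> commutant (commutant (\<pi> ` algebra_of d \<iota> \<Lambda>\<^sub>2))"
  using assms by (intro bicommutant_mono image_mono algebra_of_mono)

text \<open>A central \<open>Z\<close> commutes with the region by assumption and, lying in its
  bicommutant, with the complement by locality; so it commutes with all of
  \<open>\<pi>\<close>.\<close>

lemma center_trivial:
  assumes triv: "trivial_commutant (range \<pi>)"
    and Z: "Z \<in> commutant (\<pi> ` algebra_of d \<iota> \<Lambda>)" "Z \<in> commutant (commutant (\<pi> ` algebra_of d \<iota> \<Lambda>))"
  shows "\<exists>c. Z = cmul c"
proof -
  have "Z \<in> commutant (\<pi> ` algebra_of d \<iota> (- \<Lambda>))"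
    using Z(2) bicommutant_subset_commutant[of \<Lambda> "- \<Lambda>"] by auto
  from commutant_Un[OF \<pi> _ Z(1) this] have "Z \<in> commutant (range \<pi>)"
    by (simp add: embed_dense)
  then show ?thesis
    using triv unfolding trivial_commutant_def by blast
qed

end

text \<open>Irreducibility of \<open>\<pi>\<^sub>0\<close> makes its regional algebras factors, and
  the isomorphism hands this to \<open>\<pi>\<close>, where \<open>factor_product_zero\<close>
  applies.\<close>

lemma quasi_equivalent_factor:
  fixes \<pi>\<^sub>0 :: "'a \<Rightarrow> 'h::chilbert_space \<Rightarrow>\<^sub>L 'h" and \<pi> :: "'a \<Rightarrow> 'k::chilbert_space \<Rightarrow>\<^sub>L 'k"
  assumes \<pi>\<^sub>0: "star_representation UNIV \<pi>\<^sub>0" and \<pi>: "star_representation UNIV \<pi>"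
    and triv: "trivial_commutant (range \<pi>\<^sub>0)"
    and qe: "quasi_equivalent (algebra_of d \<iota> \<Lambda>) \<pi>\<^sub>0 \<pi>"
    and E: "E \<in> commutant (commutant (\<pi> ` algebra_of d \<iota> \<Lambda>))" "E \<noteq> 0"
    and T: "T \<in> commutant (\<pi> ` algebra_of d \<iota> \<Lambda>)" "E o\<^sub>L T = 0"
  shows "T = 0"
proof -
  note sa = selfadjoint_set_algebra_of[OF \<pi>] and sa0 = selfadjoint_set_algebra_of[OF \<pi>\<^sub>0]
  obtain \<tau> where \<tau>: "star_isomorphism (commutant (commutant (\<pi>\<^sub>0 ` algebra_of d \<iota> \<Lambda>)))
      (commutant (commutant (\<pi> ` algebra_of d \<iota> \<Lambda>))) \<tau>"
    using qe unfolding quasi_equivalent_def by blast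
  have "\<exists>c. Z = cmul c"
    if Z: "Z \<in> commutant (\<pi> ` algebra_of d \<iota> \<Lambda>)" "Z \<in> commutant (commutant (\<pi> ` algebra_of d \<iota> \<Lambda>))" for Z
  proof (rule star_isomorphism_center[OF \<tau> selfadjoint_set_commutant[OF sa0] refl selfadjoint_set_commutant[OF sa] refl])
    show "Z \<in> commutant (commutant (\<pi> ` algebra_of d \<iota> \<Lambda>))"
      "Z \<in> commutant (commutant (commutant (\<pi> ` algebra_of d \<iota> \<Lambda>)))"
      using Z commutant_bicommutant[OF selfadjoint_setD(1)[OF sa]] by auto
    show "\<exists>c. S = cmul c" if "S \<in> commutant (commutant (\<pi>\<^sub>0 ` algebra_of d \<iota> \<Lambda>))"
      "S \<in> commutant (commutant (commutant (\<pi>\<^sub>0 ` algebra_of d \<iota> \<Lambda>)))" for S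
      using center_trivial[OF \<pi>\<^sub>0 triv] that commutant_bicommutant[OF selfadjoint_setD(1)[OF sa0]] by metis
  qed
  from factor_product_zero[OF sa this E T] show ?thesis .
qed

text \<open>Identities in \<open>E\<^sub>0\<close> and operators \<open>\<pi>\<^sub>0 a\<close> pass
  through the isomorphism. The last two conclusions carry over what matters about the projection:
  the state it defines and what it commutes with.\<close>

lemma quasi_equivalent_transport:
  fixes \<pi>\<^sub>0 :: "'a \<Rightarrow> 'h::chilbert_space \<Rightarrow>\<^sub>L 'h" and \<pi> :: "'a \<Rightarrow> 'k::chilbert_space \<Rightarrow>\<^sub>L 'k"
  assumes \<pi>\<^sub>0: "star_representation UNIV \<pi>\<^sub>0" and \<pi>: "star_representation UNIV \<pi>"
    and qe: "quasi_equivalent (algebra_of d \<iota> \<Lambda>) \<pi>\<^sub>0 \<pi>"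
    and E0: "E\<^sub>0 \<in> commutant (commutant (\<pi>\<^sub>0 ` algebra_of d \<iota> \<Lambda>))" "adj E\<^sub>0 = E\<^sub>0" "E\<^sub>0 o\<^sub>L E\<^sub>0 = E\<^sub>0" "E\<^sub>0 \<noteq> 0"
  obtains E where "E \<in> commutant (commutant (\<pi> ` algebra_of d \<iota> \<Lambda>))" "adj E = E" "E o\<^sub>L E = E" "E \<noteq> 0"
    "\<And>a c. a \<in> algebra_of d \<iota> \<Lambda> \<Longrightarrow> E\<^sub>0 o\<^sub>L \<pi>\<^sub>0 a o\<^sub>L E\<^sub>0 = cmul c o\<^sub>L E\<^sub>0 \<Longrightarrow> E o\<^sub>L \<pi> a o\<^sub>L E = cmul c o\<^sub>L E"
    "\<And>a. a \<in> algebra_of d \<iota> \<Lambda> \<Longrightarrow> E\<^sub>0 o\<^sub>L \<pi>\<^sub>0 a = \<pi>\<^sub>0 a o\<^sub>L E\<^sub>0 \<Longrightarrow> E o\<^sub>L \<pi> a = \<pi> a o\<^sub>L E"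
proof -
  note sa = selfadjoint_set_algebra_of[OF \<pi>, of \<Lambda>] and sa0 = selfadjoint_set_algebra_of[OF \<pi>\<^sub>0, of \<Lambda>]
  let ?M = "commutant (commutant (\<pi>\<^sub>0 ` algebra_of d \<iota> \<Lambda>))"
  obtain \<tau> where \<tau>: "star_isomorphism ?M (commutant (commutant (\<pi> ` algebra_of d \<iota> \<Lambda>))) \<tau>"
    and \<tau>_\<pi>: "\<And>a. a \<in> algebra_of d \<iota> \<Lambda> \<Longrightarrow> \<tau> (\<pi>\<^sub>0 a) = \<pi> a"
    using qe unfolding quasi_equivalent_def by blast
  note iso = \<tau> selfadjoint_set_commutant[OF sa0] refl selfadjoint_set_commutant[OF sa] refl
  have M: "\<pi>\<^sub>0 a \<in> ?M" if "a \<in> algebra_of d \<iota> \<Lambda>" for a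
    using bicommutant_superset[OF selfadjoint_setD(1)[OF sa0]] that by blast
  show thesis
  proof
    show "\<tau> E\<^sub>0 \<in> commutant (commutant (\<pi> ` algebra_of d \<iota> \<Lambda>))"
      by (rule star_isomorphism_mem[OF iso E0(1)])
    show "adj (\<tau> E\<^sub>0) = \<tau> E\<^sub>0"
      using star_isomorphism_adj[OF iso E0(1)] E0(2) by simp
    show "\<tau> E\<^sub>0 o\<^sub>L \<tau> E\<^sub>0 = \<tau> E\<^sub>0"
      using star_isomorphism_compose[OF iso E0(1) E0(1)] E0(3) by simp
    show "\<tau> E\<^sub>0 \<noteq> 0"
      using star_isomorphism_inj[OF iso E0(1) zero_in_commutant] star_isomorphism_zero[OF iso] E0(4) by auto
    show "\<tau> E\<^sub>0 o\<^sub>L \<pi> a o\<^sub>L \<tau> E\<^sub>0 = cmul c o\<^sub>L \<tau> E\<^sub>0"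
      if a: "a \<in> algebra_of d \<iota> \<Lambda>" and eq: "E\<^sub>0 o\<^sub>L \<pi>\<^sub>0 a o\<^sub>L E\<^sub>0 = cmul c o\<^sub>L E\<^sub>0" for a c
    proof -
      have "\<tau> (E\<^sub>0 o\<^sub>L \<pi>\<^sub>0 a o\<^sub>L E\<^sub>0) = \<tau> E\<^sub>0 o\<^sub>L \<pi> a o\<^sub>L \<tau> E\<^sub>0"
        by (simp add: star_isomorphism_compose[OF iso] E0(1) M[OF a] commutant_compose \<tau>_\<pi>[OF a])
      then show ?thesis
        unfolding eq by (simp add: star_isomorphism_cmul_compose[OF iso E0(1)])
    qed
    show "\<tau> E\<^sub>0 o\<^sub>L \<pi> a = \<pi> a o\<^sub>L \<tau> E\<^sub>0"
      if a: "a \<in> algebra_of d \<iota> \<Lambda>" and eq: "E\<^sub>0 o\<^sub>L \<pi>\<^sub>0 a = \<pi>\<^sub>0 a o\<^sub>L E\<^sub>0" for a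
      using star_isomorphism_compose[OF iso E0(1) M[OF a]] star_isomorphism_compose[OF iso M[OF a] E0(1)]
      by (simp add: eq \<tau>_\<pi>[OF a])
  qed
qed

end

text \<open>If \<open>T\<close> commutes with \<open>\<rho>\<close> on \<open>A\<close>, then
  \<open>U o\<^sub>L T o\<^sub>L adj U\<close> commutes with \<open>\<sigma>\<close> on
  \<open>A\<close>. The set \<open>A\<close> is arbitrary, so this localises to regions.\<close>

lemma unitary_conj_bicommutant:
  fixes \<rho> :: "'a \<Rightarrow> 'h::chilbert_space \<Rightarrow>\<^sub>L 'h" and \<sigma> :: "'a \<Rightarrow> 't::chilbert_space \<Rightarrow>\<^sub>L 't"
  assumes U: "U \<in> bounded_ops" "adj U o\<^sub>L U = id_blinfun" "U o\<^sub>L adj U = id_blinfun"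
    "\<And>a. U o\<^sub>L \<rho> a = \<sigma> a o\<^sub>L U"
    and E: "E \<in> commutant (commutant (\<sigma> ` A))"
  shows "adj U o\<^sub>L E o\<^sub>L U \<in> commutant (commutant (\<rho> ` A))"
proof (rule commutantI)
  show "adj U o\<^sub>L E o\<^sub>L U \<in> bounded_ops"
    by (intro bounded_ops_compose adj_in_bounded_ops U commutantD(1)[OF E])
  fix T x assume T: "T \<in> commutant (\<rho> ` A)"
  have 1: "blinfun_apply (adj U) (blinfun_apply U x) = x" for x
    using arg_cong[OF U(2), of "\<lambda>S. blinfun_apply S x"] by simp
  have 2: "blinfun_apply U (blinfun_apply (adj U) x) = x" for x
    using arg_cong[OF U(3), of "\<lambda>S. blinfun_apply S x"] by simp
  have 3: "blinfun_apply U (blinfun_apply (\<rho> a) x) = blinfun_apply (\<sigma> a) (blinfun_apply U x)" for a x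
    using arg_cong[OF U(4), of "\<lambda>S. blinfun_apply S x"] by simp
  have 4: "blinfun_apply (adj U) (blinfun_apply (\<sigma> a) x) = blinfun_apply (\<rho> a) (blinfun_apply (adj U) x)" for a x
    using 3[of a "blinfun_apply (adj U) x"] by (metis 1 2)
  have "U o\<^sub>L T o\<^sub>L adj U \<in> commutant (\<sigma> ` A)"
  proof (rule commutantI)
    show "U o\<^sub>L T o\<^sub>L adj U \<in> bounded_ops"
      by (intro bounded_ops_compose adj_in_bounded_ops U commutantD(1)[OF T])
    fix S x assume "S \<in> \<sigma> ` A"
    then obtain a where a: "a \<in> A" "S = \<sigma> a"
      by blast
    show "blinfun_apply (U o\<^sub>L T o\<^sub>L adj U) (blinfun_apply S x) = blinfun_apply S (blinfun_apply (U o\<^sub>L T o\<^sub>L adj U) x)"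
      by (simp add: a(2) 4 commutantD(3)[OF T imageI[OF a(1)]] 3)
  qed
  from commutantD(3)[OF E this, of "blinfun_apply U x"]
  show "blinfun_apply (adj U o\<^sub>L E o\<^sub>L U) (blinfun_apply T x) = blinfun_apply T (blinfun_apply (adj U o\<^sub>L E o\<^sub>L U) x)"
    by (simp add: 1 2)
qed

text \<open>The rank-one projection onto \<open>\<xi>\<close> transports to a nonzero projection in \<open>\<pi>\<^sub>0(A)''\<close>, and any unit
  vector in its range has the same vector state as \<open>\<xi>\<close>.\<close>

lemma quasi_equivalent_irreducible_vector:
  fixes \<rho> :: "'a::cstar_algebra \<Rightarrow> 'h::chilbert_space \<Rightarrow>\<^sub>L 'h" and \<sigma> :: "'a \<Rightarrow> 't::chilbert_space \<Rightarrow>\<^sub>L 't"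
  assumes \<rho>: "star_representation UNIV \<rho>" and \<sigma>: "star_representation UNIV \<sigma>"
    and qe: "quasi_equivalent UNIV \<rho> \<sigma>" and triv: "trivial_commutant (range \<sigma>)" and \<xi>: "norm \<xi> = 1"
  obtains \<eta> where "norm \<eta> = 1"
    "\<And>a. cinner \<eta> (blinfun_apply (\<rho> a) \<eta>) = cinner \<xi> (blinfun_apply (\<sigma> a) \<xi>)"
proof -
  have sa: "selfadjoint_set (range \<rho>)" "selfadjoint_set (range \<sigma>)"
    using selfadjoint_set_image[OF \<rho>] selfadjoint_set_image[OF \<sigma>] by auto
  obtain \<tau> where \<tau>: "star_isomorphism (commutant (commutant (range \<sigma>))) (commutant (commutant (range \<rho>))) \<tau>"
    and \<tau>_\<sigma>: "\<And>a. \<tau> (\<sigma> a) = \<rho> a"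
    using quasi_equivalent_sym[OF qe sa] unfolding quasi_equivalent_def by blast
  note iso = \<tau> selfadjoint_set_commutant[OF sa(2)] refl selfadjoint_set_commutant[OF sa(1)] refl
  have xx: "cinner \<xi> \<xi> = 1"
    by (simp add: cinner_self \<xi>)
  have "bounded_linear (\<lambda>v. cinner \<xi> v *\<^sub>C \<xi>)"
    using cinner_bound[of \<xi>] \<xi>
    by (intro bounded_linear_intro[where K = 1])
      (auto simp: cinner_add_right cinner_scaleR_right scaleC_add_left scaleC_scaleC[symmetric] scaleC_of_real)
  then have r_apply: "blinfun_apply (Blinfun (\<lambda>v. cinner \<xi> v *\<^sub>C \<xi>)) v = cinner \<xi> v *\<^sub>C \<xi>" for v
    by (simp add: bounded_linear_Blinfun_apply)
  define r where "r = Blinfun (\<lambda>v. cinner \<xi> v *\<^sub>C \<xi>)"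
  have r: "blinfun_apply r v = cinner \<xi> v *\<^sub>C \<xi>" for v
    unfolding r_def by (rule r_apply)
  have br: "r \<in> bounded_ops"
    by (simp add: bounded_ops_def r cinner_scaleC_right scaleC_scaleC)
  have ar: "adj r = r"
    by (rule adj_eqI[OF br, symmetric])
      (simp add: r cinner_scaleC_left cinner_scaleC_right cinner_commute[of _ \<xi>])
  \<comment> \<open>Irreducibility puts the rank-one \<open>r\<close> into the domain of
    \<open>\<tau>\<close>, which runs from the side of \<open>\<sigma>\<close> to that of
    \<open>\<rho>\<close>.\<close>
  have M: "commutant (commutant (range \<sigma>)) = bounded_ops"
    by (rule trivial_commutant_bicommutant[OF triv])
  have rr: "r o\<^sub>L r = r"
    by (rule blinfun_eqI) (simp add: r cinner_scaleC_right xx)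
  have "r \<noteq> 0"
    using r[of \<xi>] xx by auto
  define Q where "Q = \<tau> r"
  have "Q \<noteq> 0"
    using star_isomorphism_inj[OF iso, of r 0] star_isomorphism_zero[OF iso] \<open>r \<noteq> 0\<close> br M zero_in_commutant
    unfolding Q_def by metis
  have bQ: "Q \<in> bounded_ops"
    using star_isomorphism_mem[OF iso, of r] br M commutantD(1) unfolding Q_def by blast
  have aQ: "adj Q = Q"
    using star_isomorphism_adj[OF iso, of r] br M ar unfolding Q_def by simp
  have QQ: "Q o\<^sub>L Q = Q"
    using star_isomorphism_compose[OF iso, of r r] br M rr unfolding Q_def by simp
  have Q_state: "Q o\<^sub>L \<rho> a o\<^sub>L Q = cmul (cinner \<xi> (blinfun_apply (\<sigma> a) \<xi>)) o\<^sub>L Q" for a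
  proof -
    have "r o\<^sub>L \<sigma> a o\<^sub>L r = cmul (cinner \<xi> (blinfun_apply (\<sigma> a) \<xi>)) o\<^sub>L r"
      by (rule blinfun_eqI)
        (simp add: r bounded_opsD[OF rep_bounded_ops[OF \<sigma>]] cinner_scaleC_right scaleC_scaleC mult.commute)
    moreover have "\<tau> (r o\<^sub>L \<sigma> a o\<^sub>L r) = Q o\<^sub>L \<rho> a o\<^sub>L Q"
      by (simp add: star_isomorphism_compose[OF iso] M br bounded_ops_compose rep_bounded_ops[OF \<sigma>] \<tau>_\<sigma> Q_def)
    moreover have "\<tau> (cmul c o\<^sub>L r) = cmul c o\<^sub>L Q" for c
      using star_isomorphism_cmul_compose[OF iso, of r c] br M unfolding Q_def by simp
    ultimately show ?thesis
      by metis
  qed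
  obtain x where x: "blinfun_apply Q x \<noteq> 0"
    using \<open>Q \<noteq> 0\<close> by (metis blinfun_eqI zero_blinfun.rep_eq)
  define \<eta> where "\<eta> = (1 / norm (blinfun_apply Q x)) *\<^sub>R blinfun_apply Q x"
  have "norm \<eta> = 1"
    using x by (simp add: \<eta>_def)
  have "blinfun_apply Q (blinfun_apply Q x) = blinfun_apply Q x"
    using arg_cong[OF QQ, of "\<lambda>S. blinfun_apply S x"] by simp
  then have Q\<eta>: "blinfun_apply Q \<eta> = \<eta>"
    by (simp add: \<eta>_def blinfun.scaleR_right)
  show thesis
  proof (rule that[OF \<open>norm \<eta> = 1\<close>])
    fix a
    have "cinner \<eta> (blinfun_apply (\<rho> a) \<eta>) = cinner (blinfun_apply (adj Q) \<eta>) (blinfun_apply (\<rho> a) (blinfun_apply Q \<eta>))"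
      by (simp add: aQ Q\<eta>)
    also have "\<dots> = cinner \<eta> (blinfun_apply (Q o\<^sub>L \<rho> a o\<^sub>L Q) \<eta>)"
      by (simp add: cinner_adj[OF bQ])
    finally show "cinner \<eta> (blinfun_apply (\<rho> a) \<eta>) = cinner \<xi> (blinfun_apply (\<sigma> a) \<xi>)"
      using \<open>norm \<eta> = 1\<close> by (simp add: Q_state Q\<eta> cinner_scaleC_right cinner_self)
  qed
qed

theorem theorem4p5:
  fixes d :: "site \<Rightarrow> nat"
    and \<iota> :: "site set \<Rightarrow> local_op \<Rightarrow> 'a::cstar_algebra"
    and \<omega>\<^sub>0 :: "'a \<Rightarrow> complex"
    and \<pi>\<^sub>0 :: "'a \<Rightarrow> 'h::chilbert_space \<Rightarrow>\<^sub>L 'h" and \<Omega> :: 'h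
    and \<Lambda> :: "site set"
    and \<pi>\<^sub>1 :: "'a \<Rightarrow> 'h1::chilbert_space \<Rightarrow>\<^sub>L 'h1"
    and \<pi>\<^sub>2 :: "'a \<Rightarrow> 'h2::chilbert_space \<Rightarrow>\<^sub>L 'h2"
    and tens :: "'h1 \<Rightarrow> 'h2 \<Rightarrow> 't::chilbert_space"
    and \<sigma> :: "'a \<Rightarrow> 't \<Rightarrow>\<^sub>L 't"
    and \<pi> :: "'a \<Rightarrow> 'k::chilbert_space \<Rightarrow>\<^sub>L 'k"
  assumes "quantum_spin_system d \<iota>"
    and "pure_state \<omega>\<^sub>0"
    and "GNS_representation \<omega>\<^sub>0 \<pi>\<^sub>0 \<Omega>"
    and "is_cone \<Lambda>"
    and "irreducible_rep (algebra_of d \<iota> \<Lambda>) \<pi>\<^sub>1"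
    and "irreducible_rep (algebra_of d \<iota> (- \<Lambda>)) \<pi>\<^sub>2"
    and "hilbert_tensor tens"
    and "tensor_representation tens (algebra_of d \<iota> \<Lambda>) \<pi>\<^sub>1 (algebra_of d \<iota> (- \<Lambda>)) \<pi>\<^sub>2 \<sigma>"
    and "quasi_equivalent UNIV \<pi>\<^sub>0 \<sigma>"
    and "star_representation UNIV \<pi>"
    and "superselection_criterion d \<iota> \<pi>\<^sub>0 \<pi>"
  shows "quasi_equivalent UNIV \<pi> \<pi>\<^sub>0 \<and>
    (irreducible_rep UNIV \<pi> \<longrightarrow> unitarily_equivalent UNIV \<pi> \<pi>\<^sub>0)"
proof -
  interpret quantum_spin_system d \<iota> by fact
  let ?A = "algebra_of d \<iota>"
  note tens = \<open>hilbert_tensor tens\<close> and \<pi> = \<open>star_representation UNIV \<pi>\<close>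
  have \<pi>0: "star_representation UNIV \<pi>\<^sub>0"
    using assms(3) unfolding GNS_representation_def by blast
  have triv0: "trivial_commutant (range \<pi>\<^sub>0)"
    using assms(2,3) by (rule pure_state_trivial_commutant)
  have \<sigma>: "star_representation UNIV \<sigma>"
    and \<sigma>_prod: "\<And>a b x y. a \<in> ?A \<Lambda> \<Longrightarrow> b \<in> ?A (- \<Lambda>) \<Longrightarrow>
      blinfun_apply (\<sigma> (a * b)) (tens x y) = tens (blinfun_apply (\<pi>\<^sub>1 a) x) (blinfun_apply (\<pi>\<^sub>2 b) y)"
    using assms(8) unfolding tensor_representation_def by blast+
  have \<pi>1: "star_representation (?A \<Lambda>) \<pi>\<^sub>1" and \<pi>2: "star_representation (?A (- \<Lambda>)) \<pi>\<^sub>2"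
    and ne: "(UNIV :: 'h1 set) \<noteq> {0}" "(UNIV :: 'h2 set) \<noteq> {0}"
    using assms(5,6) unfolding irreducible_rep_def by auto
  note triv1 = irreducible_trivial_commutant[OF assms(5) star_in_algebra_of]
  note triv2 = irreducible_trivial_commutant[OF assms(6) star_in_algebra_of]
  have \<sigma>1: "blinfun_apply (\<sigma> a) (tens x y) = tens (blinfun_apply (\<pi>\<^sub>1 a) x) y" if "a \<in> ?A \<Lambda>" for a x y
    using \<sigma>_prod[OF that one_in_algebra_of] star_representation_one[OF \<pi>2 one_in_algebra_of] by simp
  have \<sigma>2: "blinfun_apply (\<sigma> b) (tens x y) = tens x (blinfun_apply (\<pi>\<^sub>2 b) y)" if "b \<in> ?A (- \<Lambda>)" for b x y
    using \<sigma>_prod[OF one_in_algebra_of that] star_representation_one[OF \<pi>1 one_in_algebra_of] by simp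

  \<comment> \<open>Product vector and rank-one projections for the tensor product
    representation\<close>
  obtain x1 :: 'h1 where "x1 \<noteq> 0"
    using ne(1) by auto
  then obtain \<xi>1 :: 'h1 where \<xi>1: "norm \<xi>1 = 1"
    using norm_sgn[of x1] by auto
  obtain x2 :: 'h2 where "x2 \<noteq> 0"
    using ne(2) by auto
  then obtain \<xi>2 :: 'h2 where \<xi>2: "norm \<xi>2 = 1"
    using norm_sgn[of x2] by auto
  define \<xi> where "\<xi> = tens \<xi>1 \<xi>2"
  have \<xi>: "norm \<xi> = 1"
    by (simp add: \<xi>_def norm_tens[OF tens] \<xi>1 \<xi>2)
  have triv\<sigma>: "trivial_commutant (range \<sigma>)"
    by (rule tens_trivial_commutant[OF tens \<sigma> \<pi>1 star_in_algebra_of triv1 \<sigma>1 \<pi>2 star_in_algebra_of triv2 \<sigma>2 \<xi>1])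
  define s1 where "s1 a = cinner \<xi>1 (blinfun_apply (\<pi>\<^sub>1 a) \<xi>1)" for a
  define s2 where "s2 b = cinner \<xi>2 (blinfun_apply (\<pi>\<^sub>2 b) \<xi>2)" for b
  obtain E\<sigma> where E\<sigma>: "E\<sigma> \<in> commutant (commutant (\<sigma> ` ?A \<Lambda>))" "adj E\<sigma> = E\<sigma>" "E\<sigma> o\<^sub>L E\<sigma> = E\<sigma>"
    "\<And>x y. blinfun_apply E\<sigma> (tens x y) = cinner \<xi>1 x *\<^sub>C tens \<xi>1 y"
    "\<And>a. a \<in> ?A \<Lambda> \<Longrightarrow> E\<sigma> o\<^sub>L \<sigma> a o\<^sub>L E\<sigma> = cmul (s1 a) o\<^sub>L E\<sigma>"
    unfolding s1_def using tens_projection[OF tens \<sigma> \<pi>1 star_in_algebra_of triv1 \<sigma>1 \<xi>1] by blast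
  obtain F\<sigma> where F\<sigma>: "F\<sigma> \<in> commutant (commutant (\<sigma> ` ?A (- \<Lambda>)))" "adj F\<sigma> = F\<sigma>" "F\<sigma> o\<^sub>L F\<sigma> = F\<sigma>"
    "\<And>y x. blinfun_apply F\<sigma> (tens x y) = cinner \<xi>2 y *\<^sub>C tens x \<xi>2"
    "\<And>b. b \<in> ?A (- \<Lambda>) \<Longrightarrow> F\<sigma> o\<^sub>L \<sigma> b o\<^sub>L F\<sigma> = cmul (s2 b) o\<^sub>L F\<sigma>"
    unfolding s2_def
    using tens_projection[OF hilbert_tensor_swap[OF tens] \<sigma> \<pi>2 star_in_algebra_of triv2 \<sigma>2 \<xi>2] by blast

  \<comment> \<open>Unitary transfer to the GNS representation\<close>
  obtain \<eta> where \<eta>: "norm \<eta> = 1"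
    "\<And>a. cinner \<eta> (blinfun_apply (\<pi>\<^sub>0 a) \<eta>) = cinner \<xi> (blinfun_apply (\<sigma> a) \<xi>)"
    using quasi_equivalent_irreducible_vector[OF \<pi>0 \<sigma> assms(9) triv\<sigma> \<xi>] by blast
  have "\<eta> \<noteq> 0" "\<xi> \<noteq> 0"
    using \<eta>(1) \<xi> by auto
  then obtain U where U: "U \<in> bounded_ops" "adj U o\<^sub>L U = id_blinfun" "U o\<^sub>L adj U = id_blinfun"
    "\<And>a. U o\<^sub>L \<pi>\<^sub>0 a = \<sigma> a o\<^sub>L U"
    using cyclic_unitary[OF \<pi>0 \<sigma> trivial_commutant_cyclic[OF \<pi>0 triv0] trivial_commutant_cyclic[OF \<sigma> triv\<sigma>] \<eta>(2)[symmetric]]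
    by blast
  have U1: "blinfun_apply (adj U) (blinfun_apply U x) = x" for x
    using arg_cong[OF U(2), of "\<lambda>S. blinfun_apply S x"] by simp
  have U2: "blinfun_apply U (blinfun_apply (adj U) x) = x" for x
    using arg_cong[OF U(3), of "\<lambda>S. blinfun_apply S x"] by simp
  have U3: "blinfun_apply U (blinfun_apply (\<pi>\<^sub>0 a) x) = blinfun_apply (\<sigma> a) (blinfun_apply U x)" for a x
    using arg_cong[OF U(4), of "\<lambda>S. blinfun_apply S x"] by simp
  have conj: "adj (adj U o\<^sub>L P o\<^sub>L U) = adj U o\<^sub>L P o\<^sub>L U"
      "(adj U o\<^sub>L P o\<^sub>L U) o\<^sub>L (adj U o\<^sub>L P o\<^sub>L U) = adj U o\<^sub>L P o\<^sub>L U"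
      "adj U o\<^sub>L P o\<^sub>L U \<noteq> 0"
      "P o\<^sub>L \<sigma> a o\<^sub>L P = cmul c o\<^sub>L P \<Longrightarrow>
        (adj U o\<^sub>L P o\<^sub>L U) o\<^sub>L \<pi>\<^sub>0 a o\<^sub>L (adj U o\<^sub>L P o\<^sub>L U) = cmul c o\<^sub>L (adj U o\<^sub>L P o\<^sub>L U)"
    if P: "P \<in> bounded_ops" "adj P = P" "P o\<^sub>L P = P" "blinfun_apply P \<xi> = \<xi>" for P a c
  proof -
    have PP: "blinfun_apply P (blinfun_apply P x) = blinfun_apply P x" for x
      using arg_cong[OF P(3), of "\<lambda>S. blinfun_apply S x"] by simp
    show "adj (adj U o\<^sub>L P o\<^sub>L U) = adj U o\<^sub>L P o\<^sub>L U"
      by (simp add: adj_compose adj_adj adj_in_bounded_ops bounded_ops_compose U(1) P(1,2) blinfun_compose_assoc)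
    show "(adj U o\<^sub>L P o\<^sub>L U) o\<^sub>L (adj U o\<^sub>L P o\<^sub>L U) = adj U o\<^sub>L P o\<^sub>L U"
      by (rule blinfun_eqI) (simp add: U2 PP)
    show "adj U o\<^sub>L P o\<^sub>L U \<noteq> 0"
    proof
      assume "adj U o\<^sub>L P o\<^sub>L U = 0"
      then have "blinfun_apply (adj U o\<^sub>L P o\<^sub>L U) (blinfun_apply (adj U) \<xi>) = 0"
        by simp
      then have "blinfun_apply (adj U) \<xi> = 0"
        by (simp add: U2 P(4))
      then show False
        using U2[of \<xi>] \<open>\<xi> \<noteq> 0\<close> by simp
    qed
    show "(adj U o\<^sub>L P o\<^sub>L U) o\<^sub>L \<pi>\<^sub>0 a o\<^sub>L (adj U o\<^sub>L P o\<^sub>L U) = cmul c o\<^sub>L (adj U o\<^sub>L P o\<^sub>L U)"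
      if eq: "P o\<^sub>L \<sigma> a o\<^sub>L P = cmul c o\<^sub>L P"
    proof (rule blinfun_eqI)
      fix x
      have "blinfun_apply P (blinfun_apply (\<sigma> a) (blinfun_apply P v)) = c *\<^sub>C blinfun_apply P v" for v
        using arg_cong[OF eq, of "\<lambda>S. blinfun_apply S v"] by simp
      then show "blinfun_apply ((adj U o\<^sub>L P o\<^sub>L U) o\<^sub>L \<pi>\<^sub>0 a o\<^sub>L (adj U o\<^sub>L P o\<^sub>L U)) x
          = blinfun_apply (cmul c o\<^sub>L (adj U o\<^sub>L P o\<^sub>L U)) x"
        by (simp add: U3 U2 bounded_opsD[OF adj_in_bounded_ops[OF U(1)]])
    qed
  qed
  define E0 where "E0 = adj U o\<^sub>L E\<sigma> o\<^sub>L U"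
  define F0 where "F0 = adj U o\<^sub>L F\<sigma> o\<^sub>L U"
  have "blinfun_apply E\<sigma> \<xi> = \<xi>" "blinfun_apply F\<sigma> \<xi> = \<xi>"
    by (simp_all add: \<xi>_def E\<sigma> F\<sigma> cinner_self \<xi>1 \<xi>2)
  note E0 = conj[OF commutantD(1)[OF E\<sigma>(1)] E\<sigma>(2,3) this(1), folded E0_def]
    and F0 = conj[OF commutantD(1)[OF F\<sigma>(1)] F\<sigma>(2,3) this(2), folded F0_def]
  have E0_mem: "E0 \<in> commutant (commutant (\<pi>\<^sub>0 ` ?A \<Lambda>))"
    unfolding E0_def using U E\<sigma>(1) by (rule unitary_conj_bicommutant)
  have F0_mem: "F0 \<in> commutant (commutant (\<pi>\<^sub>0 ` ?A (- \<Lambda>)))"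
    unfolding F0_def using U F\<sigma>(1) by (rule unitary_conj_bicommutant)
  define w where "w a = cinner \<eta> (blinfun_apply (\<pi>\<^sub>0 a) \<eta>)" for a
  have w_prod: "w (a * b) = s1 a * s2 b" if "a \<in> ?A \<Lambda>" "b \<in> ?A (- \<Lambda>)" for a b
    using that by (simp add: w_def \<eta>(2) \<xi>_def \<sigma>_prod cinner_tens[OF tens] s1_def s2_def)

  \<comment> \<open>Transport of the projections by the superselection criterion\<close>
  obtain \<Lambda>' where \<Lambda>': "is_cone \<Lambda>'" "\<Lambda> \<inter> \<Lambda>' = {}"
    using cone_disjoint_opposite[OF assms(4)] .
  have qe: "quasi_equivalent (?A (- X)) \<pi>\<^sub>0 \<pi>" if "is_cone X" for X
  proof (rule quasi_equivalent_sym[OF _ selfadjoint_set_algebra_of[OF \<pi>] selfadjoint_set_algebra_of[OF \<pi>0]])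
    show "quasi_equivalent (?A (- X)) \<pi> \<pi>\<^sub>0"
      using assms(11) that unfolding superselection_criterion_def by blast
  qed
  have sub: "\<Lambda> \<subseteq> - \<Lambda>'"
    using \<Lambda>'(2) by blast
  have "E0 \<in> commutant (commutant (\<pi>\<^sub>0 ` ?A (- \<Lambda>')))"
    using E0_mem bicommutant_algebra_of_mono[OF \<pi>0 sub] by blast
  from quasi_equivalent_transport[OF \<pi>0 \<pi> qe[OF \<Lambda>'(1)] this E0(1-3)]
  obtain E where E: "E \<in> commutant (commutant (\<pi> ` ?A (- \<Lambda>')))" "adj E = E" "E o\<^sub>L E = E" "E \<noteq> 0"
    "\<And>a c. a \<in> ?A (- \<Lambda>') \<Longrightarrow> E0 o\<^sub>L \<pi>\<^sub>0 a o\<^sub>L E0 = cmul c o\<^sub>L E0 \<Longrightarrow> E o\<^sub>L \<pi> a o\<^sub>L E = cmul c o\<^sub>L E"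
    "\<And>a. a \<in> ?A (- \<Lambda>') \<Longrightarrow> E0 o\<^sub>L \<pi>\<^sub>0 a = \<pi>\<^sub>0 a o\<^sub>L E0 \<Longrightarrow> E o\<^sub>L \<pi> a = \<pi> a o\<^sub>L E"
    by blast
  from quasi_equivalent_transport[OF \<pi>0 \<pi> qe[OF assms(4)] F0_mem F0(1-3)]
  obtain F where F: "F \<in> commutant (commutant (\<pi> ` ?A (- \<Lambda>)))" "adj F = F" "F o\<^sub>L F = F" "F \<noteq> 0"
    "\<And>a c. a \<in> ?A (- \<Lambda>) \<Longrightarrow> F0 o\<^sub>L \<pi>\<^sub>0 a o\<^sub>L F0 = cmul c o\<^sub>L F0 \<Longrightarrow> F o\<^sub>L \<pi> a o\<^sub>L F = cmul c o\<^sub>L F"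
    "\<And>a. a \<in> ?A (- \<Lambda>) \<Longrightarrow> F0 o\<^sub>L \<pi>\<^sub>0 a = \<pi>\<^sub>0 a o\<^sub>L F0 \<Longrightarrow> F o\<^sub>L \<pi> a = \<pi> a o\<^sub>L F"
    by blast
  have E_state: "E o\<^sub>L \<pi> a o\<^sub>L E = cmul (s1 a) o\<^sub>L E" if "a \<in> ?A \<Lambda>" for a
    using E(5) E0(4)[OF E\<sigma>(5)[OF that]] algebra_of_mono[OF sub] that by blast
  have F_state: "F o\<^sub>L \<pi> b o\<^sub>L F = cmul (s2 b) o\<^sub>L F" if "b \<in> ?A (- \<Lambda>)" for b
    using F(5)[OF that F0(4)[OF F\<sigma>(5)[OF that]]] .
  note bE = commutantD(1)[OF E(1)] and bF = commutantD(1)[OF F(1)]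

  txt \<open>\<open>E\<close> need not lie in \<open>\<pi>(A\<^sub>\<Lambda>)''\<close>, but it commutes with \<open>\<pi>(A)\<close> over \<open>- \<Lambda>\<close>: on \<open>\<Lambda>'\<close> by locality,
    and on the rest of \<open>- \<Lambda>\<close> because \<open>E0\<close> does.\<close>
  have E_comm: "E \<in> commutant (\<pi> ` ?A (- \<Lambda>))"
  proof -
    have "E \<in> commutant (\<pi> ` ?A \<Lambda>')"
      using E(1) bicommutant_subset_commutant[OF \<pi>, of "- \<Lambda>'" \<Lambda>'] by auto
    moreover have "E \<in> commutant (\<pi> ` ?A (- \<Lambda> - \<Lambda>'))"
      unfolding commutant_def
    proof (intro CollectI conjI ballI bE)
      fix S assume "S \<in> \<pi> ` ?A (- \<Lambda> - \<Lambda>')"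
      then obtain a where a: "a \<in> ?A (- \<Lambda> - \<Lambda>')" "S = \<pi> a"
        by blast
      have "E0 \<in> commutant (\<pi>\<^sub>0 ` ?A (- \<Lambda> - \<Lambda>'))"
        using E0_mem bicommutant_subset_commutant[OF \<pi>0, of \<Lambda> "- \<Lambda> - \<Lambda>'"] by auto
      then have "E0 o\<^sub>L \<pi>\<^sub>0 a = \<pi>\<^sub>0 a o\<^sub>L E0"
        using a(1) by (intro commutantD(2)) auto
      moreover have "a \<in> ?A (- \<Lambda>')"
        using a(1) algebra_of_mono[of "- \<Lambda> - \<Lambda>'" "- \<Lambda>'"] by auto
      ultimately show "E o\<^sub>L S = S o\<^sub>L E"
        using E(6) a(2) by blast
    qed
    ultimately have "E \<in> commutant (\<pi> ` ?A (\<Lambda>' \<union> (- \<Lambda> - \<Lambda>')))"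
      by (intro commutant_Un[OF \<pi>]) auto
    moreover have "\<Lambda>' \<union> (- \<Lambda> - \<Lambda>') = - \<Lambda>"
      using sub by blast
    ultimately show ?thesis
      by simp
  qed
  have F_comm: "F \<in> commutant (\<pi> ` ?A \<Lambda>)"
    using F(1) bicommutant_subset_commutant[OF \<pi>, of "- \<Lambda>" \<Lambda>] by auto
  have EF: "E o\<^sub>L F = F o\<^sub>L E"
    using commutantD(2)[OF F(1) E_comm] by simp
  have EF': "blinfun_apply F (blinfun_apply E x) = blinfun_apply E (blinfun_apply F x)" for x
    using commutantD(3)[OF F(1) E_comm] .
  have EE: "blinfun_apply E (blinfun_apply E x) = blinfun_apply E x" for x
    using arg_cong[OF E(3), of "\<lambda>S. blinfun_apply S x"] by simp
  have FF: "blinfun_apply F (blinfun_apply F x) = blinfun_apply F x" for x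
    using arg_cong[OF F(3), of "\<lambda>S. blinfun_apply S x"] by simp

  \<comment> \<open>The product projection and its state\<close>
  define G where "G = E o\<^sub>L F"
  have G_mem: "G \<in> commutant (commutant (range \<pi>))"
    unfolding G_def using E(1) F(1) bicommutant_mono[of "\<pi> ` _" "range \<pi>"]
    by (intro commutant_compose) blast+
  have G_adj: "adj G = G"
    by (simp add: G_def adj_compose bE bF E(2) F(2) EF)
  have GG: "G o\<^sub>L G = G"
    by (rule blinfun_eqI) (simp add: G_def EF' EE FF)
  note bG = commutantD(1)[OF G_mem]
  have G_prod: "G o\<^sub>L \<pi> (a * b) o\<^sub>L G = cmul (w (a * b)) o\<^sub>L G" if a: "a \<in> ?A \<Lambda>" and b: "b \<in> ?A (- \<Lambda>)" for a b
  proof (rule blinfun_eqI)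
    fix x
    have e: "blinfun_apply E (blinfun_apply (\<pi> a) (blinfun_apply E v)) = s1 a *\<^sub>C blinfun_apply E v" for v
      using arg_cong[OF E_state[OF a], of "\<lambda>S. blinfun_apply S v"] by simp
    have f: "blinfun_apply F (blinfun_apply (\<pi> b) (blinfun_apply F v)) = s2 b *\<^sub>C blinfun_apply F v" for v
      using arg_cong[OF F_state[OF b], of "\<lambda>S. blinfun_apply S v"] by simp
    have fa: "blinfun_apply F (blinfun_apply (\<pi> a) v) = blinfun_apply (\<pi> a) (blinfun_apply F v)" for v
      using commutantD(3)[OF F_comm imageI[OF a]] .
    have eb: "blinfun_apply E (blinfun_apply (\<pi> b) v) = blinfun_apply (\<pi> b) (blinfun_apply E v)" for v
      using commutantD(3)[OF E_comm imageI[OF b]] .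
    \<comment> \<open>\<open>F\<close> moves past \<open>\<pi> a\<close> and \<open>E\<close> past
      \<open>\<pi> b\<close>, which leaves the compression of \<open>\<pi> a\<close> by
      \<open>E\<close> followed by that of \<open>\<pi> b\<close> by \<open>F\<close>.\<close>
    have "blinfun_apply (G o\<^sub>L \<pi> (a * b) o\<^sub>L G) x
        = blinfun_apply E (blinfun_apply (\<pi> a) (blinfun_apply E (blinfun_apply F (blinfun_apply (\<pi> b) (blinfun_apply F x)))))"
      by (simp add: G_def rep_mult[OF \<pi>] fa eb[symmetric] EF')
    also have "\<dots> = (s1 a * s2 b) *\<^sub>C blinfun_apply E (blinfun_apply F x)"
      unfolding e f by (simp add: bounded_opsD[OF bE] scaleC_scaleC)
    finally show "blinfun_apply (G o\<^sub>L \<pi> (a * b) o\<^sub>L G) x = blinfun_apply (cmul (w (a * b)) o\<^sub>L G) x"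
      by (simp add: G_def w_prod a b)
  qed
  have G_state: "G o\<^sub>L \<pi> c o\<^sub>L G = cmul (cinner \<eta> (blinfun_apply (\<pi>\<^sub>0 c) \<eta>)) o\<^sub>L G" for c
  proof -
    \<comment> \<open>Both sides are linear and continuous in c, so products over
      \<open>\<Lambda>\<close> and \<open>- \<Lambda>\<close> suffice. Matrix elements turn
      closedness of the set into equality of continuous scalar functions.\<close>
    let ?S = "{c. \<forall>x y. cinner y (blinfun_apply G (blinfun_apply (\<pi> c) (blinfun_apply G x))) = w c * cinner y (blinfun_apply G x)}"
    have "?A (\<Lambda> \<union> - \<Lambda>) \<subseteq> ?S"
    proof (rule algebra_of_Un_subset)
      show "csubspace ?S"
        using rep_scaleR[OF \<pi>, of 0 0] rep_scaleR[OF \<pi>0, of 0 0] unfolding csubspace_def w_def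
        by (auto simp: rep_add[OF \<pi>] rep_add[OF \<pi>0] rep_scaleC[OF \<pi>] rep_scaleC[OF \<pi>0] blinfun.add_left
            blinfun.add_right cinner_add_right cinner_scaleC_right bounded_opsD[OF bG] distrib_right)
      show "closed ?S"
        unfolding w_def
        by (intro closed_Collect_all closed_Collect_eq continuous_intros blinfun.continuous_on
            bounded_linear.continuous_on[OF bounded_linear_rep[OF \<pi>]]
            bounded_linear.continuous_on[OF bounded_linear_rep[OF \<pi>0]])
      fix a b assume ab: "a \<in> ?A \<Lambda>" "b \<in> ?A (- \<Lambda>)"
      have "blinfun_apply G (blinfun_apply (\<pi> (a * b)) (blinfun_apply G x)) = w (a * b) *\<^sub>C blinfun_apply G x" for x
        using arg_cong[OF G_prod[OF ab], of "\<lambda>S. blinfun_apply S x"] by simp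
      then show "a * b \<in> ?S"
        by (simp add: cinner_scaleC_right)
    qed simp
    then have "c \<in> ?S"
      by (auto simp: embed_dense)
    show ?thesis
      by (rule blinfun_eqI, rule cinner_eqI)
        (use \<open>c \<in> ?S\<close> in \<open>simp add: w_def cinner_scaleC_right\<close>)
  qed
  \<comment> \<open>The factors are cancelled one at a time: \<open>E o\<^sub>L P\<close> commutes
    with \<open>\<pi>\<close> over \<open>- \<Lambda>\<close>, where \<open>F\<close> lives, and
    then \<open>P\<close> commutes with \<open>\<pi>\<close> over \<open>- \<Lambda>'\<close>, where
    \<open>E\<close> lives.\<close>
  have faithful: "P = 0" if P: "P \<in> commutant (range \<pi>)" and GP: "G o\<^sub>L P = 0" for P
  proof -
    have P': "P \<in> commutant (\<pi> ` X)" for X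
      using subsetD[OF commutant_antimono[OF image_mono[OF subset_UNIV]] P] .
    have "F o\<^sub>L (E o\<^sub>L P) = 0"
      using GP unfolding G_def EF by (simp add: blinfun_compose_assoc)
    then have "E o\<^sub>L P = 0"
      using quasi_equivalent_factor[OF \<pi>0 \<pi> triv0 qe[OF assms(4)] F(1,4) commutant_compose[OF E_comm P']] by blast
    then show ?thesis
      using quasi_equivalent_factor[OF \<pi>0 \<pi> triv0 qe[OF \<Lambda>'(1)] E(1,4) P'] by blast
  qed
  have "G \<noteq> 0"
  proof
    assume "G = 0"
    \<comment> \<open>Faithfulness applied to the identity: G = 0 would collapse the space of
      \<open>\<pi>\<close>, where \<open>E\<close> is nonzero.\<close>
    have "(id_blinfun :: 'k \<Rightarrow>\<^sub>L 'k) = 0"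
      by (rule faithful[OF id_in_commutant]) (simp add: \<open>G = 0\<close>)
    moreover have "E = E o\<^sub>L id_blinfun"
      by (rule blinfun_eqI) simp
    ultimately show False
      using E(4) by simp
  qed
  note * = \<pi>0 \<pi> triv0 \<eta>(1) G_mem G_adj GG G_state faithful this
  show ?thesis
  proof (intro conjI impI)
    show "quasi_equivalent UNIV \<pi> \<pi>\<^sub>0"
      by (rule quasi_equivalent_of_projection[OF *])
    show "unitarily_equivalent UNIV \<pi> \<pi>\<^sub>0" if "irreducible_rep UNIV \<pi>"
      by (rule unitarily_equivalent_of_projection[OF * that])
  qed
qed

end
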